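(* Let $G$ be a hyperbolic group acting freely and cocompactly on a connected locally finite graph $V$ such that for every $\gamma\in\partial V$ and all vertices $x,y$ of $V$ the sets $[x,\gamma)$ and $[y,\gamma)$ differ by a finite set (i.e. have finite symmetric difference). Then the action of $G$ on $\partial V$ induces a hyperfinite equivalence relation, i.e. the orbit equivalence relation $\{(a,b)\in\partial V\times\partial V : \exists g\in G,\ ga=b\}$ is hyperfinite.
   Context: A geodesic metric space is hyperbolic if there is $\delta>0$ such that in every geodesic triangle each side is contained in the $\delta$-neighbourhood of the union of the other two sides. A finitely generated group is hyperbolic if its Cayley graph with respect to some (equivalently any) finite generating set is hyperbolic. The graph $V$ is regarded as a geodesic metric space with edges of length 1, and $G$ acts on it by graph automorphisms. "Freely" means that the action on the set of vertices of $V$ is free; "cocompactly" means that there are finitely many orbits of vertices. Such an action is geometric, so $V$ is a hyperbolic space; $\partial V$ denotes its Gromov boundary (equivalence classes of geodesic rays, two rays being equivalent if they are at finite Hausdorff distance) with its usual compact metrizable topology, on which $G$ acts by homeomorphisms. For a vertex $x$ of $V$ and $\gamma\in\partial V$, the interval $[x,\gamma)$ is the set of all vertices of $V$ that lie on some geodesic ray (in the graph $V$) starting at $x$ and converging to $\gamma$. A Borel equivalence relation on a standard Borel space $Z$ is an equivalence relation that is a Borel subset of $Z^2$; it is finite if all its classes are finite. A Borel equivalence relation $E$ on $Z$ is hyperfinite if there is a sequence $F_0\subseteq F_1\subseteq\cdots$ of finite Borel equivalence relations on $Z$ with $E=\bigcup_n F_n$. *)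

theory Defs
  imports
    "HOL-Analysis.Analysis"
    "HOL-Algebra.Group_Action"
    "HOL-Algebra.Generated_Groups"
begin

section \<open>Geodesic and hyperbolic metric spaces\<close>

text \<open>Metric spaces are given by a carrier set and a distance function, as in the locale
  \<^locale>\<open>Metric_space\<close>.\<close>

definition geodesic_segment ::
  "'a set \<Rightarrow> ('a \<Rightarrow> 'a \<Rightarrow> real) \<Rightarrow> 'a \<Rightarrow> 'a \<Rightarrow> 'a set \<Rightarrow> bool" where
  "geodesic_segment M d x y A \<longleftrightarrow>
     (\<exists>c. c \<in> {0..d x y} \<rightarrow> M \<and> c 0 = x \<and> c (d x y) = y \<and>
          (\<forall>s\<in>{0..d x y}. \<forall>t\<in>{0..d x y}. d (c s) (c t) = \<bar>s - t\<bar>) \<and>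
          A = c ` {0..d x y})"

definition geodesic_space :: "'a set \<Rightarrow> ('a \<Rightarrow> 'a \<Rightarrow> real) \<Rightarrow> bool" where
  "geodesic_space M d \<longleftrightarrow>
     Metric_space M d \<and> (\<forall>x\<in>M. \<forall>y\<in>M. \<exists>A. geodesic_segment M d x y A)"

definition nbhd_of :: "'a set \<Rightarrow> ('a \<Rightarrow> 'a \<Rightarrow> real) \<Rightarrow> real \<Rightarrow> 'a set \<Rightarrow> 'a set" where
  "nbhd_of M d r A = {x \<in> M. \<exists>a\<in>A. d x a < r}"

definition hyperbolic_space :: "'a set \<Rightarrow> ('a \<Rightarrow> 'a \<Rightarrow> real) \<Rightarrow> bool" where
  "hyperbolic_space M d \<longleftrightarrow>
     geodesic_space M d \<and>
     (\<exists>\<delta>>0. \<forall>x\<in>M. \<forall>y\<in>M. \<forall>z\<in>M. \<forall>A B C.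
        geodesic_segment M d x y A \<longrightarrow> geodesic_segment M d y z B \<longrightarrow>
        geodesic_segment M d z x C \<longrightarrow>
        A \<subseteq> nbhd_of M d \<delta> (B \<union> C) \<and>
        B \<subseteq> nbhd_of M d \<delta> (C \<union> A) \<and>
        C \<subseteq> nbhd_of M d \<delta> (A \<union> B))"


section \<open>The Gromov boundary\<close>

text \<open>Rays are functions on \<open>{0..}\<close>, made total by \<^const>\<open>extensional\<close>, so that a
  point of the boundary is a set of rays without spurious copies.\<close>

definition geodesic_rays :: "'a set \<Rightarrow> ('a \<Rightarrow> 'a \<Rightarrow> real) \<Rightarrow> (real \<Rightarrow> 'a) set" where
  "geodesic_rays M d =
     {c \<in> {0..} \<rightarrow>\<^sub>E M. \<forall>s\<ge>0. \<forall>t\<ge>0. d (c s) (c t) = \<bar>s - t\<bar>}"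

text \<open>Finite Hausdorff distance of the images: each lies in a bounded neighbourhood of the other.\<close>

definition ray_equiv :: "'a set \<Rightarrow> ('a \<Rightarrow> 'a \<Rightarrow> real) \<Rightarrow> (real \<Rightarrow> 'a) rel" where
  "ray_equiv M d =
     {(c, c'). c \<in> geodesic_rays M d \<and> c' \<in> geodesic_rays M d \<and>
        (\<exists>r. c ` {0..} \<subseteq> nbhd_of M d r (c' ` {0..}) \<and>
             c' ` {0..} \<subseteq> nbhd_of M d r (c ` {0..}))}"

definition gromov_boundary :: "'a set \<Rightarrow> ('a \<Rightarrow> 'a \<Rightarrow> real) \<Rightarrow> (real \<Rightarrow> 'a) set set" where
  "gromov_boundary M d = geodesic_rays M d // ray_equiv M d"

text \<open>The usual topology on the boundary of a proper hyperbolic geodesic space: the quotient of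
  the space of rays issuing from a base point \<open>p\<close>, with the topology of uniform
  convergence on compact sets.  For such spaces it does not depend on \<open>p\<close>.\<close>

definition open_in_boundary ::
  "'a set \<Rightarrow> ('a \<Rightarrow> 'a \<Rightarrow> real) \<Rightarrow> 'a \<Rightarrow> (real \<Rightarrow> 'a) set set \<Rightarrow> bool" where
  "open_in_boundary M d p U \<longleftrightarrow>
     U \<subseteq> gromov_boundary M d \<and>
     (\<forall>c\<in>geodesic_rays M d. c 0 = p \<and> ray_equiv M d `` {c} \<in> U \<longrightarrow>
        (\<exists>T. \<exists>e>0. \<forall>c'\<in>geodesic_rays M d.
           c' 0 = p \<and> (\<forall>t\<in>{0..T}. d (c t) (c' t) < e) \<longrightarrow> ray_equiv M d `` {c'} \<in> U))"

lemma istopology_open_in_boundary: "istopology (open_in_boundary M d p)"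
  unfolding istopology_def
proof (intro conjI allI impI)
  fix U V assume U: "open_in_boundary M d p U" and V: "open_in_boundary M d p V"
  show "open_in_boundary M d p (U \<inter> V)"
    unfolding open_in_boundary_def
  proof (intro conjI ballI impI)
    show "U \<inter> V \<subseteq> gromov_boundary M d"
      using U by (auto simp: open_in_boundary_def)
    fix c assume c: "c \<in> geodesic_rays M d" "c 0 = p \<and> ray_equiv M d `` {c} \<in> U \<inter> V"
    obtain T e where 1: "e > 0" "\<And>c'. \<lbrakk>c' \<in> geodesic_rays M d; c' 0 = p;
        \<forall>t\<in>{0..T}. d (c t) (c' t) < e\<rbrakk> \<Longrightarrow> ray_equiv M d `` {c'} \<in> U"
      using U c unfolding open_in_boundary_def by (metis IntD1)
    obtain S f where 2: "f > 0" "\<And>c'. \<lbrakk>c' \<in> geodesic_rays M d; c' 0 = p;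
        \<forall>t\<in>{0..S}. d (c t) (c' t) < f\<rbrakk> \<Longrightarrow> ray_equiv M d `` {c'} \<in> V"
      using V c unfolding open_in_boundary_def by (metis IntD2)
    show "\<exists>T. \<exists>e>0. \<forall>c'\<in>geodesic_rays M d.
       c' 0 = p \<and> (\<forall>t\<in>{0..T}. d (c t) (c' t) < e) \<longrightarrow> ray_equiv M d `` {c'} \<in> U \<inter> V"
      by (rule exI[of _ "max T S"], rule exI[of _ "min e f"]) (use 1 2 in \<open>auto simp: le_max_iff_disj\<close>)
  qed
next
  fix K assume K: "\<forall>U\<in>K. open_in_boundary M d p U"
  show "open_in_boundary M d p (\<Union>K)"
    unfolding open_in_boundary_def
  proof (intro conjI ballI impI)
    show "\<Union>K \<subseteq> gromov_boundary M d"
      using K by (auto simp: open_in_boundary_def)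
    fix c assume c: "c \<in> geodesic_rays M d" "c 0 = p \<and> ray_equiv M d `` {c} \<in> \<Union>K"
    then obtain U where U: "U \<in> K" "ray_equiv M d `` {c} \<in> U"
      by blast
    then have "open_in_boundary M d p U"
      using K by blast
    with U c obtain T e where "e > 0" "\<forall>c'\<in>geodesic_rays M d.
        c' 0 = p \<and> (\<forall>t\<in>{0..T}. d (c t) (c' t) < e) \<longrightarrow> ray_equiv M d `` {c'} \<in> U"
      unfolding open_in_boundary_def by blast
    with \<open>U \<in> K\<close> show "\<exists>T. \<exists>e>0. \<forall>c'\<in>geodesic_rays M d.
       c' 0 = p \<and> (\<forall>t\<in>{0..T}. d (c t) (c' t) < e) \<longrightarrow> ray_equiv M d `` {c'} \<in> \<Union>K"
      by blast
  qed
qed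

definition boundary_topology ::
  "'a set \<Rightarrow> ('a \<Rightarrow> 'a \<Rightarrow> real) \<Rightarrow> 'a \<Rightarrow> (real \<Rightarrow> 'a) set topology" where
  "boundary_topology M d p = topology (open_in_boundary M d p)"

lemma openin_boundary_topology:
  "openin (boundary_topology M d p) = open_in_boundary M d p"
  by (simp add: boundary_topology_def istopology_open_in_boundary topology_inverse')


section \<open>Graphs as geodesic metric spaces\<close>

definition simple_graph :: "'v set \<Rightarrow> 'v set set \<Rightarrow> bool" where
  "simple_graph V E \<longleftrightarrow> (\<forall>e\<in>E. e \<subseteq> V \<and> card e = 2)"

definition connected_graph :: "'v set \<Rightarrow> 'v set set \<Rightarrow> bool" where
  "connected_graph V E \<longleftrightarrow>
     V \<noteq> {} \<and> (\<forall>u\<in>V. \<forall>v\<in>V. (u, v) \<in> {(x, y). {x, y} \<in> E}\<^sup>*)"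

definition locally_finite_graph :: "'v set \<Rightarrow> 'v set set \<Rightarrow> bool" where
  "locally_finite_graph V E \<longleftrightarrow> (\<forall>v\<in>V. finite {e \<in> E. v \<in> e})"

text \<open>Points of the geometric realization are given by barycentric coordinates: \<open>x v\<close> is
  the weight of the vertex \<open>v\<close>, and the vertices of positive weight are a single vertex or the
  two ends of an edge.\<close>

definition supp :: "('v \<Rightarrow> real) \<Rightarrow> 'v set" where
  "supp x = {v. x v \<noteq> 0}"

definition graph_points :: "'v set \<Rightarrow> 'v set set \<Rightarrow> ('v \<Rightarrow> real) set" where
  "graph_points V E =
     {x. (\<forall>v. 0 \<le> x v) \<and> (supp x \<in> E \<or> (\<exists>v\<in>V. supp x = {v})) \<and> sum x (supp x) = 1}"

definition vertex_point :: "'v \<Rightarrow> 'v \<Rightarrow> real" where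
  "vertex_point v = indicator {v}"

text \<open>\<open>broken_path V E x y l\<close>: there is a path of length \<open>l\<close> from \<open>x\<close> to \<open>y\<close> made of finitely many
  straight pieces, each inside one closed edge.  An edge \<open>{u, w}\<close> is identified with the unit
  interval by the coordinate at \<open>u\<close> (or, reversing the orientation, at \<open>w\<close>).\<close>

inductive broken_path ::
  "'v set \<Rightarrow> 'v set set \<Rightarrow> ('v \<Rightarrow> real) \<Rightarrow> ('v \<Rightarrow> real) \<Rightarrow> real \<Rightarrow> bool"
  for V E x where
  trivial: "x \<in> graph_points V E \<Longrightarrow> broken_path V E x x 0"
| piece: "\<lbrakk>broken_path V E x y l; z \<in> graph_points V E; e \<in> E; supp y \<union> supp z \<subseteq> e; u \<in> e\<rbrakk>
          \<Longrightarrow> broken_path V E x z (l + \<bar>y u - z u\<bar>)"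

text \<open>The length metric; the value off the carrier is a dummy, chosen to comply with
  \<^locale>\<open>Metric_space\<close>.\<close>

definition graph_dist :: "'v set \<Rightarrow> 'v set set \<Rightarrow> ('v \<Rightarrow> real) \<Rightarrow> ('v \<Rightarrow> real) \<Rightarrow> real" where
  "graph_dist V E x y =
     (if x \<in> graph_points V E \<and> y \<in> graph_points V E then Inf {l. broken_path V E x y l} else 0)"

abbreviation graph_rays :: "'v set \<Rightarrow> 'v set set \<Rightarrow> (real \<Rightarrow> 'v \<Rightarrow> real) set" where
  "graph_rays V E \<equiv> geodesic_rays (graph_points V E) (graph_dist V E)"

abbreviation graph_boundary :: "'v set \<Rightarrow> 'v set set \<Rightarrow> (real \<Rightarrow> 'v \<Rightarrow> real) set set" where
  "graph_boundary V E \<equiv> gromov_boundary (graph_points V E) (graph_dist V E)"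

text \<open>The interval \<open>[x, \<gamma>)\<close>.\<close>

definition ray_interval ::
  "'v set \<Rightarrow> 'v set set \<Rightarrow> 'v \<Rightarrow> (real \<Rightarrow> 'v \<Rightarrow> real) set \<Rightarrow> 'v set" where
  "ray_interval V E x \<gamma> =
     {v \<in> V. \<exists>c\<in>graph_rays V E. c 0 = vertex_point x \<and> c \<in> \<gamma> \<and> vertex_point v \<in> c ` {0..}}"


section \<open>Hyperbolic groups and actions on graphs\<close>

definition cayley_edges :: "('g, 'b) monoid_scheme \<Rightarrow> 'g set \<Rightarrow> 'g set set" where
  "cayley_edges G S = {{g, g \<otimes>\<^bsub>G\<^esub> s} | g s. g \<in> carrier G \<and> s \<in> S \<and> s \<noteq> \<one>\<^bsub>G\<^esub>}"

definition hyperbolic_group :: "('g, 'b) monoid_scheme \<Rightarrow> bool" where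
  "hyperbolic_group G \<longleftrightarrow> group G \<and>
     (\<exists>S. finite S \<and> S \<subseteq> carrier G \<and> generate G S = carrier G \<and>
          hyperbolic_space (graph_points (carrier G) (cayley_edges G S))
            (graph_dist (carrier G) (cayley_edges G S)))"

definition acts_by_automorphisms ::
  "('g, 'b) monoid_scheme \<Rightarrow> 'v set \<Rightarrow> 'v set set \<Rightarrow> ('g \<Rightarrow> 'v \<Rightarrow> 'v) \<Rightarrow> bool" where
  "acts_by_automorphisms G V E \<phi> \<longleftrightarrow> group_action G V \<phi> \<and>
     (\<forall>g\<in>carrier G. \<forall>u\<in>V. \<forall>v\<in>V. {\<phi> g u, \<phi> g v} \<in> E \<longleftrightarrow> {u, v} \<in> E)"

definition acts_freely ::
  "('g, 'b) monoid_scheme \<Rightarrow> 'v set \<Rightarrow> ('g \<Rightarrow> 'v \<Rightarrow> 'v) \<Rightarrow> bool" where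
  "acts_freely G V \<phi> \<longleftrightarrow> (\<forall>v\<in>V. stabilizer G \<phi> v = {\<one>\<^bsub>G\<^esub>})"

definition acts_cocompactly ::
  "('g, 'b) monoid_scheme \<Rightarrow> 'v set \<Rightarrow> ('g \<Rightarrow> 'v \<Rightarrow> 'v) \<Rightarrow> bool" where
  "acts_cocompactly G V \<phi> \<longleftrightarrow> finite (orbits G V \<phi>)"

text \<open>The affine extension to the realization: the weight of \<open>v\<close> in \<open>g x\<close> is the weight
  of \<open>g\<^sup>-\<^sup>1 v\<close> in \<open>x\<close>.\<close>

definition point_action ::
  "('g, 'b) monoid_scheme \<Rightarrow> 'v set \<Rightarrow> ('g \<Rightarrow> 'v \<Rightarrow> 'v) \<Rightarrow> 'g \<Rightarrow> ('v \<Rightarrow> real) \<Rightarrow> 'v \<Rightarrow> real" where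
  "point_action G V \<phi> g x = (\<lambda>v. if v \<in> V then x (\<phi> (inv\<^bsub>G\<^esub> g) v) else 0)"

definition boundary_action ::
  "('g, 'b) monoid_scheme \<Rightarrow> 'v set \<Rightarrow> ('g \<Rightarrow> 'v \<Rightarrow> 'v) \<Rightarrow> 'g \<Rightarrow>
     (real \<Rightarrow> 'v \<Rightarrow> real) set \<Rightarrow> (real \<Rightarrow> 'v \<Rightarrow> real) set" where
  "boundary_action G V \<phi> g \<gamma> = (\<lambda>c. \<lambda>t\<in>{0..}. point_action G V \<phi> g (c t)) ` \<gamma>"

definition orbit_relation :: "('g, 'b) monoid_scheme \<Rightarrow> 'z set \<Rightarrow> ('g \<Rightarrow> 'z \<Rightarrow> 'z) \<Rightarrow> 'z rel" where
  "orbit_relation G Z \<psi> = {(a, b) \<in> Z \<times> Z. \<exists>g\<in>carrier G. \<psi> g a = b}"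


section \<open>Hyperfinite equivalence relations\<close>

text \<open>The measure carried by a \<^typ>\<open>'z measure\<close> plays no role below; only its
  \<open>\<sigma>\<close>-algebra does.  For a standard Borel space \<open>Z\<close> the Borel subsets of \<open>Z \<times> Z\<close> are
  the members of the product \<open>\<sigma>\<close>-algebra.\<close>

definition borel_space_of :: "'z topology \<Rightarrow> 'z measure" where
  "borel_space_of X = sigma (topspace X) {U. openin X U}"

definition borel_equiv :: "'z measure \<Rightarrow> 'z rel \<Rightarrow> bool" where
  "borel_equiv Z R \<longleftrightarrow> equiv (space Z) R \<and> R \<in> sets (Z \<Otimes>\<^sub>M Z)"

definition finite_borel_equiv :: "'z measure \<Rightarrow> 'z rel \<Rightarrow> bool" where
  "finite_borel_equiv Z R \<longleftrightarrow> borel_equiv Z R \<and> (\<forall>z\<in>space Z. finite (R `` {z}))"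

definition hyperfinite :: "'z measure \<Rightarrow> 'z rel \<Rightarrow> bool" where
  "hyperfinite Z R \<longleftrightarrow> borel_equiv Z R \<and>
     (\<exists>F :: nat \<Rightarrow> 'z rel. (\<forall>n. finite_borel_equiv Z (F n)) \<and> (\<forall>n. F n \<subseteq> F (Suc n)) \<and>
        R = (\<Union>n. F n))"

end

theory Submission
  imports Defs
begin

text \<open>
  The orbit relation on the boundary is written as an increasing union of finite Borel relations by
  attaching to every boundary point \<open>\<gamma>\<close> a sequence of nonempty finite sets of group elements, its
  markers, where the marker of level 0 is the neutral element.  Two points are identified at stage
  \<open>n\<close> if one group element carries the first point to the second and the markers of all levels
  \<open>\<ge> n\<close> of the first to those of the second.  If any two points of an orbit are identified at
  some stage, this exhausts the orbit relation.  The classes of stage \<open>n\<close> may be infinite, but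
  they become finite when only points are related whose markers make small jumps from each level below
  \<open>n\<close> to the next one: descending from level \<open>n\<close> there are finitely many choices in each step,
  and the marker of level 0 determines the group element.  This is the content of the locale
  \<open>marked_action\<close>, which is purely about countable groups.

  The markers come from the intervals \<open>[x, \<gamma>)\<close>.  A word is a finite list of vertices, and a
  group element \<open>g\<close> is an occurrence of \<open>w\<close> if \<open>g w\<close> is an initial segment of a geodesic ray to
  \<open>\<gamma>\<close>; it is an occurrence in \<open>[x, \<gamma>)\<close> if moreover the path \<open>g w\<close> starts there.  As
  changing \<open>x\<close> changes \<open>[x, \<gamma>)\<close> only by a finite set, it does not depend on \<open>x\<close> whether \<open>w\<close>
  occurs infinitely often in \<open>[x, \<gamma>)\<close>.  Choosing letters greedily one gets longer and longer words
  that occur infinitely often, and they are the same for all points of an orbit.  If some \<open>g\<close> is an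
  occurrence of all of them, then the infinite word, translated by \<open>g\<close>, is a ray to \<open>\<gamma>\<close>, and one
  such \<open>g\<close> is used as the marker at all positive levels: two points of an orbit then have the same
  infinite word and are carried to each other by the group element that carries one marker to the
  other.  Otherwise every group element fails to be an occurrence of all sufficiently long words.  The
  occurrences of the \<open>n\<close>-th word in \<open>[x, \<gamma>)\<close> and in \<open>[y, \<gamma>)\<close>, which differ by finitely
  many elements, therefore agree for large \<open>n\<close>.  From this infinite set of occurrences \<open>S\<close> one
  selects the markers by a rule that mentions no base point: those \<open>g\<close> for which the fewest elements of
  \<open>S\<close> are missed by the interval from the first vertex of \<open>g w\<close> to \<open>\<gamma>\<close>.

  Hyperbolicity enters only through the fact that equivalent rays stay within a distance that depends
  only on the distance of their starting points (\<open>fellow_travel\<close>).  It makes the rays to a fixed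
  point a closed set, so that the boundary points having a ray with a given initial segment form a closed
  set, and everything above is Borel, being built from these closed sets by countable operations; and it
  shows that the selected set of markers is finite.  That the graph \<open>V\<close> is itself hyperbolic follows
  from the hyperbolicity of the group by the Svarc-Milnor argument and the stability of quasi-geodesics
  (\<open>thin_quasi_isometry\<close>).

  All arguments are carried out for vertices and the combinatorial distance.  The geometric
  realization is used only to translate the hypotheses: thin triangles in a realized Cayley graph become
  thin intervals, and a boundary point becomes the set of discrete rays that represent it.\<close>

section \<open>Graphs with the combinatorial metric\<close>

definition adjacency :: "'v set set \<Rightarrow> 'v rel" where
  "adjacency E = {(x, y). {x, y} \<in> E}"

definition gdist :: "'v set set \<Rightarrow> 'v \<Rightarrow> 'v \<Rightarrow> nat" where
  "gdist E u v = (LEAST n. (u, v) \<in> adjacency E ^^ n)"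

definition discrete_ray :: "'v set \<Rightarrow> 'v set set \<Rightarrow> (nat \<Rightarrow> 'v) \<Rightarrow> bool" where
  "discrete_ray V E f \<longleftrightarrow> (\<forall>i. f i \<in> V) \<and> (\<forall>i j. i \<le> j \<longrightarrow> gdist E (f i) (f j) = j - i)"

definition discrete_geodesic :: "'v set \<Rightarrow> 'v set set \<Rightarrow> nat \<Rightarrow> (nat \<Rightarrow> 'v) \<Rightarrow> bool" where
  "discrete_geodesic V E n f \<longleftrightarrow>
     (\<forall>i\<le>n. f i \<in> V) \<and> (\<forall>i j. i \<le> j \<longrightarrow> j \<le> n \<longrightarrow> gdist E (f i) (f j) = j - i)"

text \<open>The union of all geodesics from \<open>x\<close> to \<open>y\<close>.\<close>

definition geo_interval :: "'v set \<Rightarrow> 'v set set \<Rightarrow> 'v \<Rightarrow> 'v \<Rightarrow> 'v set" where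
  "geo_interval V E x y = {u \<in> V. gdist E x u + gdist E u y = gdist E x y}"

lemma adjacency_sym: "(x, y) \<in> adjacency E \<Longrightarrow> (y, x) \<in> adjacency E"
  by (simp add: adjacency_def insert_commute)

lemma relpow_sym_rel:
  assumes "\<And>x y. (x, y) \<in> Q \<Longrightarrow> (y, x) \<in> Q" "(x, y) \<in> Q ^^ n"
  shows "(y, x) \<in> Q ^^ n"
  using assms(2)
proof (induction n arbitrary: x y)
  case (Suc n)
  then obtain z where "(x, z) \<in> Q ^^ n" "(z, y) \<in> Q" by auto
  with Suc.IH[of x z] assms(1) show ?case by (metis relpow_Suc_I2)
qed auto

lemma adjacency_relpow_sym: "(x, y) \<in> adjacency E ^^ n \<Longrightarrow> (y, x) \<in> adjacency E ^^ n"
  by (rule relpow_sym_rel[OF adjacency_sym])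

lemma gdist_le: "(u, v) \<in> adjacency E ^^ n \<Longrightarrow> gdist E u v \<le> n"
  unfolding gdist_def by (rule Least_le)

lemma gdist_self [simp]: "gdist E u u = 0"
  using gdist_le[of u u 0 E] by simp

lemma gdist_sym: "gdist E u v = gdist E v u"
  unfolding gdist_def by (meson adjacency_relpow_sym)

locale connected_simple_graph =
  fixes V :: "'v set" and E :: "'v set set"
  assumes simple: "simple_graph V E" and connected: "connected_graph V E"
begin

abbreviation D :: "'v \<Rightarrow> 'v \<Rightarrow> nat" where "D \<equiv> gdist E"

lemma edgeE:
  assumes "e \<in> E" "u \<in> e"
  obtains w where "e = {u, w}" "u \<noteq> w" "u \<in> V" "w \<in> V"
proof -
  have "card e = 2" "e \<subseteq> V"
    using simple assms(1) by (auto simp: simple_graph_def)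
  then obtain a b where "e = {a, b}" "a \<noteq> b"
    by (meson card_2_iff)
  with assms(2) \<open>e \<subseteq> V\<close> that[of a] that[of b] show ?thesis
    by (auto simp: insert_commute)
qed

lemma adjacency_V: "(x, y) \<in> adjacency E \<Longrightarrow> x \<in> V \<and> y \<in> V \<and> x \<noteq> y"
  using simple unfolding adjacency_def simple_graph_def by fastforce

lemma gdist_relpow:
  assumes "u \<in> V" "v \<in> V"
  shows "(u, v) \<in> adjacency E ^^ D u v"
proof -
  have "(u, v) \<in> (adjacency E)\<^sup>*"
    using connected assms by (auto simp: connected_graph_def adjacency_def)
  then obtain n where "(u, v) \<in> adjacency E ^^ n"
    using rtrancl_imp_relpow by blast
  then show ?thesis
    unfolding gdist_def by (rule LeastI)
qed

lemma gdist_triangle: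
  assumes "u \<in> V" "v \<in> V" "w \<in> V"
  shows "D u w \<le> D u v + D v w"
proof -
  have "(u, w) \<in> adjacency E ^^ (D u v + D v w)"
    using gdist_relpow assms by (auto simp: relpow_add)
  then show ?thesis
    by (rule gdist_le)
qed

lemma gdist_eq_0: "\<lbrakk>u \<in> V; v \<in> V\<rbrakk> \<Longrightarrow> D u v = 0 \<longleftrightarrow> u = v"
  using gdist_relpow[of u v] by auto

lemma gdist_edge: "{u, v} \<in> E \<Longrightarrow> D u v = 1"
proof -
  assume "{u, v} \<in> E"
  then have a: "(u, v) \<in> adjacency E"
    by (simp add: adjacency_def)
  then have "D u v \<le> 1"
    using gdist_le[of u v 1 E] by simp
  moreover have "D u v \<noteq> 0"
    using adjacency_V[OF a] gdist_eq_0 by auto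
  ultimately show ?thesis
    by simp
qed

lemma gdist_1_edge: "\<lbrakk>u \<in> V; v \<in> V; D u v = 1\<rbrakk> \<Longrightarrow> {u, v} \<in> E"
  using gdist_relpow[of u v] by (auto simp: adjacency_def)

lemma path_gdist_le:
  assumes "\<forall>i<n. (f i, f (Suc i)) \<in> adjacency E" "i \<le> j" "j \<le> n"
  shows "D (f i) (f j) \<le> j - i"
proof -
  have "(f i, f j) \<in> adjacency E ^^ (j - i)"
    unfolding relpow_fun_conv using assms
    by (intro exI[of _ "\<lambda>k. f (i + k)"]) auto
  then show ?thesis
    by (rule gdist_le)
qed

text \<open>Concatenating shortest walks from \<open>x\<close> to \<open>u\<close> and from \<open>u\<close> to \<open>y\<close> gives a walk whose
  length is the distance of its ends, and such a walk has no shortcut.\<close>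

lemma geodesic_through:
  assumes "x \<in> V" "y \<in> V" "u \<in> geo_interval V E x y"
  obtains f where "discrete_geodesic V E (D x y) f" "f 0 = x" "f (D x y) = y" "f (D x u) = u"
proof -
  let ?n = "D x y" and ?k = "D x u"
  have u: "u \<in> V" "?k + D u y = ?n"
    using assms by (auto simp: geo_interval_def)
  obtain f where f: "f 0 = x" "f ?k = u" "\<forall>i<?k. (f i, f (Suc i)) \<in> adjacency E"
    using gdist_relpow[OF assms(1) u(1)] unfolding relpow_fun_conv by blast
  obtain g where g: "g 0 = u" "g (D u y) = y" "\<forall>i<D u y. (g i, g (Suc i)) \<in> adjacency E"
    using gdist_relpow[OF u(1) assms(2)] unfolding relpow_fun_conv by blast
  define h where "h i = (if i \<le> ?k then f i else g (i - ?k))" for i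
  have step: "\<forall>i<?n. (h i, h (Suc i)) \<in> adjacency E"
  proof (intro allI impI)
    fix i assume i: "i < ?n"
    consider "i < ?k" | "i = ?k" | "i > ?k" by linarith
    then show "(h i, h (Suc i)) \<in> adjacency E"
    proof cases
      case 1 then show ?thesis using f by (simp add: h_def)
    next
      case 2 then show ?thesis using f g i u by (auto simp: h_def)
    next
      case 3
      then have "Suc i - ?k = Suc (i - ?k)" by simp
      then show ?thesis using 3 g i u by (auto simp: h_def)
    qed
  qed
  have ends: "h 0 = x" "h ?k = u"
    using f by (auto simp: h_def)
  moreover have "h ?n = y"
  proof (cases "D u y = 0")
    case True
    then show ?thesis using f g u by (simp add: h_def)
  next
    case False
    then have "\<not> ?n \<le> ?k" "?n - ?k = D u y" using u(2) by auto
    then show ?thesis using g by (simp add: h_def)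
  qed
  ultimately have ends: "h 0 = x" "h ?n = y" "h ?k = u"
    by auto
  have hV: "h i \<in> V" if "i \<le> ?n" for i
  proof (cases "i = ?n")
    case True then show ?thesis using ends assms by simp
  next
    case False then show ?thesis using step that adjacency_V by (metis le_neq_implies_less)
  qed
  have "D (h i) (h j) = j - i" if ij: "i \<le> j" "j \<le> ?n" for i j
  proof -
    have "D (h i) (h j) \<le> j - i" "D x (h i) \<le> i" "D (h j) y \<le> ?n - j"
      using path_gdist_le[OF step, of 0 i] path_gdist_le[OF step, of i j]
        path_gdist_le[OF step, of j ?n] ij ends by auto
    moreover have "?n \<le> D x (h i) + D (h i) (h j) + D (h j) y"
      using gdist_triangle[of x "h i" y] gdist_triangle[of "h i" "h j" y] hV ij assms by simp
    ultimately show ?thesis using ij by linarith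
  qed
  then show ?thesis
    using that[of h] ends hV by (simp add: discrete_geodesic_def)
qed

lemma geodesic_exists:
  assumes "x \<in> V" "y \<in> V"
  obtains f where "discrete_geodesic V E (D x y) f" "f 0 = x" "f (D x y) = y"
proof -
  have "x \<in> geo_interval V E x y"
    using assms by (simp add: geo_interval_def)
  then show ?thesis
    using geodesic_through[OF assms] that by metis
qed

lemma geodesic_in_geo_interval:
  assumes "discrete_geodesic V E n f" "i \<le> j" "j \<le> k" "k \<le> n"
  shows "f j \<in> geo_interval V E (f i) (f k)"
  using assms by (auto simp: discrete_geodesic_def geo_interval_def)

lemma discrete_ray_geodesic: "discrete_ray V E f \<Longrightarrow> discrete_geodesic V E n f"
  by (simp add: discrete_ray_def discrete_geodesic_def)

lemma discrete_ray_tail: "discrete_ray V E f \<Longrightarrow> discrete_ray V E (\<lambda>i. f (i + k))"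
  by (simp add: discrete_ray_def)

lemma discrete_ray_edge: "discrete_ray V E f \<Longrightarrow> {f i, f (Suc i)} \<in> E"
  by (rule gdist_1_edge) (auto simp: discrete_ray_def)

end

section \<open>The geometric realization\<close>

definition edge_point :: "'v \<Rightarrow> 'v \<Rightarrow> real \<Rightarrow> 'v \<Rightarrow> real" where
  "edge_point u w r = (\<lambda>v. (1 - r) * vertex_point u v + r * vertex_point w v)"

text \<open>The domain is restricted because the rays that make up the boundary are extensional functions on
  the nonnegative reals.\<close>

definition realize :: "(nat \<Rightarrow> 'v) \<Rightarrow> real \<Rightarrow> 'v \<Rightarrow> real" where
  "realize f = (\<lambda>s\<in>{0..}. edge_point (f (nat \<lfloor>s\<rfloor>)) (f (Suc (nat \<lfloor>s\<rfloor>))) (frac s))"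

lemma supp_vertex_point [simp]: "supp (vertex_point v) = {v}"
  by (auto simp: supp_def vertex_point_def indicator_def)

lemma vertex_point_inj [simp]: "vertex_point u = vertex_point v \<longleftrightarrow> u = v"
  by (metis supp_vertex_point singleton_inject)

lemma vertex_point_simps [simp]: "vertex_point v v = 1" "u \<noteq> v \<Longrightarrow> vertex_point v u = 0"
  by (auto simp: vertex_point_def)

lemma edge_point_0 [simp]: "edge_point u w 0 = vertex_point u"
  and edge_point_1 [simp]: "edge_point u w 1 = vertex_point w"
  by (auto simp: edge_point_def)

lemma realize_cell:
  assumes "real i \<le> s" "s \<le> real i + 1"
  shows "realize f s = edge_point (f i) (f (Suc i)) (s - real i)"
proof (cases "s = real i + 1")
  case True
  moreover have "nat (int i + 1) = Suc i"
    by (simp add: nat_add_distrib)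
  ultimately show ?thesis
    by (simp add: realize_def frac_def)
next
  case False
  then have "\<lfloor>s\<rfloor> = int i"
    using assms by (simp add: floor_eq_iff)
  then have "nat \<lfloor>s\<rfloor> = i" "frac s = s - real i"
    by (auto simp: frac_def)
  then show ?thesis
    using assms by (simp add: realize_def)
qed

lemma realize_nat [simp]: "realize f (real i) = vertex_point (f i)"
  using realize_cell[of i "real i" f] by simp

lemma realize_0 [simp]: "realize f 0 = vertex_point (f 0)"
  using realize_nat[of f 0] by simp

context connected_simple_graph
begin

abbreviation P :: "('v \<Rightarrow> real) set" where "P \<equiv> graph_points V E"
abbreviation boundary :: "(real \<Rightarrow> 'v \<Rightarrow> real) set set" ("\<partial>V") where "\<partial>V \<equiv> graph_boundary V E"
abbreviation pdist :: "('v \<Rightarrow> real) \<Rightarrow> ('v \<Rightarrow> real) \<Rightarrow> real" where "pdist \<equiv> graph_dist V E"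

text \<open>The distance from a vertex \<open>v\<close> to a point \<open>x\<close> of the realization, as \<open>pdist_vertex\<close> will show: a path
  from \<open>v\<close> reaches \<open>x\<close> through one of the vertices of its edge.\<close>

definition vdist :: "'v \<Rightarrow> ('v \<Rightarrow> real) \<Rightarrow> real" where
  "vdist v x = Min ((\<lambda>u. real (D v u) + 1 - x u) ` supp x)"

lemma vertex_point_in [simp]: "vertex_point v \<in> P \<longleftrightarrow> v \<in> V"
proof
  assume "vertex_point v \<in> P"
  then show "v \<in> V"
    using simple unfolding graph_points_def simple_graph_def by force
next
  assume "v \<in> V"
  then have "\<exists>w\<in>V. supp (vertex_point v) = {w}"
    by simp
  moreover have "0 \<le> vertex_point v w" for w
    by (simp add: vertex_point_def)
  moreover have "sum (vertex_point v) (supp (vertex_point v)) = 1"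
    unfolding supp_vertex_point by simp
  ultimately show "vertex_point v \<in> P"
    unfolding graph_points_def by blast
qed

lemma supp_finite: "x \<in> P \<Longrightarrow> finite (supp x) \<and> supp x \<noteq> {} \<and> supp x \<subseteq> V"
proof -
  assume "x \<in> P"
  then consider "supp x \<in> E" | v where "v \<in> V" "supp x = {v}"
    by (auto simp: graph_points_def)
  then show ?thesis
  proof cases
    case 1
    then have "card (supp x) = 2" "supp x \<subseteq> V"
      using simple by (auto simp: simple_graph_def)
    then show ?thesis
      by (metis card.empty card.infinite zero_neq_numeral)
  qed auto
qed

lemma weights_le_1: "x \<in> P \<Longrightarrow> 0 \<le> x u \<and> x u \<le> 1"
proof -
  assume x: "x \<in> P"
  then have nn: "\<And>v. 0 \<le> x v" and s: "sum x (supp x) = 1"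
    by (auto simp: graph_points_def)
  have "x u \<le> 1"
  proof (cases "u \<in> supp x")
    case True
    then show ?thesis
      using member_le_sum[of u "supp x" x] nn s supp_finite[OF x] by auto
  next
    case False
    then show ?thesis by (simp add: supp_def)
  qed
  with nn show ?thesis by simp
qed

lemma weights_edge:
  assumes "x \<in> P" "supp x \<subseteq> {u, w}" "u \<noteq> w"
  shows "x u + x w = 1"
proof -
  have "sum x (supp x) = sum x {u, w}"
    by (rule sum.mono_neutral_left) (use assms in \<open>auto simp: supp_def\<close>)
  then show ?thesis
    using assms by (auto simp: graph_points_def)
qed

lemma weight_1_vertex:
  assumes "x \<in> P" "x u = 1"
  shows "x = vertex_point u"
proof (rule ext)
  fix v
  show "x v = vertex_point u v"
  proof (cases "v = u")
    case False
    have "x u + sum x (supp x - {u}) = 1"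
      using assms supp_finite[OF assms(1)] sum.remove[of "supp x" u x]
      by (auto simp: graph_points_def supp_def)
    then have "sum x (supp x - {u}) = 0"
      using assms by simp
    then have "\<forall>w\<in>supp x - {u}. x w = 0"
      using supp_finite[OF assms(1)] weights_le_1[OF assms(1)] by (subst (asm) sum_nonneg_eq_0_iff) auto
    then show ?thesis
      using False by (auto simp: supp_def)
  qed (use assms in auto)
qed

lemma vertex_or_edge:
  assumes "x \<in> P"
  obtains v where "v \<in> V" "x = vertex_point v" | "supp x \<in> E"
proof -
  consider "supp x \<in> E" | v where "v \<in> V" "supp x = {v}"
    using assms by (auto simp: graph_points_def)
  then show ?thesis
  proof cases
    case (2 v)
    then have "x v = 1"
      using assms by (simp add: graph_points_def)
    then show ?thesis
      using weight_1_vertex[OF assms] 2 that by blast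
  qed (use that in blast)
qed

lemma edge_point_in:
  assumes "{u, w} \<in> E" "0 \<le> r" "r \<le> 1"
  shows "edge_point u w r \<in> P" "supp (edge_point u w r) \<subseteq> {u, w}"
proof -
  have uw: "u \<noteq> w" "u \<in> V" "w \<in> V"
    using adjacency_V[of u w] assms by (auto simp: adjacency_def)
  show s: "supp (edge_point u w r) \<subseteq> {u, w}"
    by (auto simp: edge_point_def supp_def vertex_point_def indicator_def split: if_splits)
  consider "r = 0" | "r = 1" | "0 < r" "r < 1" using assms by linarith
  then show "edge_point u w r \<in> P"
  proof cases
    case 3
    have v: "edge_point u w r u = 1 - r" "edge_point u w r w = r"
      using uw by (auto simp: edge_point_def)
    then have "supp (edge_point u w r) = {u, w}"
      using s 3 by (auto simp: supp_def)
    moreover have "0 \<le> edge_point u w r v" for v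
      using assms by (auto simp: edge_point_def vertex_point_def indicator_def)
    moreover have "sum (edge_point u w r) {u, w} = 1"
      using uw v by simp
    ultimately show ?thesis
      unfolding graph_points_def using assms by simp
  qed (use uw in auto)
qed

lemma edge_point_cases:
  assumes "x \<in> P"
  obtains u w r where "{u, w} \<in> E" "0 \<le> r" "r \<le> 1" "x = edge_point u w r"
    | v where "v \<in> V" "x = vertex_point v"
  using assms
proof (cases rule: vertex_or_edge)
  case 2
  obtain u where "u \<in> supp x"
    using supp_finite[OF assms] by blast
  then obtain w where w: "supp x = {u, w}" "u \<noteq> w"
    using edgeE 2 by metis
  have sum: "x u + x w = 1"
    using weights_edge[OF assms, of u w] w by simp
  have "x = edge_point u w (x w)"
  proof
    fix v
    show "x v = edge_point u w (x w) v"
    proof (cases "v = u \<or> v = w")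
      case True
      then show ?thesis using w(2) sum by (auto simp: edge_point_def)
    next
      case False
      then have "x v = 0" using w(1) by (auto simp: supp_def)
      then show ?thesis using False by (simp add: edge_point_def)
    qed
  qed
  then show ?thesis
    using that(1)[of u w "x w"] w 2 weights_le_1[OF assms, of w] by auto
qed (use that in blast)

lemma point_zero_outside: "\<lbrakk>x \<in> P; v \<notin> V\<rbrakk> \<Longrightarrow> x v = 0"
  using supp_finite[of x] by (auto simp: supp_def)

lemma vdist_vertex [simp]: "vdist v (vertex_point u) = real (D v u)"
  by (simp add: vdist_def)

lemma vdist_attained:
  assumes "x \<in> P"
  obtains u where "u \<in> V" "0 < x u" "vdist v x = real (D v u) + 1 - x u"
proof -
  have "vdist v x \<in> (\<lambda>u. real (D v u) + 1 - x u) ` supp x"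
    unfolding vdist_def using supp_finite[OF assms] by (intro Min_in) auto
  then obtain u where "u \<in> supp x" "vdist v x = real (D v u) + 1 - x u"
    by auto
  then show ?thesis
    using that[of u] supp_finite[OF assms] weights_le_1[OF assms, of u] by (auto simp: supp_def)
qed

text \<open>If one of the two ends has weight 0, the other has weight 1, and as the ends are
  adjacent the minimum is attained at the latter.\<close>

lemma vdist_edge:
  assumes "x \<in> P" "{u, w} \<in> E" "supp x \<subseteq> {u, w}" "v \<in> V"
  shows "vdist v x = min (real (D v u) + 1 - x u) (real (D v w) + x u)"
proof -
  have uw: "u \<noteq> w" "u \<in> V" "w \<in> V"
    using adjacency_V[of u w] assms by (auto simp: adjacency_def)
  have sum: "x u + x w = 1"
    using weights_edge assms uw by blast
  have dd: "D v w \<le> D v u + 1" "D v u \<le> D v w + 1"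
    using gdist_triangle[of v u w] gdist_triangle[of v w u] gdist_edge[OF assms(2)] uw assms
    by (auto simp: gdist_sym[of _ w u])
  consider "supp x = {u, w}" | "x u = 1" | "x w = 1"
    using assms(3) sum by (cases "x u = 0"; cases "x w = 0") (auto simp: supp_def)
  then show ?thesis
  proof cases
    case 1
    then have "vdist v x = min (real (D v u) + 1 - x u) (real (D v w) + 1 - x w)"
      using uw by (simp add: vdist_def)
    then show ?thesis using sum by simp
  next
    case 2
    then have "vdist v x = real (D v u)"
      using weight_1_vertex[OF assms(1) 2] by simp
    then show ?thesis using 2 dd by simp
  next
    case 3
    then have "vdist v x = real (D v w)"
      using weight_1_vertex[OF assms(1) 3] by simp
    then show ?thesis using sum 3 dd by simp
  qed
qed

text \<open>Both terms of the preceding formula change exactly by the movement along the edge.  Hence the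
  difference of the values of \<open>vdist v\<close> at its ends bounds the length of a broken path from below.\<close>

lemma vdist_lipschitz:
  assumes "y \<in> P" "z \<in> P" "e \<in> E" "supp y \<union> supp z \<subseteq> e" "u \<in> e" "v \<in> V"
  shows "\<bar>vdist v y - vdist v z\<bar> \<le> \<bar>y u - z u\<bar>"
proof -
  obtain w where e: "e = {u, w}"
    using edgeE assms by blast
  have "vdist v y = min (real (D v u) + 1 - y u) (real (D v w) + y u)"
    "vdist v z = min (real (D v u) + 1 - z u) (real (D v w) + z u)"
    using assms e by (auto intro!: vdist_edge)
  then show ?thesis
    by linarith
qed

lemma broken_path_props:
  assumes "broken_path V E x y l"
  shows "x \<in> P \<and> y \<in> P \<and> 0 \<le> l \<and> (\<forall>v\<in>V. \<bar>vdist v x - vdist v y\<bar> \<le> l)"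
  using assms
proof induction
  case (piece y l z e u)
  have "\<bar>vdist v x - vdist v z\<bar> \<le> l + \<bar>y u - z u\<bar>" if "v \<in> V" for v
    using piece vdist_lipschitz[of y z e u v] that by force
  with piece show ?case by auto
qed auto

lemma broken_path_trans:
  assumes "broken_path V E y z m" "broken_path V E x y l"
  shows "broken_path V E x z (l + m)"
  using assms
proof induction
  case (piece y' m z' e u)
  then show ?case
    using broken_path.piece[of V E x y' "l + m" z' e u] by (simp add: add.assoc)
qed simp

lemma broken_path_piece:
  assumes "y \<in> P" "z \<in> P" "e \<in> E" "supp y \<union> supp z \<subseteq> e" "u \<in> e"
  shows "broken_path V E y z \<bar>y u - z u\<bar>"
  using broken_path.piece[OF broken_path.trivial, of y V E z e u] assms by simp

lemma broken_path_sym: "broken_path V E x y l \<Longrightarrow> broken_path V E y x l"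
proof (induction rule: broken_path.induct)
  case trivial
  then show ?case by (rule broken_path.trivial)
next
  case (piece y l z e u)
  then have "y \<in> P"
    using broken_path_props by blast
  then have "broken_path V E z y \<bar>z u - y u\<bar>"
    using piece by (intro broken_path_piece) auto
  then show ?case
    using broken_path_trans[OF piece.IH, of z "\<bar>z u - y u\<bar>"] by (simp add: abs_minus_commute add.commute)
qed

lemma broken_path_edge:
  assumes "{u, w} \<in> E" "0 \<le> r" "r \<le> 1" "0 \<le> s" "s \<le> 1"
  shows "broken_path V E (edge_point u w r) (edge_point u w s) \<bar>r - s\<bar>"
proof -
  have "u \<noteq> w" using adjacency_V[of u w] assms by (auto simp: adjacency_def)
  then have "\<bar>edge_point u w r w - edge_point u w s w\<bar> = \<bar>r - s\<bar>"
    by (simp add: edge_point_def)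
  then show ?thesis
    using broken_path_piece[of "edge_point u w r" "edge_point u w s" "{u, w}" w] edge_point_in assms
    by simp
qed

lemma broken_path_vertices:
  assumes "(u, v) \<in> adjacency E ^^ n" "u \<in> V"
  shows "broken_path V E (vertex_point u) (vertex_point v) (real n)"
  using assms
proof (induction n arbitrary: v)
  case 0
  then show ?case by (auto intro: broken_path.trivial)
next
  case (Suc n)
  then obtain w where w: "(u, w) \<in> adjacency E ^^ n" "{w, v} \<in> E"
    by (auto simp: adjacency_def)
  have "broken_path V E (vertex_point w) (vertex_point v) 1"
    using broken_path_edge[OF w(2), of 0 1] by simp
  then show ?case
    using broken_path_trans[OF _ Suc.IH[OF w(1) Suc.prems(2)]] by (simp add: add.commute)
qed

lemma broken_path_from_vertex:
  assumes "v \<in> V" "y \<in> P"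
  shows "broken_path V E (vertex_point v) y (vdist v y)"
proof -
  obtain u where u: "u \<in> V" "0 < y u" "vdist v y = real (D v u) + 1 - y u"
    using vdist_attained[OF assms(2)] by blast
  have *: "broken_path V E (vertex_point v) (vertex_point u) (real (D v u))"
    using broken_path_vertices gdist_relpow u assms by blast
  show ?thesis
    using assms(2)
  proof (cases rule: vertex_or_edge)
    case (1 w)
    with u have "u = w"
      by (auto simp: vertex_point_def indicator_def split: if_splits)
    with 1 * u show ?thesis by simp
  next
    case 2
    have "u \<in> supp y" using u by (simp add: supp_def)
    then have "broken_path V E (vertex_point u) y \<bar>vertex_point u u - y u\<bar>"
      using 2 u assms by (intro broken_path_piece[of _ _ "supp y"]) auto
    moreover have "\<bar>vertex_point u u - y u\<bar> = 1 - y u"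
      using weights_le_1[OF assms(2), of u] by simp
    ultimately show ?thesis
      using broken_path_trans[OF _ *] u by (metis add_diff_eq)
  qed
qed

lemma broken_path_exists: "\<lbrakk>x \<in> P; y \<in> P\<rbrakk> \<Longrightarrow> \<exists>l. broken_path V E x y l"
proof -
  assume "x \<in> P" "y \<in> P"
  moreover obtain v where "v \<in> V"
    using connected by (auto simp: connected_graph_def)
  ultimately show ?thesis
    using broken_path_trans broken_path_sym broken_path_from_vertex by metis
qed

lemma bdd_below_broken_path: "bdd_below {l. broken_path V E x y l}"
  by (rule bdd_belowI[of _ 0]) (auto dest: broken_path_props)

lemma pdist_le: "broken_path V E x y l \<Longrightarrow> pdist x y \<le> l"
  using broken_path_props[of x y l] cInf_lower[OF _ bdd_below_broken_path, of l x y]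
  by (simp add: graph_dist_def)

lemma pdist_greatest:
  assumes "x \<in> P" "y \<in> P" "\<And>l. broken_path V E x y l \<Longrightarrow> a \<le> l"
  shows "a \<le> pdist x y"
  using assms cInf_greatest[of "{l. broken_path V E x y l}" a] broken_path_exists[of x y]
  by (auto simp: graph_dist_def)

lemma pdist_sym: "pdist x y = pdist y x"
proof -
  have "{l. broken_path V E x y l} = {l. broken_path V E y x l}"
    using broken_path_sym by blast
  then show ?thesis by (simp add: graph_dist_def)
qed

lemma pdist_nonneg: "0 \<le> pdist x y"
proof (cases "x \<in> P \<and> y \<in> P")
  case True
  then show ?thesis using pdist_greatest[of x y 0] broken_path_props by blast
qed (auto simp: graph_dist_def)

lemma pdist_triangle:
  assumes "x \<in> P" "y \<in> P" "z \<in> P"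
  shows "pdist x z \<le> pdist x y + pdist y z"
proof -
  have "pdist x z - pdist x y \<le> l'" if l': "broken_path V E y z l'" for l'
  proof -
    have "pdist x z - l' \<le> pdist x y"
    proof (rule pdist_greatest[OF assms(1,2)])
      fix l assume "broken_path V E x y l"
      then show "pdist x z - l' \<le> l"
        using pdist_le[OF broken_path_trans[OF l']] by force
    qed
    then show ?thesis by simp
  qed
  then show ?thesis
    using pdist_greatest[OF assms(2,3), of "pdist x z - pdist x y"] by simp
qed

lemma pdist_vertex:
  assumes "v \<in> V" "y \<in> P"
  shows "pdist (vertex_point v) y = vdist v y"
proof (rule antisym)
  show "pdist (vertex_point v) y \<le> vdist v y"
    using pdist_le broken_path_from_vertex assms by blast
  show "vdist v y \<le> pdist (vertex_point v) y"
  proof (rule pdist_greatest)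
    fix l assume "broken_path V E (vertex_point v) y l"
    then show "vdist v y \<le> l"
      using broken_path_props assms by force
  qed (use assms in auto)
qed

lemma pdist_vertices [simp]: "\<lbrakk>u \<in> V; v \<in> V\<rbrakk> \<Longrightarrow> pdist (vertex_point u) (vertex_point v) = real (D u v)"
  by (simp add: pdist_vertex)

lemma pdist_self [simp]: "pdist x x = 0"
  using pdist_le[OF broken_path.trivial, of x] pdist_nonneg[of x x]
  by (cases "x \<in> P") (auto simp: graph_dist_def)

text \<open>The value is attained at a vertex whose weight is positive and at most 1, and it can be integral
  only if this weight is 1.\<close>

lemma integral_vdist_vertex:
  assumes "y \<in> P" "vdist v y = real n"
  obtains u where "u \<in> V" "y = vertex_point u"
proof -
  obtain u where u: "u \<in> V" "0 < y u" "real n = real (D v u) + 1 - y u"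
    using vdist_attained[OF assms(1)] assms(2) by metis
  with weights_le_1[OF assms(1), of u] have "real n < real (D v u) + 1" "real (D v u) \<le> real n"
    by auto
  then have "n = D v u"
    by linarith
  with u have "y u = 1" by simp
  then show ?thesis
    using weight_1_vertex[OF assms(1)] u that by blast
qed

section \<open>Realizing discrete geodesics\<close>

lemma realize_geodesic_in:
  assumes f: "discrete_geodesic V E n f" and s: "0 \<le> s" "s \<le> real n"
  shows "realize f s \<in> P" "vdist (f 0) (realize f s) = s"
proof -
  define i where "i = nat \<lfloor>s\<rfloor>"
  have i: "real i \<le> s" "s < real i + 1"
    using s by (auto simp: i_def)
  have "realize f s \<in> P \<and> vdist (f 0) (realize f s) = s"
  proof (cases "s = real i")
    case True
    then show ?thesis
      using f s by (auto simp: discrete_geodesic_def)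
  next
    case False
    then have "Suc i \<le> n" using i s by linarith
    then have e: "{f i, f (Suc i)} \<in> E"
      using f by (intro gdist_1_edge) (auto simp: discrete_geodesic_def)
    have r: "realize f s = edge_point (f i) (f (Suc i)) (s - real i)"
      using i by (intro realize_cell) auto
    have pt: "realize f s \<in> P" "supp (realize f s) \<subseteq> {f i, f (Suc i)}"
      using edge_point_in[OF e] i by (simp_all add: r)
    have "f i \<noteq> f (Suc i)" using adjacency_V e by (auto simp: adjacency_def)
    then have w: "realize f s (f i) = 1 - (s - real i)"
      by (simp add: r edge_point_def)
    have "D (f 0) (f i) = i" "D (f 0) (f (Suc i)) = Suc i" "f 0 \<in> V"
      using f \<open>Suc i \<le> n\<close> by (auto simp: discrete_geodesic_def)
    then have "vdist (f 0) (realize f s) = s"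
      using vdist_edge[OF pt(1) e pt(2), of "f 0"] w i by simp
    with pt show ?thesis by simp
  qed
  then show "realize f s \<in> P" "vdist (f 0) (realize f s) = s" by auto
qed

lemma realize_same_cell:
  assumes f: "discrete_geodesic V E n f" and "Suc i \<le> n"
    and "real i \<le> s" "s \<le> real i + 1" "real i \<le> t" "t \<le> real i + 1"
  shows "pdist (realize f s) (realize f t) \<le> \<bar>s - t\<bar>"
proof -
  have e: "{f i, f (Suc i)} \<in> E"
    using f assms by (intro gdist_1_edge) (auto simp: discrete_geodesic_def)
  have "broken_path V E (realize f s) (realize f t) \<bar>(s - real i) - (t - real i)\<bar>"
    using broken_path_edge[OF e, of "s - real i" "t - real i"] assms
    by (simp add: realize_cell)
  then show ?thesis
    using pdist_le by fastforce
qed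

text \<open>The distance from the starting vertex grows at unit speed, which bounds distances from below; cutting
  at the vertices on the way bounds them from above.\<close>

lemma realize_geodesic_dist:
  assumes f: "discrete_geodesic V E n f" and "0 \<le> s" "s \<le> real n" "0 \<le> t" "t \<le> real n"
  shows "pdist (realize f s) (realize f t) = \<bar>s - t\<bar>"
proof -
  have *: "pdist (realize f s) (realize f t) = t - s" if st: "0 \<le> s" "s \<le> t" "t \<le> real n" for s t
  proof (rule antisym)
    note in_s = realize_geodesic_in[OF f, of s] and in_t = realize_geodesic_in[OF f, of t]
    have f0: "f 0 \<in> V" using f by (simp add: discrete_geodesic_def)
    show "t - s \<le> pdist (realize f s) (realize f t)"
      using pdist_triangle[of "vertex_point (f 0)" "realize f s" "realize f t"] in_s in_t f0 st
      by (simp add: pdist_vertex)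
    define i j where "i = nat \<lfloor>s\<rfloor>" and "j = nat \<lfloor>t\<rfloor>"
    have i: "real i \<le> s" "s < real i + 1" and j: "real j \<le> t" "t < real j + 1"
      using st by (auto simp: i_def j_def)
    consider "s = t" | "s < t" "i = j" | "i < j"
      using i j st by linarith
    then show "pdist (realize f s) (realize f t) \<le> t - s"
    proof cases
      case 2
      then have "Suc i \<le> n" using i st by linarith
      then show ?thesis
        using realize_same_cell[OF f, of i s t] i j 2 by simp
    next
      case 3
      have jn: "j \<le> n" using j st by linarith
      have a: "pdist (realize f s) (realize f (real (Suc i))) \<le> real (Suc i) - s"
        using realize_same_cell[OF f, of i s "real (Suc i)"] i 3 jn by simp
      have b: "pdist (realize f (real j)) (realize f t) \<le> t - real j"
      proof (cases "t = real j")
        case False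
        then have "Suc j \<le> n" using j st by linarith
        then show ?thesis using realize_same_cell[OF f, of j "real j" t] j by simp
      qed simp
      have c: "pdist (realize f (real (Suc i))) (realize f (real j)) = real j - real (Suc i)"
        using f 3 jn by (simp add: discrete_geodesic_def del: of_nat_Suc)
      have P3: "realize f (real (Suc i)) \<in> P" "realize f (real j) \<in> P"
        using f 3 jn by (auto simp: discrete_geodesic_def simp del: of_nat_Suc)
      have "pdist (realize f s) (realize f t) \<le> pdist (realize f s) (realize f (real (Suc i)))
          + (pdist (realize f (real (Suc i))) (realize f (real j)) + pdist (realize f (real j)) (realize f t))"
        using pdist_triangle[OF in_s(1) P3(1) in_t(1)] pdist_triangle[OF P3 in_t(1)] st by linarith
      then show ?thesis using a b c by linarith
    qed simp
  qed
  show ?thesis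
    using *[of s t] *[of t s] assms pdist_sym by (cases "s \<le> t") auto
qed

lemma realize_ray: "discrete_ray V E f \<Longrightarrow> realize f \<in> graph_rays V E"
proof -
  assume f: "discrete_ray V E f"
  have "realize f \<in> {0..} \<rightarrow>\<^sub>E P"
  proof (rule PiE_I)
    fix s :: real assume "s \<in> {0..}"
    then show "realize f s \<in> P"
      using realize_geodesic_in(1)[OF discrete_ray_geodesic[OF f], of s "nat \<lceil>s\<rceil>"]
      by (simp add: real_nat_ceiling_ge)
  qed (simp add: realize_def)
  moreover have "pdist (realize f s) (realize f t) = \<bar>s - t\<bar>" if "0 \<le> s" "0 \<le> t" for s t
  proof (rule realize_geodesic_dist[OF discrete_ray_geodesic[OF f, of "nat \<lceil>max s t\<rceil>"]])
    show "s \<le> real (nat \<lceil>max s t\<rceil>)" "t \<le> real (nat \<lceil>max s t\<rceil>)"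
      using real_nat_ceiling_ge[of "max s t"] by linarith+
  qed (use that in auto)
  ultimately show ?thesis
    by (simp add: geodesic_rays_def)
qed

lemma realize_segment:
  assumes "discrete_geodesic V E (D x y) f" "f 0 = x" "f (D x y) = y"
  shows "geodesic_segment P pdist (vertex_point x) (vertex_point y) (realize f ` {0..real (D x y)})"
proof -
  have "x \<in> V" "y \<in> V"
    using assms by (auto simp: discrete_geodesic_def)
  then have d: "pdist (vertex_point x) (vertex_point y) = real (D x y)"
    by simp
  show ?thesis
    unfolding geodesic_segment_def d
    by (rule exI[of _ "realize f"])
      (use assms realize_geodesic_in[OF assms(1)] realize_geodesic_dist[OF assms(1)] in auto)
qed

section \<open>Geodesic rays of the realization\<close>

lemma ray_in: "\<lbrakk>c \<in> graph_rays V E; 0 \<le> t\<rbrakk> \<Longrightarrow> c t \<in> P"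
  and ray_dist: "\<lbrakk>c \<in> graph_rays V E; 0 \<le> s; 0 \<le> t\<rbrakk> \<Longrightarrow> pdist (c s) (c t) = \<bar>s - t\<bar>"
  by (auto simp: geodesic_rays_def PiE_def Pi_def)

lemma ray_from_vertex:
  assumes c: "c \<in> graph_rays V E" and "c 0 = vertex_point x"
  obtains f where "discrete_ray V E f" "f 0 = x" "\<And>n. c (real n) = vertex_point (f n)"
proof -
  have x: "x \<in> V"
    using ray_in[OF c, of 0] assms by simp
  have "\<exists>u. u \<in> V \<and> c (real n) = vertex_point u" for n
  proof -
    have "vdist x (c (real n)) = real n"
      using pdist_vertex[OF x ray_in[OF c], of "real n"] ray_dist[OF c, of 0 "real n"] assms by simp
    then show ?thesis
      using integral_vdist_vertex ray_in[OF c, of "real n"] by (metis of_nat_0_le_iff)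
  qed
  then obtain f where f: "\<And>n. f n \<in> V \<and> c (real n) = vertex_point (f n)"
    by metis
  have "D (f i) (f j) = j - i" if "i \<le> j" for i j
  proof -
    have "real (D (f i) (f j)) = real (j - i)"
      using ray_dist[OF c, of "real i" "real j"] f that by simp
    then show ?thesis by linarith
  qed
  moreover have "f 0 = x"
    using f[of 0] assms by simp
  ultimately show ?thesis
    using that[of f] f by (auto simp: discrete_ray_def)
qed

text \<open>A path leaving the edge that carries its starting point \<open>x\<close> runs through an end \<open>u\<close> of
  this edge, and the part before \<open>u\<close> is no shorter than the straight one.\<close>

lemma broken_path_leaves_edge:
  assumes "broken_path V E x y l" "supp x \<in> E"
  shows "supp y \<subseteq> supp x \<or> (\<exists>u\<in>supp x. 1 - x u + vdist u y \<le> l)"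
  using assms(1)
proof induction
  case trivial
  then show ?case by simp
next
  case (piece y l z e u)
  have y: "y \<in> P" and x: "x \<in> P" and l: "\<forall>v\<in>V. \<bar>vdist v x - vdist v y\<bar> \<le> l"
    using broken_path_props[OF piece.hyps(1)] by auto
  show ?case
  proof (cases "supp z \<subseteq> supp x")
    case False
    have "\<exists>v\<in>supp x. 1 - x v + vdist v y \<le> l"
    proof (cases "supp y \<subseteq> supp x")
      case True
      have "e \<noteq> supp x"
        using piece False by auto
      have "\<not> supp y \<in> E"
      proof
        assume "supp y \<in> E"
        then have "card (supp y) = 2" "card (supp x) = 2" "card e = 2"
          using simple assms(2) piece by (auto simp: simple_graph_def)
        moreover have "finite (supp x)" "finite e"
          using calculation by (auto intro: card_ge_0_finite)
        ultimately have "supp y = supp x" "supp y = e"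
          using card_subset_eq[of "supp x" "supp y"] card_subset_eq[of e "supp y"] True piece by auto
        then show False
          using \<open>e \<noteq> supp x\<close> by simp
      qed
      then obtain v where v: "v \<in> V" "y = vertex_point v"
        using vertex_or_edge[OF y] by blast
      then have "v \<in> supp x"
        using True by simp
      then obtain w where w: "supp x = {v, w}" "v \<noteq> w" "w \<in> V"
        using edgeE assms(2) by metis
      have "vdist v x = min (real (D v v) + 1 - x v) (real (D v w) + x v)"
        using vdist_edge[OF x] w assms(2) v by auto
      moreover have "D v w = 1"
        using gdist_edge w assms(2) by auto
      ultimately have "vdist v x = 1 - x v"
        using weights_le_1[OF x, of v] by simp
      then have "1 - x v + vdist v y \<le> l"
        using l v by force
      then show ?thesis
        using \<open>v \<in> supp x\<close> by blast
    qed (use piece in auto)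
    then obtain v where v: "v \<in> supp x" "1 - x v + vdist v y \<le> l"
      by blast
    then have "v \<in> V"
      using supp_finite[OF x] by auto
    then have "\<bar>vdist v y - vdist v z\<bar> \<le> \<bar>y u - z u\<bar>"
      using vdist_lipschitz y piece by blast
    with v show ?thesis by force
  qed simp
qed

text \<open>If the ray starts inside an edge, its point at time 2 has been reached through an end \<open>u\<close> of
  that edge.  From then on its distance from \<open>u\<close> is \<open>t - \<alpha>\<close>, where \<open>\<alpha>\<close> is the
  distance from the starting point to \<open>u\<close>, and a point at integral distance from a vertex is a
  vertex.\<close>

lemma ray_meets_vertex:
  assumes c: "c \<in> graph_rays V E"
  obtains T v where "0 \<le> T" "v \<in> V" "c T = vertex_point v"
proof -
  have x: "c 0 \<in> P"
    using ray_in[OF c] by simp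
  show ?thesis
    using x
  proof (cases rule: vertex_or_edge)
    case (1 v)
    then show ?thesis using that[of 0 v] by simp
  next
    case 2
    let ?x = "c 0"
    have y: "c 2 \<in> P" "pdist ?x (c 2) = 2"
      using ray_in[OF c] ray_dist[OF c, of 0 2] by auto
    obtain u where "u \<in> supp ?x"
      using supp_finite[OF x] by blast
    then obtain w where w: "supp ?x = {u, w}" "u \<noteq> w" "u \<in> V" "w \<in> V"
      using edgeE 2 by metis
    have nsub: "\<not> supp (c 2) \<subseteq> supp ?x"
    proof
      assume "supp (c 2) \<subseteq> supp ?x"
      then have "pdist ?x (c 2) \<le> \<bar>?x u - c 2 u\<bar>"
        using broken_path_piece[OF x y(1) 2, of u] w by (intro pdist_le) auto
      then show False
        using weights_le_1[OF x, of u] weights_le_1[OF y(1), of u] y(2) by linarith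
    qed
    have "min (1 - ?x u + vdist u (c 2)) (1 - ?x w + vdist w (c 2)) \<le> pdist ?x (c 2)"
    proof (rule pdist_greatest[OF x y(1)])
      fix l assume "broken_path V E ?x (c 2) l"
      then have "\<exists>u\<in>{u, w}. 1 - ?x u + vdist u (c 2) \<le> l"
        using broken_path_leaves_edge[OF _ 2] nsub w by metis
      then show "min (1 - ?x u + vdist u (c 2)) (1 - ?x w + vdist w (c 2)) \<le> l"
        by auto
    qed
    then have "1 - ?x u + vdist u (c 2) \<le> 2 \<or> 1 - ?x w + vdist w (c 2) \<le> 2"
      using y(2) by (simp add: min_le_iff_disj)
    then obtain a where a: "a \<in> supp ?x" "1 - ?x a + vdist a (c 2) \<le> 2"
      using w(1) by blast
    then obtain b where b: "supp ?x = {a, b}" "a \<noteq> b" "a \<in> V"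
      using edgeE 2 by metis
    have "D a b = 1" using gdist_edge b 2 by auto
    then have ax: "vdist a ?x = 1 - ?x a"
      using vdist_edge[OF x, of a b a] b 2 weights_le_1[OF x, of a] by simp
    define T where "T = 3 - ?x a"
    have T: "2 \<le> T"
      using weights_le_1[OF x, of a] by (simp add: T_def)
    have cT: "c T \<in> P"
      using ray_in[OF c] T by simp
    have "vdist a (c T) \<le> vdist a (c 2) + (T - 2)"
      using pdist_triangle[OF _ y(1) cT, of "vertex_point a"] b cT y ray_dist[OF c, of 2 T] T
      by (simp add: pdist_vertex)
    moreover have "T \<le> vdist a ?x + vdist a (c T)"
      using pdist_triangle[OF x _ cT, of "vertex_point a"] b cT x ray_dist[OF c, of 0 T] T
      by (simp add: pdist_vertex pdist_sym[of ?x])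
    ultimately have "vdist a (c T) = real 2"
      using a ax by (simp add: T_def)
    then show ?thesis
      using integral_vdist_vertex[OF cT] that T by (metis order_trans zero_le_numeral)
  qed
qed

section \<open>Thin intervals\<close>

text \<open>Thinness of triangles in terms of unions of geodesics instead of chosen sides.  This form
  mentions vertices only and applies to any point that satisfies a distance equation.\<close>

definition thin :: "nat \<Rightarrow> bool" where
  "thin \<delta> \<longleftrightarrow> (\<forall>x\<in>V. \<forall>y\<in>V. \<forall>z\<in>V. \<forall>u\<in>geo_interval V E x y.
     \<exists>w\<in>geo_interval V E x z \<union> geo_interval V E z y. D u w \<le> \<delta>)"

lemma geo_interval_V: "u \<in> geo_interval V E x y \<Longrightarrow> u \<in> V"
  by (simp add: geo_interval_def)

lemma geo_interval_sym: "geo_interval V E x y = geo_interval V E y x"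
  by (auto simp: geo_interval_def gdist_sym add.commute)

lemma near_vertex_of_segment:
  assumes f: "discrete_geodesic V E n f" and a: "a \<in> realize f ` {0..real n}"
  shows "\<exists>i\<le>n. pdist a (vertex_point (f i)) \<le> 1"
proof -
  obtain s where s: "0 \<le> s" "s \<le> real n" "a = realize f s"
    using a by auto
  define i where "i = nat \<lfloor>s\<rfloor>"
  have i: "real i \<le> s" "s < real i + 1"
    using s by (auto simp: i_def)
  then have "i \<le> n"
    using s by linarith
  moreover have "pdist a (vertex_point (f i)) \<le> 1"
    using realize_geodesic_dist[OF f, of s "real i"] s i \<open>i \<le> n\<close> by simp
  ultimately show ?thesis by blast
qed

text \<open>The realization of a discrete geodesic is a geodesic segment, and each of its points is within
  distance 1 of a vertex of the discrete geodesic.\<close>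

lemma hyperbolic_imp_thin:
  assumes "hyperbolic_space P pdist"
  shows "\<exists>\<delta>. thin \<delta>"
proof -
  obtain \<delta> where \<delta>: "\<And>x y z A B C. \<lbrakk>x \<in> P; y \<in> P; z \<in> P; geodesic_segment P pdist x y A;
      geodesic_segment P pdist y z B; geodesic_segment P pdist z x C\<rbrakk>
      \<Longrightarrow> A \<subseteq> nbhd_of P pdist \<delta> (B \<union> C)"
    using assms unfolding hyperbolic_space_def by metis
  define n where "n = nat \<lceil>\<delta>\<rceil> + 1"
  have "thin n"
    unfolding thin_def
  proof (intro ballI)
    fix x y z u assume x: "x \<in> V" and y: "y \<in> V" and z: "z \<in> V" and u: "u \<in> geo_interval V E x y"
    obtain f where f: "discrete_geodesic V E (D x y) f" "f 0 = x" "f (D x y) = y" "f (D x u) = u"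
      using geodesic_through[OF x y u] by blast
    obtain g where g: "discrete_geodesic V E (D y z) g" "g 0 = y" "g (D y z) = z"
      using geodesic_exists[OF y z] by blast
    obtain h where h: "discrete_geodesic V E (D z x) h" "h 0 = z" "h (D z x) = x"
      using geodesic_exists[OF z x] by blast
    have "vertex_point u \<in> realize f ` {0..real (D x y)}"
      using f u by (intro image_eqI[of _ _ "real (D x u)"]) (auto simp: geo_interval_def)
    moreover have "realize f ` {0..real (D x y)}
        \<subseteq> nbhd_of P pdist \<delta> (realize g ` {0..real (D y z)} \<union> realize h ` {0..real (D z x)})"
      using x y z
      by (intro \<delta>[OF _ _ _ realize_segment[OF f(1-3)] realize_segment[OF g] realize_segment[OF h]]) auto
    ultimately obtain a where a: "a \<in> realize g ` {0..real (D y z)} \<union> realize h ` {0..real (D z x)}"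
        "pdist (vertex_point u) a < \<delta>"
      unfolding nbhd_of_def by blast
    have "\<exists>w\<in>geo_interval V E x z \<union> geo_interval V E z y. pdist a (vertex_point w) \<le> 1"
      using a(1)
    proof
      assume "a \<in> realize g ` {0..real (D y z)}"
      then obtain i where "i \<le> D y z" "pdist a (vertex_point (g i)) \<le> 1"
        using near_vertex_of_segment[OF g(1)] by blast
      then show ?thesis
        using geodesic_in_geo_interval[OF g(1), of 0 i "D y z"] g geo_interval_sym[of y z] by auto
    next
      assume "a \<in> realize h ` {0..real (D z x)}"
      then obtain i where "i \<le> D z x" "pdist a (vertex_point (h i)) \<le> 1"
        using near_vertex_of_segment[OF h(1)] by blast
      then show ?thesis
        using geodesic_in_geo_interval[OF h(1), of 0 i "D z x"] h geo_interval_sym[of z x] by auto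
    qed
    then obtain w where w: "w \<in> geo_interval V E x z \<union> geo_interval V E z y" "pdist a (vertex_point w) \<le> 1"
      by blast
    have uw: "u \<in> V" "w \<in> V" "a \<in> P"
      using u w geo_interval_V a realize_geodesic_in(1)[OF g(1)] realize_geodesic_in(1)[OF h(1)] by auto
    have "real (D u w) < \<delta> + 1"
      using pdist_triangle[of "vertex_point u" a "vertex_point w"] uw a(2) w(2) by simp
    then have "D u w \<le> n"
      unfolding n_def by linarith
    with w show "\<exists>w\<in>geo_interval V E x z \<union> geo_interval V E z y. D u w \<le> n" by blast
  qed
  then show ?thesis ..
qed

section \<open>Quasi-geodesics stay close to geodesics\<close>

text \<open>Halving the sequence \<open>N\<close> times costs one thin triangle each time.\<close>

lemma chain_near:
  assumes "thin \<delta>" "\<And>i. i \<le> n \<Longrightarrow> q i \<in> V" "\<And>i. i < n \<Longrightarrow> D (q i) (q (Suc i)) \<le> M"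
    and "a \<le> b" "b \<le> n" "b - a \<le> 2 ^ N" "z \<in> geo_interval V E (q a) (q b)"
  shows "\<exists>i\<le>n. D z (q i) \<le> \<delta> * N + M"
  using assms(4-)
proof (induction N arbitrary: a b z)
  case 0
  then consider "b = a" | "b = Suc a" by force
  then have "D (q a) (q b) \<le> M"
    using assms(3)[of a] 0 by cases auto
  then have "D z (q a) \<le> M"
    using 0 by (auto simp: geo_interval_def gdist_sym)
  then show ?case
    using 0 by (intro exI[of _ a]) auto
next
  case (Suc N)
  define m where "m = (a + b) div 2"
  have m: "a \<le> m" "m \<le> b" "m - a \<le> 2 ^ N" "b - m \<le> 2 ^ N"
    using Suc.prems by (auto simp: m_def)
  obtain w where w: "w \<in> geo_interval V E (q a) (q m) \<union> geo_interval V E (q m) (q b)" "D z w \<le> \<delta>"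
    using assms(1) Suc.prems assms(2) m unfolding thin_def by (meson le_trans)
  then obtain i where i: "i \<le> n" "D w (q i) \<le> \<delta> * N + M"
    using Suc.IH[of a m w] Suc.IH[of m b w] m Suc.prems by auto
  moreover have "D z (q i) \<le> D z w + D w (q i)"
    using gdist_triangle geo_interval_V w Suc.prems assms(2) i by blast
  ultimately show ?case
    using w by (intro exI[of _ i]) auto
qed

end

lemma linear_le_exp:
  fixes a b :: nat
  shows "\<exists>n0. \<forall>n\<ge>n0. a * n + b \<le> 2 ^ n"
proof (intro exI allI impI)
  fix n assume n: "a + b + 4 \<le> n"
  have sq: "n * n \<le> 2 ^ n" if "4 \<le> n" for n :: nat
    using that
  proof (induction n rule: dec_induct)
    case (step n)
    have "4 * n \<le> n * n" using step by simp
    moreover have "Suc n * Suc n = n * n + 2 * n + 1" by simp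
    ultimately have "Suc n * Suc n \<le> 2 * (n * n)" using step by linarith
    with step.IH show ?case by simp
  qed simp
  have "a * n + b \<le> (a + b) * n"
    using n by (cases n) (auto simp: algebra_simps)
  also have "\<dots> \<le> n * n"
    using n by (intro mult_le_mono1) simp
  finally show "a * n + b \<le> 2 ^ n"
    using sq[of n] n by simp
qed

text \<open>A quantity cannot exceed a logarithm of itself by much.  The logarithm appears through powers of 2
  because it will count halvings of a path.\<close>

lemma bounded_by_log:
  fixes \<delta> M A B :: nat
  shows "\<exists>K. \<forall>R. (\<forall>N. A * R + B \<le> 2 ^ N \<longrightarrow> R \<le> \<delta> * N + M) \<longrightarrow> R \<le> K"
proof -
  let ?d = "Suc \<delta>"
  obtain n0 where n0: "\<forall>N\<ge>n0. (A * ?d) * N + (A * (?d + M + 1) + B) \<le> 2 ^ N"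
    using linear_le_exp by blast
  have "R \<le> ?d * n0 + M" if R: "\<forall>N. A * R + B \<le> 2 ^ N \<longrightarrow> R \<le> \<delta> * N + M" for R
  proof (rule ccontr)
    assume big: "\<not> R \<le> ?d * n0 + M"
    define N where "N = (R - M - 1) div ?d"
    have "?d * N \<le> R - M - 1" "R - M - 1 < ?d * (N + 1)"
      unfolding N_def using dividend_less_times_div[of ?d "R - M - 1"]
      by (auto simp only: times_div_less_eq_dividend distrib_left mult_1_right add.commute)
    then have lo: "?d * N + M < R" and hi: "R \<le> ?d * N + (?d + M + 1)"
      using big by auto
    have "n0 \<le> N"
      unfolding N_def using big by (subst less_eq_div_iff_mult_less_eq) (auto simp: mult.commute)
    have "A * R + B \<le> A * (?d * N + (?d + M + 1)) + B"
      using hi by (intro add_mono mult_le_mono2) auto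
    also have "\<dots> = (A * ?d) * N + (A * (?d + M + 1) + B)"
      by (simp add: algebra_simps)
    also have "\<dots> \<le> 2 ^ N"
      using n0 \<open>n0 \<le> N\<close> by blast
    finally have "R \<le> \<delta> * N + M"
      using R by blast
    with lo show False by simp
  qed
  then show ?thesis by blast
qed

context connected_simple_graph
begin

definition quasi_geodesic :: "nat \<Rightarrow> nat \<Rightarrow> nat \<Rightarrow> nat \<Rightarrow> (nat \<Rightarrow> 'v) \<Rightarrow> bool" where
  "quasi_geodesic M \<mu> \<kappa> n q \<longleftrightarrow> (\<forall>i\<le>n. q i \<in> V) \<and> (\<forall>i<n. D (q i) (q (Suc i)) \<le> M) \<and>
     (\<forall>i j. i \<le> j \<longrightarrow> j \<le> n \<longrightarrow> j - i \<le> \<mu> * D (q i) (q j) + \<kappa>)"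

text \<open>One half of the detour in the next lemma: it leaves the geodesic between \<open>e\<close> and \<open>z\<close> at
  distance \<open>2R\<close> from \<open>z\<close>, or at \<open>e\<close> if \<open>e\<close> is closer than that, and goes to the sequence \<open>q\<close>
  outside the ball of radius \<open>R\<close> around \<open>z\<close>.  The relation power counts the steps of this walk.\<close>

lemma points_on_side:
  assumes e: "e \<in> V" "z \<in> V" and R: "\<And>y. \<lbrakk>y \<in> V; D e y + D y z = D e z\<rbrakk> \<Longrightarrow> \<exists>i\<le>n. D y (q i) \<le> R"
    and far: "\<And>i. i \<le> n \<Longrightarrow> R \<le> D z (q i)" and q: "\<And>i. i \<le> n \<Longrightarrow> q i \<in> V" "i0 \<le> n" "e = q i0" "1 \<le> M"
  shows "\<exists>y i l. y \<in> V \<and> D e y + D y z = D e z \<and> D y z \<le> 2 * R \<and> i \<le> n \<and> l \<le> R \<and> D y (q i) \<le> R \<and>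
    (y, q i) \<in> {(u, v). u \<in> V \<and> v \<in> V \<and> R \<le> D z u \<and> R \<le> D z v \<and> D u v \<le> M} ^^ l"
proof (cases "D e z \<le> 2 * R")
  case True
  then show ?thesis
    using e q by (intro exI[of _ e] exI[of _ i0] exI[of _ 0]) auto
next
  case False
  obtain f where f: "discrete_geodesic V E (D e z) f" "f 0 = e" "f (D e z) = z"
    using geodesic_exists e by blast
  define y where "y = f (D e z - 2 * R)"
  have y: "y \<in> V" "D e y = D e z - 2 * R" "D y z = 2 * R"
  proof -
    have "D (f 0) (f (D e z - 2 * R)) = D e z - 2 * R" "D (f (D e z - 2 * R)) (f (D e z)) = 2 * R"
      using f(1) False by (auto simp: discrete_geodesic_def)
    then show "y \<in> V" "D e y = D e z - 2 * R" "D y z = 2 * R"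
      using f by (auto simp: y_def discrete_geodesic_def)
  qed
  then obtain i where i: "i \<le> n" "D y (q i) \<le> R"
    using R[of y] False by auto
  obtain g where g: "discrete_geodesic V E (D y (q i)) g" "g 0 = y" "g (D y (q i)) = q i"
    using geodesic_exists y q i by blast
  have gfar: "g t \<in> V \<and> R \<le> D z (g t)" if "t \<le> D y (q i)" for t
  proof -
    have "g t \<in> V" "D (g 0) (g t) = t"
      using g(1) that by (auto simp: discrete_geodesic_def)
    then have "2 * R \<le> t + D (g t) z"
      using gdist_triangle[of y "g t" z] y e g by simp
    then show ?thesis
      using that i \<open>g t \<in> V\<close> by (simp add: gdist_sym)
  qed
  have "D (g t) (g (Suc t)) \<le> M" if "t < D y (q i)" for t
    using g(1) that q(4) by (auto simp: discrete_geodesic_def)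
  then have "(y, q i) \<in> {(u, v). u \<in> V \<and> v \<in> V \<and> R \<le> D z u \<and> R \<le> D z v \<and> D u v \<le> M} ^^ (D y (q i))"
    unfolding relpow_fun_conv using g gfar by (intro exI[of _ g]) auto
  then show ?thesis
    using y i False by (intro exI[of _ y] exI[of _ i] exI[of _ "D y (q i)"]) auto
qed

text \<open>Let \<open>z\<close> be the point of the geodesic farthest from the quasi-geodesic, at distance
  \<open>R\<close>.  Leaving the geodesic at distance \<open>2R\<close> before \<open>z\<close>, going to the
  quasi-geodesic, along it, and back to the geodesic at distance \<open>2R\<close> after \<open>z\<close> gives a
  detour of length linear in \<open>R\<close> which avoids the ball of radius \<open>R\<close> around \<open>z\<close>; but the
  detour can stay away from \<open>z\<close> only by the logarithm of its length.\<close>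

lemma geodesic_near_quasi_geodesic:
  assumes "thin \<delta>" "1 \<le> M"
  shows "\<exists>K. \<forall>n q. quasi_geodesic M \<mu> \<kappa> n q \<longrightarrow>
    (\<forall>z\<in>geo_interval V E (q 0) (q n). \<exists>i\<le>n. D z (q i) \<le> K)"
proof -
  obtain K where K: "\<And>R. (\<forall>N. (2 + 6 * \<mu>) * R + \<kappa> \<le> 2 ^ N \<longrightarrow> R \<le> \<delta> * N + M) \<Longrightarrow> R \<le> K"
    using bounded_by_log by blast
  have "\<exists>i\<le>n. D z' (q i) \<le> K" if qg: "quasi_geodesic M \<mu> \<kappa> n q" and z': "z' \<in> geo_interval V E (q 0) (q n)" for n q z'
  proof -
    define r where "r z = Min ((\<lambda>i. D z (q i)) ` {..n})" for z
    have q: "\<And>i. i \<le> n \<Longrightarrow> q i \<in> V" and qM: "\<And>i. i < n \<Longrightarrow> D (q i) (q (Suc i)) \<le> M"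
      and qd: "\<And>i j. \<lbrakk>i \<le> j; j \<le> n\<rbrakk> \<Longrightarrow> j - i \<le> \<mu> * D (q i) (q j) + \<kappa>"
      using qg by (auto simp: quasi_geodesic_def)
    have r_le: "r z \<le> D z (q i)" if "i \<le> n" for z i
      using that by (auto simp: r_def)
    have r_att: "\<exists>i\<le>n. D z (q i) = r z" for z
    proof -
      have "r z \<in> (\<lambda>i. D z (q i)) ` {..n}"
        unfolding r_def by (rule Min_in) auto
      then show ?thesis by auto
    qed
    have "\<forall>z. z \<in> geo_interval V E (q 0) (q n) \<longrightarrow> r z < D (q 0) (q n) + 1"
    proof (intro allI impI)
      fix z assume "z \<in> geo_interval V E (q 0) (q n)"
      then have "D z (q 0) \<le> D (q 0) (q n)"
        by (auto simp: geo_interval_def gdist_sym)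
      with r_le[of 0 z] show "r z < D (q 0) (q n) + 1" by simp
    qed
    then obtain z where z: "z \<in> geo_interval V E (q 0) (q n)"
        and z_max: "\<And>y. y \<in> geo_interval V E (q 0) (q n) \<Longrightarrow> r y \<le> r z"
      using ex_has_greatest_nat[of "\<lambda>z. z \<in> geo_interval V E (q 0) (q n)" z' r] z' by blast
    define R where "R = r z"
    have zV: "z \<in> V" and zd: "D (q 0) z + D z (q n) = D (q 0) (q n)"
      using z by (auto simp: geo_interval_def)
    have far: "\<And>i. i \<le> n \<Longrightarrow> R \<le> D z (q i)"
      using r_le by (simp add: R_def)
    let ?Q = "{(u, v). u \<in> V \<and> v \<in> V \<and> R \<le> D z u \<and> R \<le> D z v \<and> D u v \<le> M}"
    have near: "\<exists>i\<le>n. D y (q i) \<le> R" if "y \<in> V" "D (q 0) y + D y z = D (q 0) z \<or> D (q n) y + D y z = D (q n) z" for y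
    proof -
      have "y \<in> geo_interval V E (q 0) (q n)"
        using that(2)
      proof
        assume *: "D (q 0) y + D y z = D (q 0) z"
        have "D (q 0) (q n) \<le> D (q 0) y + D y (q n)" "D y (q n) \<le> D y z + D z (q n)"
          using gdist_triangle that q zV by auto
        with * zd that show ?thesis by (auto simp: geo_interval_def)
      next
        assume *: "D (q n) y + D y z = D (q n) z"
        have "D (q 0) (q n) \<le> D (q 0) y + D y (q n)" "D (q 0) y \<le> D (q 0) z + D z y"
          using gdist_triangle that q zV by auto
        with * zd that show ?thesis by (auto simp: geo_interval_def gdist_sym)
      qed
      then show ?thesis
        using z_max[of y] r_att[of y] by (auto simp: R_def)
    qed
    obtain y i l where y: "y \<in> V" "D (q 0) y + D y z = D (q 0) z" "D y z \<le> 2 * R" "i \<le> n" "l \<le> R"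
        "D y (q i) \<le> R" "(y, q i) \<in> ?Q ^^ l"
      using points_on_side[of "q 0" z n q R 0 M, OF q[OF le0] zV near far q le0 refl assms(2)] by blast
    obtain y' i' l' where y': "y' \<in> V" "D (q n) y' + D y' z = D (q n) z" "D y' z \<le> 2 * R" "i' \<le> n" "l' \<le> R"
        "D y' (q i') \<le> R" "(y', q i') \<in> ?Q ^^ l'"
      using points_on_side[of "q n" z n q R n M, OF q[OF le_refl] zV near far q le_refl refl assms(2)]
      by blast
    have Q_sym: "(v, u) \<in> ?Q" if "(u, v) \<in> ?Q" for u v
      using that by (auto simp: gdist_sym)
    have along: "(q a, q b) \<in> ?Q ^^ (b - a)" if "a \<le> b" "b \<le> n" for a b
      unfolding relpow_fun_conv using that q far qM by (intro exI[of _ "\<lambda>t. q (a + t)"]) auto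
    have "D (q i) (q i') \<le> 6 * R"
    proof -
      have "D (q i) (q i') \<le> D (q i) y + D y (q i')" "D y (q i') \<le> D y z + D z (q i')"
        "D z (q i') \<le> D z y' + D y' (q i')"
        using gdist_triangle y y' q zV by auto
      then show ?thesis
        using y y' by (simp add: gdist_sym)
    qed
    then have bnd: "\<mu> * D (q i) (q i') + \<kappa> \<le> 6 * \<mu> * R + \<kappa>" by simp
    have "\<exists>m. (q i, q i') \<in> ?Q ^^ m \<and> m \<le> 6 * \<mu> * R + \<kappa>"
    proof (cases "i \<le> i'")
      case True
      then have "i' - i \<le> 6 * \<mu> * R + \<kappa>"
        using qd[of i i'] y'(4) bnd by linarith
      then show ?thesis
        using along[of i i'] True y'(4) by blast
    next
      case False
      then have "(q i, q i') \<in> ?Q ^^ (i - i')"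
        using y(4) by (intro relpow_sym_rel[OF Q_sym along]) auto
      moreover have "i - i' \<le> 6 * \<mu> * R + \<kappa>"
        using qd[of i' i] False y(4) bnd unfolding gdist_sym[of E "q i'" "q i"] by linarith
      ultimately show ?thesis by blast
    qed
    then obtain m where m: "(q i, q i') \<in> ?Q ^^ m" "m \<le> 6 * \<mu> * R + \<kappa>" by blast
    have return_path: "(q i', y') \<in> ?Q ^^ l'"
      using relpow_sym_rel[OF Q_sym y'(7)] .
    define L where "L = l + (m + l')"
    have "(y, y') \<in> ?Q ^^ L"
      unfolding L_def relpow_add by (intro relcompI[OF y(7)] relcompI[OF m(1)] return_path)
    then obtain p where p: "p 0 = y" "p L = y'" "\<And>t. t < L \<Longrightarrow> (p t, p (Suc t)) \<in> ?Q"
      unfolding relpow_fun_conv by blast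
    have pV: "p t \<in> V \<and> R \<le> D z (p t)" if "t \<le> L" for t
    proof (cases "L = 0")
      case True
      then have "y = q i" using y(7) by (simp add: L_def)
      then show ?thesis using p(1) True that far[OF y(4)] y(1) by simp
    next
      case False
      then show ?thesis using p(3)[of t] p(3)[of "t - 1"] that by (cases "t = L") auto
    qed
    have zy: "z \<in> geo_interval V E (p 0) (p L)"
    proof -
      have "D (q 0) (q n) \<le> D (q 0) y + D y (q n)" "D y (q n) \<le> D y y' + D y' (q n)"
        "D y y' \<le> D y z + D z y'"
        using gdist_triangle y y' q zV by auto
      then have "D y z + D z y' = D y y'"
        using y(2) y'(2) zd by (simp add: gdist_sym)
      then show ?thesis using p zV by (simp add: geo_interval_def)
    qed
    have "R \<le> \<delta> * N + M" if N: "(2 + 6 * \<mu>) * R + \<kappa> \<le> 2 ^ N" for N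
    proof -
      have "L \<le> (2 + 6 * \<mu>) * R + \<kappa>"
        using y(5) y'(5) m(2) by (simp add: L_def algebra_simps)
      then have "L - 0 \<le> 2 ^ N"
        using N by linarith
      then obtain t where "t \<le> L" "D z (p t) \<le> \<delta> * N + M"
        using chain_near[OF assms(1), of L p M 0 L N z] pV p(3) zy by auto
      then show ?thesis
        using pV[of t] by simp
    qed
    then have "R \<le> K"
      using K by blast
    then show ?thesis
      using z_max[OF z'] r_att[of z'] by (auto simp: R_def)
  qed
  then show ?thesis by blast
qed

text \<open>Project the points of a geodesic to the quasi-geodesic.  As the projections of
  consecutive points have close indices, no index is skipped by much.\<close>

lemma quasi_geodesic_near_geodesic:
  assumes "thin \<delta>" "1 \<le> M"
  shows "\<exists>K. \<forall>n q. quasi_geodesic M \<mu> \<kappa> n q \<longrightarrow>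
    (\<forall>i\<le>n. \<exists>z\<in>geo_interval V E (q 0) (q n). D (q i) z \<le> K)"
proof -
  obtain K where K: "\<And>n q z. \<lbrakk>quasi_geodesic M \<mu> \<kappa> n q; z \<in> geo_interval V E (q 0) (q n)\<rbrakk>
      \<Longrightarrow> \<exists>i\<le>n. D z (q i) \<le> K"
    using geodesic_near_quasi_geodesic[OF assms] by metis
  define K' where "K' = M * (\<mu> * (2 * K + 1) + \<kappa>) + K"
  have "\<exists>z\<in>geo_interval V E (q 0) (q n). D (q i) z \<le> K'" if qg: "quasi_geodesic M \<mu> \<kappa> n q" and i: "i \<le> n" for n q i
  proof -
    have q: "\<And>i. i \<le> n \<Longrightarrow> q i \<in> V" and qM: "\<And>i. i < n \<Longrightarrow> D (q i) (q (Suc i)) \<le> M"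
      and qd: "\<And>i j. \<lbrakk>i \<le> j; j \<le> n\<rbrakk> \<Longrightarrow> j - i \<le> \<mu> * D (q i) (q j) + \<kappa>"
      using qg by (auto simp: quasi_geodesic_def)
    have step: "D (q a) (q b) \<le> M * (b - a)" if "a \<le> b" "b \<le> n" for a b
      using that
    proof (induction b rule: dec_induct)
      case (step b)
      have "D (q a) (q (Suc b)) \<le> D (q a) (q b) + D (q b) (q (Suc b))"
        using gdist_triangle q step by simp
      with step qM[of b] show ?case by (simp add: Suc_diff_le)
    qed simp
    let ?m = "D (q 0) (q n)"
    obtain f where f: "discrete_geodesic V E ?m f" "f 0 = q 0" "f ?m = q n"
      using geodesic_exists q by blast
    have fb: "f k \<in> geo_interval V E (q 0) (q n)" if "k \<le> ?m" for k
      using geodesic_in_geo_interval[OF f(1), of 0 k ?m] that f by simp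
    have "\<exists>j\<le>n. D (f k) (q j) \<le> K \<and> (k = ?m \<longrightarrow> j = n)" if "k \<le> ?m" for k
      using K[OF qg fb[OF that]] f by (cases "k = ?m") auto
    then obtain \<tau> where \<tau>: "\<And>k. k \<le> ?m \<Longrightarrow> \<tau> k \<le> n \<and> D (f k) (q (\<tau> k)) \<le> K \<and> (k = ?m \<longrightarrow> \<tau> k = n)"
      by metis
    define k where "k = (LEAST k. i \<le> \<tau> k)"
    have "i \<le> \<tau> ?m" using \<tau>[of ?m] i by simp
    then have k: "k \<le> ?m" "i \<le> \<tau> k"
      unfolding k_def by (auto intro: Least_le LeastI)
    show ?thesis
    proof (cases "k = 0")
      case True
      then have "D (f 0) (q (\<tau> 0)) \<le> K" using \<tau> k by blast
      have "i \<le> \<mu> * K + \<kappa>"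
      proof -
        have "\<tau> 0 - 0 \<le> \<mu> * D (q 0) (q (\<tau> 0)) + \<kappa>" using qd[of 0 "\<tau> 0"] \<tau>[of 0] by simp
        also have "\<dots> \<le> \<mu> * K + \<kappa>" using \<open>D (f 0) (q (\<tau> 0)) \<le> K\<close> f by simp
        finally show ?thesis using k True by simp
      qed
      also have "\<dots> \<le> \<mu> * (2 * K + 1) + \<kappa>" by simp
      finally have "M * i \<le> K'"
        unfolding K'_def by (simp add: trans_le_add1)
      then have "D (q i) (q 0) \<le> K'"
        using step[of 0 i] i by (simp add: gdist_sym)
      then show ?thesis using fb[of 0] f by auto
    next
      case False
      then obtain j where j: "k = Suc j" by (cases k) auto
      have ji: "\<tau> j < i"
        using not_less_Least[of j "\<lambda>k. i \<le> \<tau> k"] j by (simp add: k_def)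
      have jm: "j \<le> ?m" using j k by simp
      have "D (f j) (f k) = 1"
        using f(1) j k by (auto simp: discrete_geodesic_def)
      have "D (q (\<tau> j)) (q (\<tau> k)) \<le> D (q (\<tau> j)) (f j) + D (f j) (q (\<tau> k))"
        "D (f j) (q (\<tau> k)) \<le> D (f j) (f k) + D (f k) (q (\<tau> k))"
        using gdist_triangle \<tau> jm k q f(1) by (auto simp: discrete_geodesic_def)
      then have "D (q (\<tau> j)) (q (\<tau> k)) \<le> 2 * K + 1"
        using \<tau>[OF jm] \<tau>[OF k(1)] \<open>D (f j) (f k) = 1\<close> by (simp add: gdist_sym)
      then have "\<mu> * D (q (\<tau> j)) (q (\<tau> k)) + \<kappa> \<le> \<mu> * (2 * K + 1) + \<kappa>"
        by (intro add_mono mult_le_mono2) auto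
      then have "\<tau> k - i \<le> \<mu> * (2 * K + 1) + \<kappa>"
        using qd[of "\<tau> j" "\<tau> k"] \<tau>[OF k(1)] ji k by linarith
      then have "M * (\<tau> k - i) \<le> M * (\<mu> * (2 * K + 1) + \<kappa>)"
        by (rule mult_le_mono2)
      then have "D (q i) (q (\<tau> k)) \<le> M * (\<mu> * (2 * K + 1) + \<kappa>)"
        using step[of i "\<tau> k"] k \<tau>[OF k(1)] by linarith
      moreover have "D (q i) (f k) \<le> D (q i) (q (\<tau> k)) + D (q (\<tau> k)) (f k)"
        using gdist_triangle q i \<tau>[OF k(1)] f(1) k by (auto simp: discrete_geodesic_def)
      ultimately have "D (q i) (f k) \<le> K'"
        using \<tau>[OF k(1)] by (simp add: K'_def gdist_sym)
      then show ?thesis using fb k by blast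
    qed
  qed
  then show ?thesis by blast
qed

end

text \<open>The map \<open>\<sigma>\<close> takes geodesics to quasi-geodesics.  So a point of a side is moved to a side of the
  triangle with the image vertices, from there by thinness to another side, and from there to the
  image of a side of the original triangle.\<close>

lemma thin_quasi_isometry:
  fixes A :: "'a set" and V :: "'v set"
  assumes A: "connected_simple_graph A EA" and V: "connected_simple_graph V EV"
    and thin: "connected_simple_graph.thin A EA \<delta>"
    and \<pi>: "\<And>a. a \<in> A \<Longrightarrow> \<pi> a \<in> V" "\<And>a b. \<lbrakk>a \<in> A; b \<in> A\<rbrakk> \<Longrightarrow> gdist EV (\<pi> a) (\<pi> b) \<le> \<mu> * gdist EA a b"
    and \<sigma>: "\<And>v. v \<in> V \<Longrightarrow> \<sigma> v \<in> A" "\<And>v. v \<in> V \<Longrightarrow> gdist EV v (\<pi> (\<sigma> v)) \<le> R"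
      "\<And>u v. {u, v} \<in> EV \<Longrightarrow> gdist EA (\<sigma> u) (\<sigma> v) \<le> M"
  shows "\<exists>\<delta>'. connected_simple_graph.thin V EV \<delta>'"
proof -
  interpret A: connected_simple_graph A EA by fact
  interpret V: connected_simple_graph V EV by fact
  obtain K1 where K1: "\<And>n q z. \<lbrakk>A.quasi_geodesic (Suc M) \<mu> (2 * R) n q; z \<in> geo_interval A EA (q 0) (q n)\<rbrakk>
      \<Longrightarrow> \<exists>i\<le>n. A.D z (q i) \<le> K1"
    using A.geodesic_near_quasi_geodesic[OF thin, of "Suc M" \<mu> "2 * R"] by fastforce
  obtain K2 where K2: "\<And>n q i. \<lbrakk>A.quasi_geodesic (Suc M) \<mu> (2 * R) n q; i \<le> n\<rbrakk>
      \<Longrightarrow> \<exists>z\<in>geo_interval A EA (q 0) (q n). A.D (q i) z \<le> K2"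
    using A.quasi_geodesic_near_geodesic[OF thin, of "Suc M" \<mu> "2 * R"] by fastforce
  have lower: "V.D u v \<le> \<mu> * A.D (\<sigma> u) (\<sigma> v) + 2 * R" if "u \<in> V" "v \<in> V" for u v
  proof -
    have "V.D u v \<le> V.D u (\<pi> (\<sigma> u)) + V.D (\<pi> (\<sigma> u)) v"
      "V.D (\<pi> (\<sigma> u)) v \<le> V.D (\<pi> (\<sigma> u)) (\<pi> (\<sigma> v)) + V.D (\<pi> (\<sigma> v)) v"
      using V.gdist_triangle \<pi> \<sigma> that by auto
    then show ?thesis
      using \<pi>(2)[of "\<sigma> u" "\<sigma> v"] \<sigma>(1,2)[of u] \<sigma>(1,2)[of v] that by (simp add: gdist_sym)
  qed
  have qg: "A.quasi_geodesic (Suc M) \<mu> (2 * R) n (\<sigma> \<circ> f)" if f: "discrete_geodesic V EV n f" for n f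
    unfolding A.quasi_geodesic_def
  proof (intro conjI allI impI)
    fix i assume "i < n"
    then have "V.D (f i) (f (Suc i)) = 1" "f i \<in> V" "f (Suc i) \<in> V"
      using f by (auto simp: discrete_geodesic_def)
    then have "{f i, f (Suc i)} \<in> EV" by (intro V.gdist_1_edge) auto
    then show "A.D ((\<sigma> \<circ> f) i) ((\<sigma> \<circ> f) (Suc i)) \<le> Suc M"
      using \<sigma>(3) by (simp add: le_SucI)
  next
    fix i j assume "i \<le> j" "j \<le> n"
    then have "V.D (f i) (f j) = j - i" "f i \<in> V" "f j \<in> V"
      using f by (auto simp: discrete_geodesic_def)
    then show "j - i \<le> \<mu> * A.D ((\<sigma> \<circ> f) i) ((\<sigma> \<circ> f) j) + 2 * R"
      using lower[of "f i" "f j"] by simp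
  qed (use f \<sigma> in \<open>auto simp: discrete_geodesic_def\<close>)
  have near: "\<exists>v\<in>geo_interval V EV x y. A.D w (\<sigma> v) \<le> K1" if xyw: "x \<in> V" "y \<in> V" "w \<in> geo_interval A EA (\<sigma> x) (\<sigma> y)" for x y w
  proof -
    obtain g where g: "discrete_geodesic V EV (V.D x y) g" "g 0 = x" "g (V.D x y) = y"
      using V.geodesic_exists[OF xyw(1,2)] by blast
    then obtain i where "i \<le> V.D x y" "A.D w (\<sigma> (g i)) \<le> K1"
      using K1[OF qg[OF g(1)], of w] xyw by auto
    then show ?thesis
      using V.geodesic_in_geo_interval[OF g(1), of 0 i "V.D x y"] g by auto
  qed
  have "V.thin (\<mu> * (K2 + \<delta> + K1) + 2 * R)"
    unfolding V.thin_def
  proof (intro ballI)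
    fix x y t u assume x: "x \<in> V" and y: "y \<in> V" and t: "t \<in> V" and u: "u \<in> geo_interval V EV x y"
    obtain f where f: "discrete_geodesic V EV (V.D x y) f" "f 0 = x" "f (V.D x y) = y" "f (V.D x u) = u"
      using V.geodesic_through[OF x y u] by blast
    have "V.D x u \<le> V.D x y" "u \<in> V" using u by (auto simp: geo_interval_def)
    then obtain z where z: "z \<in> geo_interval A EA (\<sigma> x) (\<sigma> y)" "A.D (\<sigma> u) z \<le> K2"
      using K2[OF qg[OF f(1)], of "V.D x u"] f by auto
    obtain w where w: "w \<in> geo_interval A EA (\<sigma> x) (\<sigma> t) \<union> geo_interval A EA (\<sigma> t) (\<sigma> y)" "A.D z w \<le> \<delta>"
      using thin[unfolded A.thin_def] z(1) \<sigma>(1) x y t by blast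
    then obtain v where v: "v \<in> geo_interval V EV x t \<union> geo_interval V EV t y" "A.D w (\<sigma> v) \<le> K1"
      using near[OF x t] near[OF t y] by blast
    have in_A: "\<sigma> u \<in> A" "z \<in> A" "w \<in> A" "\<sigma> v \<in> A" "v \<in> V"
      using \<sigma>(1) \<open>u \<in> V\<close> z w v A.geo_interval_V V.geo_interval_V by blast+
    have "A.D (\<sigma> u) (\<sigma> v) \<le> A.D (\<sigma> u) z + A.D z (\<sigma> v)" "A.D z (\<sigma> v) \<le> A.D z w + A.D w (\<sigma> v)"
      using A.gdist_triangle in_A by auto
    then have "A.D (\<sigma> u) (\<sigma> v) \<le> K2 + \<delta> + K1"
      using z w v by linarith
    then have "\<mu> * A.D (\<sigma> u) (\<sigma> v) + 2 * R \<le> \<mu> * (K2 + \<delta> + K1) + 2 * R"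
      by simp
    then have "V.D u v \<le> \<mu> * (K2 + \<delta> + K1) + 2 * R"
      using lower[OF \<open>u \<in> V\<close> \<open>v \<in> V\<close>] by linarith
    with v show "\<exists>v\<in>geo_interval V EV x t \<union> geo_interval V EV t y. V.D u v \<le> \<mu> * (K2 + \<delta> + K1) + 2 * R"
      by blast
  qed
  then show ?thesis ..
qed

section \<open>Boundary points as sets of discrete rays\<close>

context connected_simple_graph
begin

text \<open>Rays are parametrized by arc length, so a point of \<open>c\<close> close to \<open>c' s\<close> has a parameter which differs
  from \<open>s\<close> at most by their distance plus the distance of the starting points.\<close>

lemma ray_equiv_iff:
  "(c, c') \<in> ray_equiv P pdist \<longleftrightarrow>
     c \<in> graph_rays V E \<and> c' \<in> graph_rays V E \<and> (\<exists>r. \<forall>t\<ge>0. pdist (c t) (c' t) \<le> r)"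
proof (intro iffI conjI)
  assume *: "(c, c') \<in> ray_equiv P pdist"
  then show c: "c \<in> graph_rays V E" "c' \<in> graph_rays V E"
    by (auto simp: ray_equiv_def)
  from * obtain r where r: "c ` {0..} \<subseteq> nbhd_of P pdist r (c' ` {0..})"
    by (auto simp: ray_equiv_def)
  have "pdist (c t) (c' t) \<le> 2 * r + pdist (c 0) (c' 0)" if t: "0 \<le> t" for t
  proof -
    have "c t \<in> nbhd_of P pdist r (c' ` {0..})"
      using r t by auto
    then obtain s where s: "0 \<le> s" "pdist (c t) (c' s) < r"
      by (auto simp: nbhd_of_def)
    have "pdist (c 0) (c t) \<le> pdist (c 0) (c' 0) + pdist (c' 0) (c' s) + pdist (c' s) (c t)"
      "pdist (c' 0) (c' s) \<le> pdist (c' 0) (c 0) + pdist (c 0) (c t) + pdist (c t) (c' s)"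
      "pdist (c t) (c' t) \<le> pdist (c t) (c' s) + pdist (c' s) (c' t)"
      using pdist_triangle[of "c 0" "c' 0" "c t"] pdist_triangle[of "c' 0" "c' s" "c t"]
        pdist_triangle[of "c' 0" "c 0" "c' s"] pdist_triangle[of "c 0" "c t" "c' s"]
        pdist_triangle[of "c t" "c' s" "c' t"] ray_in[OF c(1)] ray_in[OF c(2)] s t
      by force+
    then have "t \<le> pdist (c 0) (c' 0) + s + r" "s \<le> pdist (c 0) (c' 0) + t + r"
        "pdist (c t) (c' t) \<le> r + \<bar>s - t\<bar>"
      using s t ray_dist[OF c(1)] ray_dist[OF c(2)] pdist_sym[of "c' s" "c t"] pdist_sym[of "c' 0" "c 0"]
      by auto
    then show ?thesis by linarith
  qed
  then show "\<exists>r. \<forall>t\<ge>0. pdist (c t) (c' t) \<le> r" by blast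
next
  assume "c \<in> graph_rays V E \<and> c' \<in> graph_rays V E \<and> (\<exists>r. \<forall>t\<ge>0. pdist (c t) (c' t) \<le> r)"
  then obtain r where c: "c \<in> graph_rays V E" "c' \<in> graph_rays V E"
    and r: "\<And>t. 0 \<le> t \<Longrightarrow> pdist (c t) (c' t) \<le> r"
    by blast
  have "c ` {0..} \<subseteq> nbhd_of P pdist (r + 1) (c' ` {0..})"
  proof
    fix x assume "x \<in> c ` {0..}"
    then obtain t where "0 \<le> t" "x = c t" by auto
    then show "x \<in> nbhd_of P pdist (r + 1) (c' ` {0..})"
      using r[of t] ray_in[OF c(1)] by (force simp: nbhd_of_def)
  qed
  moreover have "c' ` {0..} \<subseteq> nbhd_of P pdist (r + 1) (c ` {0..})"
  proof
    fix x assume "x \<in> c' ` {0..}"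
    then obtain t where "0 \<le> t" "x = c' t" by auto
    then show "x \<in> nbhd_of P pdist (r + 1) (c ` {0..})"
      using r[of t] ray_in[OF c(2)] pdist_sym[of "c t" "c' t"] by (force simp: nbhd_of_def)
  qed
  ultimately show "(c, c') \<in> ray_equiv P pdist"
    using c by (auto simp: ray_equiv_def)
qed

lemma equiv_ray_equiv: "equiv (graph_rays V E) (ray_equiv P pdist)"
proof (rule equivI)
  show "ray_equiv P pdist \<subseteq> graph_rays V E \<times> graph_rays V E"
    by (auto simp: ray_equiv_def)
  show "refl_on (graph_rays V E) (ray_equiv P pdist)"
    by (rule refl_onI) (auto simp: ray_equiv_iff)
  show "sym (ray_equiv P pdist)"
    by (rule symI) (auto simp: ray_equiv_iff pdist_sym)
  show "trans (ray_equiv P pdist)"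
  proof (rule transI)
    fix a b c assume "(a, b) \<in> ray_equiv P pdist" "(b, c) \<in> ray_equiv P pdist"
    then obtain r s where *: "a \<in> graph_rays V E" "b \<in> graph_rays V E" "c \<in> graph_rays V E"
      "\<And>t. 0 \<le> t \<Longrightarrow> pdist (a t) (b t) \<le> r" "\<And>t. 0 \<le> t \<Longrightarrow> pdist (b t) (c t) \<le> s"
      unfolding ray_equiv_iff by blast
    have "pdist (a t) (c t) \<le> r + s" if "0 \<le> t" for t
      using pdist_triangle[of "a t" "b t" "c t"] *(4,5)[OF that] ray_in *(1-3) that by fastforce
    then show "(a, c) \<in> ray_equiv P pdist"
      using * by (auto simp: ray_equiv_iff)
  qed
qed

text \<open>Between integral times a ray moves by at most 1.\<close>

lemma ray_equiv_at_integers: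
  assumes c: "c \<in> graph_rays V E" "c' \<in> graph_rays V E"
    and r: "\<And>n. pdist (c (real n)) (c' (real n)) \<le> r"
  shows "(c, c') \<in> ray_equiv P pdist"
proof -
  have "pdist (c t) (c' t) \<le> r + 2" if t: "0 \<le> t" for t
  proof -
    define n where "n = nat \<lfloor>t\<rfloor>"
    have n: "real n \<le> t" "t \<le> real n + 1"
      using t by (auto simp: n_def)
    have "pdist (c t) (c' t) \<le> pdist (c t) (c (real n)) + pdist (c (real n)) (c' (real n))
        + pdist (c' (real n)) (c' t)"
      using pdist_triangle[of "c t" "c (real n)" "c' t"] pdist_triangle[of "c (real n)" "c' (real n)" "c' t"]
        ray_in[OF c(1)] ray_in[OF c(2)] t by force
    then show ?thesis
      using r[of n] ray_dist[OF c(1), of t "real n"] ray_dist[OF c(2), of "real n" t] n t by linarith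
  qed
  then show ?thesis
    using c by (auto simp: ray_equiv_iff)
qed

lemma realize_equiv_iff:
  assumes "discrete_ray V E f" "discrete_ray V E f'"
  shows "(realize f, realize f') \<in> ray_equiv P pdist \<longleftrightarrow> (\<exists>r. \<forall>t. D (f t) (f' t) \<le> r)"
proof
  have fV: "\<And>t. f t \<in> V" "\<And>t. f' t \<in> V"
    using assms by (auto simp: discrete_ray_def)
  {
    assume "(realize f, realize f') \<in> ray_equiv P pdist"
    then obtain r where r: "\<And>t. 0 \<le> t \<Longrightarrow> pdist (realize f t) (realize f' t) \<le> r"
      unfolding ray_equiv_iff by blast
    have "D (f t) (f' t) \<le> nat \<lceil>r\<rceil>" for t
      using r[of "real t"] fV by simp linarith
    then show "\<exists>r. \<forall>t. D (f t) (f' t) \<le> r" by blast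
  next
    assume "\<exists>r. \<forall>t. D (f t) (f' t) \<le> r"
    then obtain r where r: "\<And>t. D (f t) (f' t) \<le> r" by blast
    show "(realize f, realize f') \<in> ray_equiv P pdist"
      by (rule ray_equiv_at_integers[of _ _ "real r"]) (use realize_ray assms fV r in auto)
  }
qed

lemma ray_equiv_realize:
  assumes "c \<in> graph_rays V E" "discrete_ray V E f" "\<And>n. c (real n) = vertex_point (f n)"
  shows "(c, realize f) \<in> ray_equiv P pdist"
  by (rule ray_equiv_at_integers[of _ _ 0]) (use assms realize_ray in auto)

text \<open>The boundary point \<open>\<gamma>\<close> as seen by discrete rays: it is determined by any element of this set.\<close>

definition rays_to :: "(real \<Rightarrow> 'v \<Rightarrow> real) set \<Rightarrow> (nat \<Rightarrow> 'v) set" where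
  "rays_to \<gamma> = {f. discrete_ray V E f \<and> realize f \<in> \<gamma>}"

lemma boundary_class: "\<lbrakk>\<gamma> \<in> \<partial>V; c \<in> \<gamma>\<rbrakk> \<Longrightarrow> \<gamma> = ray_equiv P pdist `` {c}"
  unfolding gromov_boundary_def
  by (erule quotientE) (simp add: equiv_class_eq[OF equiv_ray_equiv])

lemma class_in_boundary: "c \<in> graph_rays V E \<Longrightarrow> ray_equiv P pdist `` {c} \<in> \<partial>V"
  unfolding gromov_boundary_def by (rule quotientI)

lemma rays_to_discrete: "f \<in> rays_to \<gamma> \<Longrightarrow> discrete_ray V E f"
  by (simp add: rays_to_def)

lemma rays_to_V: "f \<in> rays_to \<gamma> \<Longrightarrow> f i \<in> V"
  by (simp add: rays_to_def discrete_ray_def)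

lemma rays_to_of_ray:
  assumes "c \<in> graph_rays V E" "c 0 = vertex_point x"
  obtains f where "f \<in> rays_to (ray_equiv P pdist `` {c})" "f 0 = x" "\<And>n. c (real n) = vertex_point (f n)"
proof -
  obtain f where f: "discrete_ray V E f" "f 0 = x" "\<And>n. c (real n) = vertex_point (f n)"
    using ray_from_vertex[OF assms] by blast
  then have "f \<in> rays_to (ray_equiv P pdist `` {c})"
    using ray_equiv_realize[OF assms(1)] by (auto simp: rays_to_def)
  then show ?thesis using f that by blast
qed

lemma rays_to_bounded:
  assumes "\<gamma> \<in> \<partial>V" "f \<in> rays_to \<gamma>" "f' \<in> rays_to \<gamma>"
  shows "\<exists>r. \<forall>t. D (f t) (f' t) \<le> r"
proof -
  have "(realize f, realize f') \<in> ray_equiv P pdist"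
    using boundary_class[OF assms(1), of "realize f"] assms by (auto simp: rays_to_def)
  then show ?thesis
    using realize_equiv_iff assms rays_to_discrete by blast
qed

lemma rays_to_closed_bounded:
  assumes "\<gamma> \<in> \<partial>V" "f \<in> rays_to \<gamma>" "discrete_ray V E f'" "\<And>t. D (f t) (f' t) \<le> r"
  shows "f' \<in> rays_to \<gamma>"
proof -
  have "(realize f, realize f') \<in> ray_equiv P pdist"
    using realize_equiv_iff assms rays_to_discrete by blast
  then show ?thesis
    using boundary_class[OF assms(1), of "realize f"] assms by (auto simp: rays_to_def)
qed

lemma rays_to_inj:
  assumes "\<gamma> \<in> \<partial>V" "\<gamma>' \<in> \<partial>V" "f \<in> rays_to \<gamma>" "f \<in> rays_to \<gamma>'"
  shows "\<gamma> = \<gamma>'"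
  using boundary_class[of \<gamma> "realize f"] boundary_class[of \<gamma>' "realize f"] assms
  by (simp add: rays_to_def)

text \<open>A representing ray may start inside an edge; its tail from a vertex on it represents the same
  boundary point.\<close>

lemma rays_to_nonempty:
  assumes "\<gamma> \<in> \<partial>V"
  shows "\<exists>f. f \<in> rays_to \<gamma>"
proof -
  obtain c where c: "c \<in> graph_rays V E" "\<gamma> = ray_equiv P pdist `` {c}"
    using assms unfolding gromov_boundary_def by (auto elim: quotientE)
  obtain T v where T: "0 \<le> T" "v \<in> V" "c T = vertex_point v"
    using ray_meets_vertex[OF c(1)] by blast
  define c' where "c' = (\<lambda>t\<in>{0..}. c (t + T))"
  have "c' \<in> {0..} \<rightarrow>\<^sub>E P"
    using ray_in[OF c(1)] T by (auto simp: c'_def)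
  moreover have "pdist (c' s) (c' t) = \<bar>s - t\<bar>" if "0 \<le> s" "0 \<le> t" for s t
    using ray_dist[OF c(1), of "s + T" "t + T"] T that by (simp add: c'_def)
  ultimately have c': "c' \<in> graph_rays V E" "c' 0 = vertex_point v"
    using T by (auto simp: geodesic_rays_def c'_def)
  have "pdist (c t) (c' t) \<le> T" if "0 \<le> t" for t
    using ray_dist[OF c(1), of t "t + T"] T that by (simp add: c'_def)
  then have cc: "(c, c') \<in> ray_equiv P pdist"
    using c c' by (auto simp: ray_equiv_iff)
  then have "\<gamma> = ray_equiv P pdist `` {c'}"
    using c(2) equiv_class_eq[OF equiv_ray_equiv] by blast
  then show ?thesis
    using rays_to_of_ray[OF c'] by blast
qed

lemma rays_to_tail:
  assumes "\<gamma> \<in> \<partial>V" "f \<in> rays_to \<gamma>"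
  shows "(\<lambda>i. f (i + k)) \<in> rays_to \<gamma>"
proof (rule rays_to_closed_bounded[OF assms(1,2), where r = k])
  show "discrete_ray V E (\<lambda>i. f (i + k))"
    using assms discrete_ray_tail by (auto simp: rays_to_def)
  show "D (f t) (f (t + k)) \<le> k" for t
    using rays_to_discrete[OF assms(2)] by (simp add: discrete_ray_def)
qed

lemma ray_interval_iff:
  assumes "\<gamma> \<in> \<partial>V" "x \<in> V"
  shows "v \<in> ray_interval V E x \<gamma> \<longleftrightarrow> (\<exists>f\<in>rays_to \<gamma>. f 0 = x \<and> v \<in> range f)"
proof
  assume "v \<in> ray_interval V E x \<gamma>"
  then obtain c t where c: "v \<in> V" "c \<in> graph_rays V E" "c 0 = vertex_point x" "c \<in> \<gamma>" "0 \<le> t"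
      "vertex_point v = c t"
    by (auto simp: ray_interval_def)
  obtain f where f: "f \<in> rays_to (ray_equiv P pdist `` {c})" "f 0 = x" "\<And>n. c (real n) = vertex_point (f n)"
    using rays_to_of_ray[OF c(2,3)] by blast
  have "real (D x v) = t"
    using ray_dist[OF c(2), of 0 t] c(1,3,5) c(6)[symmetric] assms(2) by simp
  then have "c (real (D x v)) = vertex_point v"
    by (simp only: c(6))
  then have "f (D x v) = v"
    by (simp only: f(3) vertex_point_inj)
  then have "v \<in> range f"
    by (rule range_eqI[OF sym])
  moreover have "f \<in> rays_to \<gamma>"
    using f(1) unfolding boundary_class[OF assms(1) c(4), symmetric] .
  ultimately show "\<exists>f\<in>rays_to \<gamma>. f 0 = x \<and> v \<in> range f"
    using f(2) by blast
next
  assume "\<exists>f\<in>rays_to \<gamma>. f 0 = x \<and> v \<in> range f"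
  then obtain f n where f: "f \<in> rays_to \<gamma>" "f 0 = x" "v = f n"
    by blast
  then have "vertex_point v = realize f (real n)" by simp
  then have "vertex_point v \<in> realize f ` {0..}" by (rule image_eqI) simp
  then show "v \<in> ray_interval V E x \<gamma>"
    using f realize_ray[of f] rays_to_V[OF f(1), of n] realize_0[of f] unfolding ray_interval_def rays_to_def
    by blast
qed

lemma neighbours_finite:
  assumes "locally_finite_graph V E" "v \<in> V"
  shows "finite {w. {v, w} \<in> E}"
proof -
  have "finite {e \<in> E. v \<in> e}"
    using assms by (simp add: locally_finite_graph_def)
  moreover have "finite e" if "e \<in> E" for e
    using that simple by (intro card_ge_0_finite) (auto simp: simple_graph_def)
  ultimately have "finite (\<Union>{e \<in> E. v \<in> e})"
    by (intro finite_Union) auto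
  moreover have "{w. {v, w} \<in> E} \<subseteq> \<Union>{e \<in> E. v \<in> e}" by auto
  ultimately show ?thesis by (rule rev_finite_subset)
qed

lemma ball_finite:
  assumes "locally_finite_graph V E" "x \<in> V"
  shows "finite {v \<in> V. D x v \<le> n}"
proof (induction n)
  case 0
  have "{v \<in> V. D x v \<le> 0} = {x}"
    using gdist_eq_0 assms by auto
  then show ?case by simp
next
  case (Suc n)
  have "{v \<in> V. D x v \<le> Suc n} \<subseteq> {v \<in> V. D x v \<le> n} \<union> (\<Union>u\<in>{v \<in> V. D x v \<le> n}. {w. {u, w} \<in> E})"
  proof
    fix v assume v: "v \<in> {v \<in> V. D x v \<le> Suc n}"
    show "v \<in> {v \<in> V. D x v \<le> n} \<union> (\<Union>u\<in>{v \<in> V. D x v \<le> n}. {w. {u, w} \<in> E})"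
    proof (cases "D x v = Suc n")
      case True
      have "(x, v) \<in> adjacency E ^^ Suc n"
        using gdist_relpow[of x v] True assms v by auto
      then obtain u where "(x, u) \<in> adjacency E ^^ n" "(u, v) \<in> adjacency E"
        by auto
      then show ?thesis
        using gdist_le[of x u n E] adjacency_V[of u v] by (auto simp: adjacency_def)
    qed (use v in auto)
  qed
  moreover have "finite ({v \<in> V. D x v \<le> n} \<union> (\<Union>u\<in>{v \<in> V. D x v \<le> n}. {w. {u, w} \<in> E}))"
    using Suc neighbours_finite[OF assms(1)] by auto
  ultimately show ?case by (rule finite_subset)
qed

lemma countable_V:
  assumes "locally_finite_graph V E"
  shows "countable V"
proof -
  obtain x where x: "x \<in> V"
    using connected by (auto simp: connected_graph_def)
  have "V \<subseteq> (\<Union>n. {v \<in> V. D x v \<le> n})" by auto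
  moreover have "countable (\<Union>n. {v \<in> V. D x v \<le> n})"
    using ball_finite[OF assms x] by (intro countable_UN) (auto intro: countable_finite)
  ultimately show ?thesis by (rule countable_subset)
qed

text \<open>Koenig's lemma: since every vertex has finitely many neighbours, there are nested infinite sets of
  indices such that the rays with index in the \<open>n\<close>-th set agree up to time \<open>n\<close>.\<close>

lemma ray_limit:
  assumes lf: "locally_finite_graph V E" and b: "\<And>N :: nat. discrete_ray V E (b N)" "\<And>N. b N 0 = x"
  obtains h where "discrete_ray V E h" "h 0 = x" "\<And>n. infinite {N. \<forall>i\<le>n. b N i = h i}"
proof -
  define good where "good n S \<longleftrightarrow> infinite S \<and> (\<forall>N\<in>S. \<forall>M\<in>S. \<forall>i\<le>n. b N i = b M i)" for n :: nat and S
  have "\<exists>S. \<forall>n. good n (S n) \<and> S (Suc n) \<subseteq> S n"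
  proof (rule dependent_nat_choice)
    show "\<exists>S. good 0 S"
      using b(2) by (intro exI[of _ UNIV]) (auto simp: good_def)
    fix S and n :: nat assume S: "good n S"
    then have "S \<noteq> {}"
      unfolding good_def by (metis finite.emptyI)
    then obtain M where M: "M \<in> S"
      by blast
    have "(\<lambda>N. b N (Suc n)) ` S \<subseteq> {w. {b M n, w} \<in> E}"
    proof clarify
      fix N assume "N \<in> S"
      then have "b N n = b M n"
        using S M unfolding good_def by blast
      then show "{b M n, b N (Suc n)} \<in> E"
        using discrete_ray_edge[OF b(1), of N n] by simp
    qed
    moreover have "finite {w. {b M n, w} \<in> E}"
      using neighbours_finite[OF lf] b(1)[of M] by (auto simp: discrete_ray_def)
    ultimately have "finite ((\<lambda>N. b N (Suc n)) ` S)"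
      by (rule finite_subset)
    then obtain N where N: "N \<in> S" "infinite {a \<in> S. b a (Suc n) = b N (Suc n)}"
      using pigeonhole_infinite[of S "\<lambda>N. b N (Suc n)"] S unfolding good_def by blast
    have "good (Suc n) {a \<in> S. b a (Suc n) = b N (Suc n)}"
      unfolding good_def
    proof (intro conjI ballI allI impI N(2))
      fix K L i assume "K \<in> {a \<in> S. b a (Suc n) = b N (Suc n)}" "L \<in> {a \<in> S. b a (Suc n) = b N (Suc n)}" "i \<le> Suc n"
      then consider "b K i = b L i" | "K \<in> S" "L \<in> S" "i \<le> n"
        by (cases "i = Suc n") auto
      then show "b K i = b L i"
        using S unfolding good_def by cases blast+
    qed
    then show "\<exists>S'. good (Suc n) S' \<and> S' \<subseteq> S"
      by (intro exI[of _ "{a \<in> S. b a (Suc n) = b N (Suc n)}"]) auto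
  qed
  then obtain S where S: "\<And>n. good n (S n)" "\<And>n. S (Suc n) \<subseteq> S n"
    by blast
  have mono: "S n \<subseteq> S m" if "m \<le> n" for m n
    using that S(2) by (induction n rule: dec_induct) auto
  have "S n \<noteq> {}" for n
    using S(1)[of n] unfolding good_def by (metis finite.emptyI)
  then have "\<exists>N. N \<in> S n" for n
    by blast
  then obtain pick where pick: "\<And>n. pick n \<in> S n" by metis
  define h where "h n = b (pick n) n" for n
  have agree: "b N i = h i" if "N \<in> S n" "i \<le> n" for N n i
  proof -
    have "N \<in> S i" using mono[OF that(2)] that(1) by auto
    then show ?thesis
      using S(1)[of i] pick[of i] unfolding good_def h_def by blast
  qed
  have "discrete_ray V E h"
    unfolding discrete_ray_def
  proof (intro conjI allI impI)
    fix i
    show "h i \<in> V"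
      using b(1) by (auto simp: h_def discrete_ray_def)
    fix j assume "i \<le> j"
    then have "h i = b (pick j) i" "h j = b (pick j) j"
      using agree[OF pick] by auto
    then show "D (h i) (h j) = j - i"
      using b(1)[of "pick j"] \<open>i \<le> j\<close> by (simp add: discrete_ray_def)
  qed
  moreover have "h 0 = x"
    using b(2) by (simp add: h_def)
  moreover have "infinite {N. \<forall>i\<le>n. b N i = h i}" for n
  proof -
    have "S n \<subseteq> {N. \<forall>i\<le>n. b N i = h i}"
      using agree by auto
    then show ?thesis
      using S(1)[of n] infinite_super unfolding good_def by blast
  qed
  ultimately show ?thesis using that by blast
qed

end

section \<open>Rays in hyperbolic graphs\<close>

locale hyperbolic_graph = connected_simple_graph +
  fixes \<delta> :: nat
  assumes locally_finite: "locally_finite_graph V E" and thin: "thin \<delta>"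
begin

lemma thinE:
  assumes "x \<in> V" "y \<in> V" "z \<in> V" "u \<in> geo_interval V E x y"
  obtains w where "w \<in> geo_interval V E x z \<or> w \<in> geo_interval V E z y" "D u w \<le> \<delta>"
proof -
  have "\<exists>w\<in>geo_interval V E x z \<union> geo_interval V E z y. D u w \<le> \<delta>"
    using thin assms by (simp add: thin_def)
  then show ?thesis
    using that by blast
qed

text \<open>In the triangle with vertices \<open>x\<close>, \<open>y\<close> and \<open>z\<close>, a point near \<open>w\<close> on one of the sides at \<open>z\<close> must be
  near \<open>z\<close>, because its distance from \<open>x\<close> is almost that of \<open>z\<close>.\<close>

lemma bigon:
  assumes "x \<in> V" "y \<in> V" "w \<in> geo_interval V E x y" "z \<in> geo_interval V E x y" "D x w = D x z"
  shows "D w z \<le> 2 * \<delta>"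
proof -
  have wz: "w \<in> V" "z \<in> V" "D x z + D z y = D x y"
    using assms(3,4) by (auto simp: geo_interval_def)
  obtain v where v: "v \<in> geo_interval V E x z \<or> v \<in> geo_interval V E z y" "D w v \<le> \<delta>"
    using thinE[OF assms(1,2) wz(2) assms(3)] by blast
  then have vV: "v \<in> V" using geo_interval_V by blast
  have sym: "D v w = D w v" "D v z = D z v"
    by (rule gdist_sym)+
  have tri: "D w z \<le> D w v + D v z" "D x w \<le> D x v + D v w" "D x v \<le> D x w + D w v"
    "D x y \<le> D x v + D v y"
    by (intro gdist_triangle assms(1,2) wz(1,2) vV)+
  have "D v z \<le> \<delta>"
    using v(1)
  proof
    assume "v \<in> geo_interval V E x z"
    then have "D x v + D v z = D x z" by (simp add: geo_interval_def)
    then show ?thesis using tri v(2) assms(5) sym by linarith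
  next
    assume "v \<in> geo_interval V E z y"
    then have "D z v + D v y = D z y" by (simp add: geo_interval_def)
    then show ?thesis using tri(3,4) v(2) assms(5) wz(3) sym by linarith
  qed
  then show ?thesis using tri v(2) by linarith
qed

text \<open>The point is that \<open>r\<close> disappears from the bound.  In the quadrilateral \<open>f 0\<close>, \<open>f T\<close>, \<open>f' T\<close>, \<open>f' 0\<close>
  with \<open>T\<close> large, the side between \<open>f T\<close> and \<open>f' T\<close> is too far away from \<open>f t\<close>, so \<open>f t\<close> is close to
  the side between the starting points or to a geodesic along \<open>f'\<close>.\<close>

lemma fellow_travel:
  assumes f: "discrete_ray V E f" and f': "discrete_ray V E f'" and r: "\<And>t. D (f t) (f' t) \<le> r"
  shows "D (f t) (f' t) \<le> 6 * \<delta> + 3 * D (f 0) (f' 0)"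
proof -
  \<comment> \<open>Beyond this time \<open>f\<close> is further than \<open>\<delta> + r\<close> from \<open>f t\<close>.\<close>
  define T where "T = t + r + \<delta> + 1"
  have fV: "\<And>i. f i \<in> V" "\<And>i. f' i \<in> V"
    and fD: "\<And>i j. i \<le> j \<Longrightarrow> D (f i) (f j) = j - i" "\<And>i j. i \<le> j \<Longrightarrow> D (f' i) (f' j) = j - i"
    using f f' unfolding discrete_ray_def by blast+
  have "f t \<in> geo_interval V E (f 0) (f T)"
    by (rule geodesic_in_geo_interval[OF discrete_ray_geodesic[OF f], of 0 t T T]) (auto simp: T_def)
  then obtain w where w: "w \<in> geo_interval V E (f 0) (f' T) \<or> w \<in> geo_interval V E (f' T) (f T)" "D (f t) w \<le> \<delta>"
    using thinE[OF fV(1)[of 0] fV(1)[of T] fV(2)[of T]] by blast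
  have wV: "w \<in> V" using w geo_interval_V by blast
  have "\<not> w \<in> geo_interval V E (f' T) (f T)"
  proof
    assume "w \<in> geo_interval V E (f' T) (f T)"
    then have "D w (f T) \<le> r"
      using r[of T] by (simp add: geo_interval_def gdist_sym)
    then have "D (f t) (f T) \<le> \<delta> + r"
      using gdist_triangle[of "f t" w "f T"] w fV wV by simp
    then show False using fD(1)[of t T] by (simp add: T_def)
  qed
  then obtain w' where w': "w' \<in> geo_interval V E (f 0) (f' 0) \<or> w' \<in> geo_interval V E (f' 0) (f' T)" "D w w' \<le> \<delta>"
    using thinE[OF fV(1)[of 0] fV(2)[of T] fV(2)[of 0]] w(1) by blast
  have w'V: "w' \<in> V" using w' geo_interval_V by blast
  let ?k = "D (f 0) (f' 0)"
  have near: "D (f t) w' \<le> 2 * \<delta>"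
    using gdist_triangle[of "f t" w w'] w w' fV wV w'V by simp
  have t: "D (f 0) (f t) = t" "D (f' 0) (f' t) = t"
    using fD[of 0 t] by auto
  from w'(1) show ?thesis
  proof
    assume "w' \<in> geo_interval V E (f 0) (f' 0)"
    then have "D (f 0) w' \<le> ?k" by (simp add: geo_interval_def)
    then have "t \<le> ?k + 2 * \<delta>"
      using gdist_triangle[of "f 0" w' "f t"] near t fV w'V by (simp add: gdist_sym)
    moreover have "D (f t) (f' t) \<le> D (f t) (f 0) + D (f 0) (f' t)" "D (f 0) (f' t) \<le> ?k + D (f' 0) (f' t)"
      using gdist_triangle fV by auto
    ultimately show ?thesis using t gdist_sym[of E "f t" "f 0"] by linarith
  next
    assume w'b: "w' \<in> geo_interval V E (f' 0) (f' T)"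
    define s where "s = D (f' 0) w'"
    have "s \<le> T"
      using w'b fD(2)[of 0 T] by (simp add: geo_interval_def s_def)
    have "f' s \<in> geo_interval V E (f' 0) (f' T)"
      using geodesic_in_geo_interval[OF discrete_ray_geodesic[OF f'], of 0 s T T] \<open>s \<le> T\<close> by simp
    then have ws: "D w' (f' s) \<le> 2 * \<delta>"
      using bigon[OF fV(2) fV(2) w'b] fD(2)[of 0 s] by (simp add: s_def)
    have "D (f' 0) w' \<le> D (f' 0) (f 0) + D (f 0) w'" "D (f 0) w' \<le> D (f 0) (f t) + D (f t) w'"
      "D (f 0) (f t) \<le> D (f 0) w' + D w' (f t)" "D (f 0) w' \<le> D (f 0) (f' 0) + D (f' 0) w'"
      using gdist_triangle fV w'V by auto
    then have st: "s \<le> t + ?k + 2 * \<delta>" "t \<le> s + ?k + 2 * \<delta>"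
      using near t by (auto simp: s_def gdist_sym)
    have "D (f' s) (f' t) = (if s \<le> t then t - s else s - t)"
      using fD(2)[of s t] fD(2)[of t s] gdist_sym[of E "f' s" "f' t"] by simp
    then have "D (f' s) (f' t) \<le> ?k + 2 * \<delta>"
      using st by (simp split: if_splits)
    moreover have "D (f t) (f' t) \<le> D (f t) w' + D w' (f' t)" "D w' (f' t) \<le> D w' (f' s) + D (f' s) (f' t)"
      using gdist_triangle fV w'V by auto
    ultimately show ?thesis using near ws by linarith
  qed
qed

lemma rays_to_fellow_travel:
  assumes "\<gamma> \<in> \<partial>V" "f \<in> rays_to \<gamma>" "f' \<in> rays_to \<gamma>"
  shows "D (f t) (f' t) \<le> 6 * \<delta> + 3 * D (f 0) (f' 0)"
  using fellow_travel rays_to_bounded[OF assms] rays_to_discrete assms(2,3) by blast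

lemma rays_to_limit:
  assumes \<gamma>: "\<gamma> \<in> \<partial>V" and h: "\<And>n. \<exists>f\<in>rays_to \<gamma>. \<forall>i\<le>n. f i = h i"
  shows "h \<in> rays_to \<gamma>"
proof -
  obtain f where f: "\<And>n. f n \<in> rays_to \<gamma>" "\<And>n i. i \<le> n \<Longrightarrow> f n i = h i"
    using h by metis
  have "discrete_ray V E h"
    unfolding discrete_ray_def
  proof (intro conjI allI impI)
    show "h i \<in> V" for i using rays_to_V[OF f(1)[of i], of i] f(2)[of i i] by simp
    show "D (h i) (h j) = j - i" if "i \<le> j" for i j
    proof -
      have "D (f j i) (f j j) = j - i"
        using rays_to_discrete[OF f(1)[of j]] that by (simp add: discrete_ray_def)
      then show ?thesis
        using f(2)[of i j] f(2)[of j j] that by simp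
    qed
  qed
  moreover have "D (f 0 t) (h t) \<le> 6 * \<delta>" for t
    using rays_to_fellow_travel[OF \<gamma> f(1)[of 0] f(1)[of t], of t] f(2)[of 0 0] f(2)[of 0 t] f(2)[of t t]
    by simp
  ultimately show ?thesis
    using rays_to_closed_bounded[OF \<gamma> f(1)[of 0]] by blast
qed

definition starts :: "(real \<Rightarrow> 'a \<Rightarrow> real) set \<Rightarrow> 'a list \<Rightarrow> bool" where
  "starts \<gamma> w \<longleftrightarrow> (\<exists>f\<in>rays_to \<gamma>. \<forall>i<length w. f i = w ! i)"

lemma starts_Nil: "\<gamma> \<in> \<partial>V \<Longrightarrow> starts \<gamma> []"
  using rays_to_nonempty by (auto simp: starts_def)

text \<open>If the set were not open at the class of \<open>c\<close>, there would be rays that agree with the discrete ray \<open>f\<close>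
  of \<open>c\<close> on longer and longer segments and are equivalent to rays with initial segment \<open>w\<close>.  A limit \<open>h\<close> of the latter starts with \<open>w\<close>, and
  the uniform bound of the fellow traveller property passes to the limit, so \<open>h\<close> is equivalent to \<open>f\<close>.\<close>

lemma starts_closed:
  assumes p: "p \<in> V"
  shows "open_in_boundary P pdist (vertex_point p) {\<gamma> \<in> \<partial>V. \<not> starts \<gamma> w}"
  unfolding open_in_boundary_def
proof (intro conjI ballI impI)
  fix c assume c: "c \<in> graph_rays V E"
    "c 0 = vertex_point p \<and> ray_equiv P pdist `` {c} \<in> {\<gamma> \<in> \<partial>V. \<not> starts \<gamma> w}"
  let ?cl = "\<lambda>c. ray_equiv P pdist `` {c}"
  have w: "w \<noteq> []"
    using c starts_Nil by auto
  obtain f where f: "f \<in> rays_to (?cl c)" "f 0 = p" "\<And>n. c (real n) = vertex_point (f n)"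
    using rays_to_of_ray c by blast
  show "\<exists>T. \<exists>e>0. \<forall>c'\<in>graph_rays V E. c' 0 = vertex_point p \<and> (\<forall>t\<in>{0..T}. pdist (c t) (c' t) < e)
      \<longrightarrow> ?cl c' \<in> {\<gamma> \<in> \<partial>V. \<not> starts \<gamma> w}"
  proof (rule ccontr)
    assume neg: "\<not> ?thesis"
    have "\<exists>b. discrete_ray V E b \<and> (\<forall>i<length w. b i = w ! i) \<and>
        (\<forall>t\<le>N. D (b t) (f t) \<le> 6 * \<delta> + 3 * D (hd w) p)" for N :: nat
    proof -
      obtain c' where c': "c' \<in> graph_rays V E" "c' 0 = vertex_point p"
          "\<forall>t\<in>{0..real N}. pdist (c t) (c' t) < 1" "\<not> ?cl c' \<in> {\<gamma> \<in> \<partial>V. \<not> starts \<gamma> w}"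
        using neg zero_less_one by blast
      have \<gamma>: "?cl c' \<in> \<partial>V"
        using class_in_boundary c' by blast
      then obtain b where b: "b \<in> rays_to (?cl c')" "\<forall>i<length w. b i = w ! i"
        using c' by (auto simp: starts_def)
      obtain f' where f': "f' \<in> rays_to (?cl c')" "f' 0 = p" "\<And>n. c' (real n) = vertex_point (f' n)"
        using rays_to_of_ray c' by blast
      have "D (b t) (f t) \<le> 6 * \<delta> + 3 * D (hd w) p" if "t \<le> N" for t
      proof -
        have "real (D (f t) (f' t)) < 1"
          using c'(3) that f(3)[of t] f'(3)[of t] rays_to_V[OF f(1)] rays_to_V[OF f'(1)]
          by (metis atLeastAtMost_iff of_nat_0_le_iff of_nat_le_iff pdist_vertices)
        then have "f t = f' t"
          using gdist_eq_0 rays_to_V[OF f(1)] rays_to_V[OF f'(1)] by simp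
        moreover have "b 0 = hd w" using b(2) w by (simp add: hd_conv_nth)
        ultimately show ?thesis
          using rays_to_fellow_travel[OF \<gamma> b(1) f'(1), of t] f'(2) by simp
      qed
      then show ?thesis
        using b rays_to_discrete by blast
    qed
    then obtain b where b: "\<And>N. discrete_ray V E (b N)" "\<And>N i. i < length w \<Longrightarrow> b N i = w ! i"
        "\<And>N t. t \<le> N \<Longrightarrow> D (b N t) (f t) \<le> 6 * \<delta> + 3 * D (hd w) p"
      by metis
    have "b N 0 = hd w" for N
      using b(2)[of 0 N] w by (simp add: hd_conv_nth)
    then obtain h where h: "discrete_ray V E h" "\<And>n. infinite {N. \<forall>i\<le>n. b N i = h i}"
      using ray_limit[of b "hd w", OF locally_finite b(1)] by blast
    have large: "\<exists>N\<ge>m. \<forall>i\<le>n. b N i = h i" for m n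
      using h(2)[of n] unfolding infinite_nat_iff_unbounded_le by blast
    have "D (f t) (h t) \<le> 6 * \<delta> + 3 * D (hd w) p" for t
      using large[of t t] b(3)[of t] gdist_sym by (metis order_refl)
    then have "h \<in> rays_to (?cl c)"
      using rays_to_closed_bounded[OF _ f(1) h(1)] c by blast
    moreover have "\<forall>i<length w. h i = w ! i"
      using large[of 0 "length w"] b(2) by (metis less_imp_le)
    ultimately show False
      using c by (auto simp: starts_def)
  qed
qed auto

lemma starts_separate:
  assumes "a \<in> \<partial>V" "b \<in> \<partial>V" "\<And>w. w \<in> lists V \<Longrightarrow> starts a w \<longleftrightarrow> starts b w"
  shows "a = b"
proof -
  obtain f where f: "f \<in> rays_to a"
    using rays_to_nonempty assms by blast
  have "\<exists>g\<in>rays_to b. \<forall>i\<le>n. g i = f i" for n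
  proof -
    have "starts a (map f [0..<Suc n])"
      unfolding starts_def using f by (intro bexI[of _ f]) (auto simp del: upt_Suc)
    moreover have "map f [0..<Suc n] \<in> lists V"
      using rays_to_V[OF f] by (auto simp del: upt_Suc)
    ultimately have "starts b (map f [0..<Suc n])"
      using assms by blast
    then show ?thesis
      by (auto simp: starts_def less_Suc_eq_le simp del: upt_Suc)
  qed
  then have "f \<in> rays_to b"
    by (rule rays_to_limit[OF assms(2)])
  then show ?thesis
    using rays_to_inj assms f by blast
qed

definition boundary_borel :: "'a \<Rightarrow> (real \<Rightarrow> 'a \<Rightarrow> real) set measure" where
  "boundary_borel p = borel_space_of (boundary_topology P pdist (vertex_point p))"

lemma topspace_boundary: "topspace (boundary_topology P pdist (vertex_point p)) = \<partial>V"
proof -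
  have "open_in_boundary P pdist (vertex_point p) (\<partial>V)"
    unfolding open_in_boundary_def using class_in_boundary
    by (intro conjI ballI impI exI[of _ 0] exI[of _ 1]) auto
  then show ?thesis
    unfolding topspace_def openin_boundary_topology by (auto simp: open_in_boundary_def)
qed

lemma space_boundary_borel [simp]: "space (boundary_borel p) = \<partial>V"
  unfolding boundary_borel_def borel_space_of_def topspace_boundary by (simp add: space_measure_of_conv)

lemma pred_starts:
  assumes "p \<in> V"
  shows "Measurable.pred (boundary_borel p) (\<lambda>\<gamma>. starts \<gamma> w)"
proof -
  let ?U = "{\<gamma> \<in> \<partial>V. \<not> starts \<gamma> w}"
  have "?U \<in> sets (boundary_borel p)"
    unfolding boundary_borel_def borel_space_of_def topspace_boundary
    using starts_closed[OF assms, of w] openin_subset[of "boundary_topology P pdist (vertex_point p)"]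
    by (subst sets_measure_of)
      (auto simp: openin_boundary_topology open_in_boundary_def intro!: sigma_sets.Basic)
  then have "space (boundary_borel p) - ?U \<in> sets (boundary_borel p)"
    by (rule sets.compl_sets)
  moreover have "space (boundary_borel p) - ?U = {\<gamma> \<in> space (boundary_borel p). starts \<gamma> w}"
    by auto
  ultimately show ?thesis by (simp add: pred_def)
qed

end

section \<open>The action on the boundary\<close>

locale graph_action = connected_simple_graph V E + group_action G V \<phi>
  for G :: "('g, 'b) monoid_scheme" (structure) and V :: "'v set" and E \<phi> +
  assumes edges: "\<lbrakk>g \<in> carrier G; u \<in> V; v \<in> V\<rbrakk> \<Longrightarrow> {\<phi> g u, \<phi> g v} \<in> E \<longleftrightarrow> {u, v} \<in> E"
    and free: "\<lbrakk>g \<in> carrier G; v \<in> V; \<phi> g v = v\<rbrakk> \<Longrightarrow> g = \<one>"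
begin

sublocale grp: group G
  using group_hom group_hom.axioms(1) by blast

lemma act_V [simp]: "\<lbrakk>g \<in> carrier G; v \<in> V\<rbrakk> \<Longrightarrow> \<phi> g v \<in> V"
  using element_image by blast

lemma act_one [simp]: "v \<in> V \<Longrightarrow> \<phi> \<one> v = v"
  using id_eq_one by (metis restrict_apply)

lemma act_mult: "\<lbrakk>g \<in> carrier G; h \<in> carrier G; v \<in> V\<rbrakk> \<Longrightarrow> \<phi> (g \<otimes> h) v = \<phi> g (\<phi> h v)"
  using composition_rule by blast

lemma act_inv [simp]:
  assumes "g \<in> carrier G" "v \<in> V"
  shows "\<phi> (inv g) (\<phi> g v) = v" "\<phi> g (\<phi> (inv g) v) = v"
  using act_mult[of "inv g" g v] act_mult[of g "inv g" v] assms by auto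

lemma act_eq_iff [simp]: "\<lbrakk>g \<in> carrier G; u \<in> V; v \<in> V\<rbrakk> \<Longrightarrow> \<phi> g u = \<phi> g v \<longleftrightarrow> u = v"
  by (metis act_inv(1))

lemma act_free:
  assumes "g \<in> carrier G" "h \<in> carrier G" "v \<in> V" "\<phi> g v = \<phi> h v"
  shows "g = h"
proof -
  have "\<phi> (inv h \<otimes> g) v = v"
    using assms by (simp add: act_mult)
  then have "inv h \<otimes> g = \<one>"
    using free assms by simp
  then show ?thesis
    using assms by (metis grp.inv_closed grp.inv_equality grp.inv_inv)
qed

lemma gdist_act_le:
  assumes g: "g \<in> carrier G" and "u \<in> V" "v \<in> V"
  shows "D (\<phi> g u) (\<phi> g v) \<le> D u v"
proof -
  obtain f where f: "f 0 = u" "f (D u v) = v" "\<forall>i<D u v. (f i, f (Suc i)) \<in> adjacency E"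
    using gdist_relpow[OF assms(2,3)] unfolding relpow_fun_conv by blast
  have "(\<phi> g (f i), \<phi> g (f (Suc i))) \<in> adjacency E" if "i < D u v" for i
    using f(3) that adjacency_V[of "f i" "f (Suc i)"] edges[OF g] by (auto simp: adjacency_def)
  then have "(\<phi> g u, \<phi> g v) \<in> adjacency E ^^ D u v"
    unfolding relpow_fun_conv using f by (intro exI[of _ "\<lambda>i. \<phi> g (f i)"]) auto
  then show ?thesis by (rule gdist_le)
qed

lemma gdist_act [simp]:
  assumes "g \<in> carrier G" "u \<in> V" "v \<in> V"
  shows "D (\<phi> g u) (\<phi> g v) = D u v"
  using gdist_act_le[of g u v] gdist_act_le[of "inv g" "\<phi> g u" "\<phi> g v"] assms by simp

lemma discrete_ray_act: "\<lbrakk>g \<in> carrier G; discrete_ray V E f\<rbrakk> \<Longrightarrow> discrete_ray V E (\<phi> g \<circ> f)"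
  by (simp add: discrete_ray_def)

abbreviation pact :: "'g \<Rightarrow> ('v \<Rightarrow> real) \<Rightarrow> 'v \<Rightarrow> real" where "pact \<equiv> point_action G V \<phi>"

lemma pact_vertex_point:
  assumes "g \<in> carrier G" "u \<in> V"
  shows "pact g (vertex_point u) = vertex_point (\<phi> g u)"
proof
  fix v
  have "\<phi> (inv g) v = u \<longleftrightarrow> v = \<phi> g u" if "v \<in> V"
    using assms that by auto
  then show "pact g (vertex_point u) v = vertex_point (\<phi> g u) v"
    using assms by (auto simp: point_action_def vertex_point_def indicator_def)
qed

lemma pact_edge_point:
  assumes "g \<in> carrier G" "u \<in> V" "w \<in> V"
  shows "pact g (edge_point u w r) = edge_point (\<phi> g u) (\<phi> g w) r"
proof
  fix v
  have "pact g (edge_point u w r) v = (1 - r) * pact g (vertex_point u) v + r * pact g (vertex_point w) v"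
    by (simp add: point_action_def edge_point_def)
  then show "pact g (edge_point u w r) v = edge_point (\<phi> g u) (\<phi> g w) r v"
    using assms by (simp add: pact_vertex_point edge_point_def)
qed

lemma edge_V: "{u, w} \<in> E \<Longrightarrow> u \<in> V \<and> w \<in> V"
  using adjacency_V[of u w] by (simp add: adjacency_def)

lemma pact_in [simp]:
  assumes "g \<in> carrier G" "x \<in> P"
  shows "pact g x \<in> P"
  using assms(2)
proof (cases rule: edge_point_cases)
  case (1 u w r)
  then have uw: "u \<in> V" "w \<in> V" using edge_V by auto
  then have "{\<phi> g u, \<phi> g w} \<in> E" using 1 edges assms by simp
  then show ?thesis
    using edge_point_in(1) 1 uw pact_edge_point assms by simp
next
  case (2 v)
  then show ?thesis using pact_vertex_point assms by simp
qed

lemma pact_inv [simp]: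
  assumes "g \<in> carrier G" "x \<in> P"
  shows "pact (inv g) (pact g x) = x" "pact g (pact (inv g) x) = x"
  using assms point_zero_outside[OF assms(2)] by (auto simp: point_action_def)

lemma broken_path_act:
  assumes g: "g \<in> carrier G" and "broken_path V E x y l"
  shows "broken_path V E (pact g x) (pact g y) l"
  using assms(2)
proof induction
  case trivial
  then show ?case using pact_in[OF g] by (intro broken_path.trivial)
next
  case (piece y l z e u)
  have y: "y \<in> P" using broken_path_props[OF piece.hyps(1)] by blast
  have eV: "e \<subseteq> V" and u: "u \<in> V"
    using piece simple by (auto simp: simple_graph_def)
  obtain w where e: "e = {u, w}" "w \<in> V"
    using edgeE piece by metis
  have "\<phi> g ` e \<in> E"
    using e u edges[OF g u e(2)] piece by simp
  moreover have "supp (pact g x) \<subseteq> \<phi> g ` e" if "supp x \<subseteq> e" for x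
  proof
    fix v assume "v \<in> supp (pact g x)"
    then have "v \<in> V" "\<phi> (inv g) v \<in> supp x"
      by (auto simp: supp_def point_action_def split: if_splits)
    then show "v \<in> \<phi> g ` e"
      using that g by (intro image_eqI[of _ _ "\<phi> (inv g) v"]) auto
  qed
  moreover have "pact g x (\<phi> g u) = x u" for x
    using g u by (simp add: point_action_def)
  ultimately show ?case
    using broken_path.piece[of V E "pact g x" "pact g y" l "pact g z" "\<phi> g ` e" "\<phi> g u"] piece g
    by auto
qed

lemma pdist_act_le: "\<lbrakk>g \<in> carrier G; x \<in> P; y \<in> P\<rbrakk> \<Longrightarrow> pdist (pact g x) (pact g y) \<le> pdist x y"
  using pdist_greatest[of x y] pdist_le broken_path_act by blast

lemma pdist_act [simp]: "\<lbrakk>g \<in> carrier G; x \<in> P; y \<in> P\<rbrakk> \<Longrightarrow> pdist (pact g x) (pact g y) = pdist x y"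
  using pdist_act_le[of g x y] pdist_act_le[of "inv g" "pact g x" "pact g y"] by simp

definition ract :: "'g \<Rightarrow> (real \<Rightarrow> 'v \<Rightarrow> real) \<Rightarrow> real \<Rightarrow> 'v \<Rightarrow> real" where
  "ract g c = (\<lambda>t\<in>{0..}. pact g (c t))"

abbreviation bact :: "'g \<Rightarrow> (real \<Rightarrow> 'v \<Rightarrow> real) set \<Rightarrow> (real \<Rightarrow> 'v \<Rightarrow> real) set" where
  "bact \<equiv> boundary_action G V \<phi>"

lemma bact_eq: "bact g \<gamma> = ract g ` \<gamma>"
  by (simp add: boundary_action_def ract_def)

lemma ract_ray: "\<lbrakk>g \<in> carrier G; c \<in> graph_rays V E\<rbrakk> \<Longrightarrow> ract g c \<in> graph_rays V E"
  using ray_in[of c] ray_dist[of c] by (auto simp: geodesic_rays_def ract_def)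

lemma ract_equiv:
  assumes "g \<in> carrier G" "(c, c') \<in> ray_equiv P pdist"
  shows "(ract g c, ract g c') \<in> ray_equiv P pdist"
  using assms ract_ray ray_in[of c] ray_in[of c'] unfolding ray_equiv_iff by (auto simp: ract_def)

lemma ract_inv:
  assumes "g \<in> carrier G" "c \<in> graph_rays V E"
  shows "ract g (ract (inv g) c) = c"
proof
  fix t
  show "ract g (ract (inv g) c) t = c t"
    using assms ray_in[OF assms(2), of t] by (cases "0 \<le> t") (auto simp: ract_def geodesic_rays_def PiE_def extensional_def)
qed

lemma bact_class:
  assumes g: "g \<in> carrier G" and c: "c \<in> graph_rays V E"
  shows "bact g (ray_equiv P pdist `` {c}) = ray_equiv P pdist `` {ract g c}"
proof
  show "bact g (ray_equiv P pdist `` {c}) \<subseteq> ray_equiv P pdist `` {ract g c}"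
    unfolding bact_eq using ract_equiv[OF g] by auto
  show "ray_equiv P pdist `` {ract g c} \<subseteq> bact g (ray_equiv P pdist `` {c})"
  proof
    fix c' assume "c' \<in> ray_equiv P pdist `` {ract g c}"
    then have c': "(ract g c, c') \<in> ray_equiv P pdist" by simp
    then have ray: "c' \<in> graph_rays V E" by (simp add: ray_equiv_iff)
    have "(ract (inv g) (ract g c), ract (inv g) c') \<in> ray_equiv P pdist"
      using ract_equiv c' g by simp
    then have "ract (inv g) c' \<in> ray_equiv P pdist `` {c}"
      using ract_inv[of "inv g" c] g c by simp
    then show "c' \<in> bact g (ray_equiv P pdist `` {c})"
      unfolding bact_eq using ract_inv[OF g ray] by (metis image_eqI)
  qed
qed

lemma bact_in [simp]:
  assumes "g \<in> carrier G" "\<gamma> \<in> \<partial>V"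
  shows "bact g \<gamma> \<in> \<partial>V"
proof -
  obtain c where "c \<in> graph_rays V E" "\<gamma> = ray_equiv P pdist `` {c}"
    using assms(2) unfolding gromov_boundary_def by (auto elim: quotientE)
  then show ?thesis
    using bact_class[OF assms(1)] class_in_boundary ract_ray[OF assms(1)] by simp
qed

lemma ract_realize:
  assumes "g \<in> carrier G" "\<And>i. f i \<in> V"
  shows "ract g (realize f) = realize (\<phi> g \<circ> f)"
  using assms by (auto simp: ract_def realize_def pact_edge_point)

lemma rays_to_act:
  assumes "g \<in> carrier G" "f \<in> rays_to \<gamma>"
  shows "\<phi> g \<circ> f \<in> rays_to (bact g \<gamma>)"
proof -
  have "ract g (realize f) \<in> bact g \<gamma>"
    using assms by (auto simp: bact_eq rays_to_def)
  then show ?thesis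
    using ract_realize[OF assms(1), of f] rays_to_V[OF assms(2)] assms discrete_ray_act
    by (simp add: rays_to_def)
qed

text \<open>Equality of boundary points can be checked on a single ray; the laws of the action below follow
  from those for vertices in this way.\<close>

lemma bact_unique:
  assumes "\<gamma> \<in> \<partial>V" "\<gamma>' \<in> \<partial>V" "g \<in> carrier G"
    and "f \<in> rays_to \<gamma>" "\<phi> g \<circ> f \<in> rays_to \<gamma>'"
  shows "bact g \<gamma> = \<gamma>'"
  using rays_to_inj[OF _ assms(2) rays_to_act[OF assms(3,4)] assms(5)] assms by simp

lemma bact_mult:
  assumes "g \<in> carrier G" "h \<in> carrier G" "\<gamma> \<in> \<partial>V"
  shows "bact (g \<otimes> h) \<gamma> = bact g (bact h \<gamma>)"
proof -
  obtain f where f: "f \<in> rays_to \<gamma>" using rays_to_nonempty assms by blast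
  have "\<phi> (g \<otimes> h) \<circ> f = \<phi> g \<circ> (\<phi> h \<circ> f)"
    using act_mult assms rays_to_V[OF f] by (auto simp: fun_eq_iff)
  then show ?thesis
    using rays_to_act assms f by (intro bact_unique[OF _ _ _ f]) auto
qed

lemma bact_one [simp]:
  assumes "\<gamma> \<in> \<partial>V"
  shows "bact \<one> \<gamma> = \<gamma>"
proof -
  obtain f where f: "f \<in> rays_to \<gamma>" using rays_to_nonempty assms by blast
  then have "\<phi> \<one> \<circ> f = f"
    using rays_to_V[OF f] by (auto simp: fun_eq_iff)
  then show ?thesis
    using assms f by (intro bact_unique[OF _ _ _ f]) auto
qed

lemma bact_inv [simp]:
  assumes "g \<in> carrier G" "\<gamma> \<in> \<partial>V"
  shows "bact (inv g) (bact g \<gamma>) = \<gamma>" "bact g (bact (inv g) \<gamma>) = \<gamma>"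
  using bact_mult[of "inv g" g \<gamma>] bact_mult[of g "inv g" \<gamma>] assms by auto

lemma ray_interval_act_imp:
  assumes "g \<in> carrier G" "\<gamma> \<in> \<partial>V" "x \<in> V" "v \<in> ray_interval V E x \<gamma>"
  shows "\<phi> g v \<in> ray_interval V E (\<phi> g x) (bact g \<gamma>)"
proof -
  obtain f n where "f \<in> rays_to \<gamma>" "f 0 = x" "v = f n"
    using assms ray_interval_iff by auto
  then have "\<phi> g \<circ> f \<in> rays_to (bact g \<gamma>)" "(\<phi> g \<circ> f) 0 = \<phi> g x" "\<phi> g v = (\<phi> g \<circ> f) n"
    using rays_to_act[OF assms(1)] by auto
  then show ?thesis
    using assms by (subst ray_interval_iff) (auto simp del: comp_apply)
qed

lemma ray_interval_V: "v \<in> ray_interval V E x \<gamma> \<Longrightarrow> v \<in> V"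
  by (simp add: ray_interval_def)

lemma ray_interval_act [simp]:
  assumes "g \<in> carrier G" "\<gamma> \<in> \<partial>V" "x \<in> V" "v \<in> V"
  shows "\<phi> g v \<in> ray_interval V E (\<phi> g x) (bact g \<gamma>) \<longleftrightarrow> v \<in> ray_interval V E x \<gamma>"
  using ray_interval_act_imp[of g \<gamma> x v] ray_interval_act_imp[of "inv g" "bact g \<gamma>" "\<phi> g x" "\<phi> g v"] assms
  by auto

lemma inj_on_act: "v \<in> V \<Longrightarrow> inj_on (\<lambda>g. \<phi> g v) (carrier G)"
  using act_free by (intro inj_onI) blast

lemma finite_act_in:
  assumes "v \<in> V" "finite S"
  shows "finite {g \<in> carrier G. \<phi> g v \<in> S}"
proof (rule finite_imageD[of "\<lambda>g. \<phi> g v"])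
  show "finite ((\<lambda>g. \<phi> g v) ` {g \<in> carrier G. \<phi> g v \<in> S})"
    by (rule finite_subset[OF _ assms(2)]) auto
  show "inj_on (\<lambda>g. \<phi> g v) {g \<in> carrier G. \<phi> g v \<in> S}"
    using inj_on_act[OF assms(1)] by (rule inj_on_subset) auto
qed

end

locale hyperbolic_graph_action = graph_action G V E \<phi> + hyperbolic_graph V E \<delta>
  for G :: "('g, 'b) monoid_scheme" (structure) and V :: "'v set" and E \<delta> \<phi>
begin

lemma starts_act_imp:
  assumes "g \<in> carrier G" "starts \<gamma> w"
  shows "starts (bact g \<gamma>) (map (\<phi> g) w)"
proof -
  obtain f where "f \<in> rays_to \<gamma>" "\<forall>i<length w. f i = w ! i"
    using assms by (auto simp: starts_def)
  then show ?thesis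
    unfolding starts_def using rays_to_act[OF assms(1)] by (intro bexI[of _ "\<phi> g \<circ> f"]) auto
qed

lemma starts_act [simp]:
  assumes "g \<in> carrier G" "\<gamma> \<in> \<partial>V" "w \<in> lists V"
  shows "starts (bact g \<gamma>) (map (\<phi> g) w) \<longleftrightarrow> starts \<gamma> w"
proof
  assume "starts (bact g \<gamma>) (map (\<phi> g) w)"
  then have "starts (bact (inv g) (bact g \<gamma>)) (map (\<phi> (inv g)) (map (\<phi> g) w))"
    using starts_act_imp assms by blast
  moreover have "map (\<phi> (inv g)) (map (\<phi> g) w) = w"
    using assms by (auto intro!: map_idI)
  ultimately show "starts \<gamma> w"
    using assms by simp
qed (rule starts_act_imp[OF assms(1)])

end

section \<open>Hyperfiniteness from markers\<close>

lemma pred_Bex_countable: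
  assumes "countable I" "\<And>i. i \<in> I \<Longrightarrow> Measurable.pred M (P i)"
  shows "Measurable.pred M (\<lambda>x. \<exists>i\<in>I. P i x)"
  unfolding pred_def by (rule sets.sets_Collect_countable_Ex'[OF _ assms(1)]) (rule assms(2)[unfolded pred_def])

lemma pred_Ball_countable:
  assumes "countable I" "\<And>i. i \<in> I \<Longrightarrow> Measurable.pred M (P i)"
  shows "Measurable.pred M (\<lambda>x. \<forall>i\<in>I. P i x)"
  unfolding pred_def by (rule sets.sets_Collect_countable_All'[OF _ assms(1)]) (rule assms(2)[unfolded pred_def])

text \<open>The finite set \<open>\<Psi> n a\<close> should be thought of as a place in the group that comes closer to \<open>a\<close> as \<open>n\<close>
  grows and does not remember, for large \<open>n\<close>, from where in the orbit \<open>a\<close> is observed.  The element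
  \<open>h\<close> in the last condition need not be \<open>g\<close>, as \<open>a\<close> may have a stabilizer.\<close>

locale marked_action = group G for G :: "('g, 'b) monoid_scheme" (structure) +
  fixes M :: "'z measure" and \<psi> :: "'g \<Rightarrow> 'z \<Rightarrow> 'z" and \<Psi> :: "nat \<Rightarrow> 'z \<Rightarrow> 'g set"
  assumes countable_group: "countable (carrier G)"
    and act_closed: "\<lbrakk>g \<in> carrier G; a \<in> space M\<rbrakk> \<Longrightarrow> \<psi> g a \<in> space M"
    and act_one: "a \<in> space M \<Longrightarrow> \<psi> \<one> a = a"
    and act_mult: "\<lbrakk>g \<in> carrier G; h \<in> carrier G; a \<in> space M\<rbrakk> \<Longrightarrow> \<psi> (g \<otimes> h) a = \<psi> g (\<psi> h a)"
    and pred_graph: "g \<in> carrier G \<Longrightarrow> Measurable.pred (M \<Otimes>\<^sub>M M) (\<lambda>x. \<psi> g (fst x) = snd x)"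
    and markers_finite: "a \<in> space M \<Longrightarrow> finite (\<Psi> n a)"
    and markers_in: "a \<in> space M \<Longrightarrow> \<Psi> n a \<subseteq> carrier G"
    and markers_nonempty: "a \<in> space M \<Longrightarrow> \<Psi> n a \<noteq> {}"
    and markers_0: "a \<in> space M \<Longrightarrow> \<Psi> 0 a = {\<one>}"
    and pred_markers: "u \<in> carrier G \<Longrightarrow> Measurable.pred M (\<lambda>a. u \<in> \<Psi> n a)"
    and markers_eventually: "\<lbrakk>a \<in> space M; g \<in> carrier G\<rbrakk> \<Longrightarrow>
      \<exists>h\<in>carrier G. \<psi> h a = \<psi> g a \<and> (\<exists>n. \<forall>m\<ge>n. \<Psi> m (\<psi> g a) = (\<lambda>u. h \<otimes> u) ` \<Psi> m a)"
begin

text \<open>These relations increase with \<open>n\<close> and exhaust the orbit relation, but their classes may be infinite.\<close>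

definition agree_from :: "nat \<Rightarrow> 'z \<Rightarrow> 'z \<Rightarrow> bool" where
  "agree_from n a b \<longleftrightarrow> (\<exists>h\<in>carrier G. \<psi> h a = b \<and> (\<forall>m\<ge>n. \<Psi> m b = (\<lambda>u. h \<otimes> u) ` \<Psi> m a))"

text \<open>Passing from a marker of level \<open>n\<close> to one of level \<open>n + 1\<close> multiplies by one of the elements with number
  at most \<open>N\<close>, of which there are finitely many.  This is invariant under left translation of the
  markers.\<close>

definition step_bounded :: "nat \<Rightarrow> nat \<Rightarrow> 'z \<Rightarrow> bool" where
  "step_bounded N n a \<longleftrightarrow> (\<forall>u\<in>\<Psi> n a. \<forall>w\<in>\<Psi> (Suc n) a. to_nat_on (carrier G) (inv u \<otimes> w) \<le> N)"

text \<open>The same bound \<open>N\<close> limits the level from which the markers agree and the jumps below that level; from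
  that level on the jumps of the two points are the same, which makes the relation transitive.\<close>

definition approx :: "nat \<Rightarrow> 'z rel" where
  "approx N = {(a, b). a \<in> space M \<and> b \<in> space M \<and>
     (\<exists>m\<le>N. agree_from m a b \<and> (\<forall>i<m. step_bounded N i a \<and> step_bounded N i b))}"

lemma inv_mult_cancel: "\<lbrakk>h \<in> carrier G; u \<in> carrier G\<rbrakk> \<Longrightarrow> inv h \<otimes> (h \<otimes> u) = u"
  by (simp add: m_assoc[symmetric])

lemma translate_inv:
  assumes "h \<in> carrier G" "A \<subseteq> carrier G" "B = (\<lambda>u. h \<otimes> u) ` A"
  shows "A = (\<lambda>u. inv h \<otimes> u) ` B"
proof -
  have "(\<lambda>u. inv h \<otimes> (h \<otimes> u)) ` A = (\<lambda>u. u) ` A"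
    by (rule image_cong[OF refl]) (use assms(1,2) inv_mult_cancel in blast)
  then show ?thesis
    by (simp add: assms(3) image_image)
qed

lemma agree_from_refl: "a \<in> space M \<Longrightarrow> agree_from n a a"
proof -
  assume a: "a \<in> space M"
  have "(\<lambda>u. \<one> \<otimes> u) ` \<Psi> m a = (\<lambda>u. u) ` \<Psi> m a" for m
    by (rule image_cong[OF refl]) (use markers_in[OF a] l_one in blast)
  then show ?thesis
    unfolding agree_from_def using act_one[OF a] by (intro bexI[of _ \<one>]) auto
qed

lemma agree_from_sym:
  assumes "a \<in> space M" "agree_from n a b"
  shows "agree_from n b a"
proof -
  obtain h where h: "h \<in> carrier G" "\<psi> h a = b" "\<And>m. n \<le> m \<Longrightarrow> \<Psi> m b = (\<lambda>u. h \<otimes> u) ` \<Psi> m a"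
    using assms(2) unfolding agree_from_def by blast
  have "\<psi> (inv h) b = a"
    using act_mult[of "inv h" h a] act_one h assms by simp
  moreover have "\<Psi> m a = (\<lambda>u. inv h \<otimes> u) ` \<Psi> m b" if "n \<le> m" for m
    using translate_inv[OF h(1) markers_in[OF assms(1)] h(3)[OF that]] .
  ultimately show ?thesis
    using inv_closed[OF h(1)] unfolding agree_from_def by blast
qed

lemma agree_from_trans:
  assumes a: "a \<in> space M" and ab: "agree_from n a b" and bc: "agree_from n b c"
  shows "agree_from n a c"
proof -
  obtain h where h: "h \<in> carrier G" "\<psi> h a = b" "\<And>m. n \<le> m \<Longrightarrow> \<Psi> m b = (\<lambda>u. h \<otimes> u) ` \<Psi> m a"
    using ab unfolding agree_from_def by blast
  obtain k where k: "k \<in> carrier G" "\<psi> k b = c" "\<And>m. n \<le> m \<Longrightarrow> \<Psi> m c = (\<lambda>u. k \<otimes> u) ` \<Psi> m b"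
    using bc unfolding agree_from_def by blast
  have "\<Psi> m c = (\<lambda>u. k \<otimes> h \<otimes> u) ` \<Psi> m a" if "n \<le> m" for m
    unfolding k(3)[OF that] h(3)[OF that] image_image
    using markers_in[OF a, of m] h(1) k(1) by (intro image_cong) (auto simp: m_assoc)
  then show ?thesis
    unfolding agree_from_def using act_mult[OF k(1) h(1) a] h(2) k(2) m_closed[OF k(1) h(1)] by auto
qed

lemma agree_from_mono: "\<lbrakk>agree_from n a b; n \<le> m\<rbrakk> \<Longrightarrow> agree_from m a b"
  unfolding agree_from_def by (meson le_trans)

lemma step_bounded_mono: "\<lbrakk>step_bounded N n a; N \<le> N'\<rbrakk> \<Longrightarrow> step_bounded N' n a"
  unfolding step_bounded_def by (meson le_trans)

lemma step_bounded_agree: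
  assumes "a \<in> space M" "agree_from n a b" "n \<le> m" "step_bounded N m a"
  shows "step_bounded N m b"
proof -
  obtain h where h: "h \<in> carrier G" "\<And>m. n \<le> m \<Longrightarrow> \<Psi> m b = (\<lambda>u. h \<otimes> u) ` \<Psi> m a"
    using assms(2) unfolding agree_from_def by blast
  have "inv (h \<otimes> u) \<otimes> (h \<otimes> w) = inv u \<otimes> w" if "u \<in> carrier G" "w \<in> carrier G" for u w
  proof -
    have "inv (h \<otimes> u) \<otimes> (h \<otimes> w) = inv u \<otimes> (inv h \<otimes> (h \<otimes> w))"
      using that h(1) by (simp add: inv_mult_group m_assoc)
    then show ?thesis using that h(1) by (simp add: inv_mult_cancel)
  qed
  then show ?thesis
    using assms(3,4) h(2)[of m] h(2)[of "Suc m"] markers_in[OF assms(1)]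
    by (auto simp: step_bounded_def subset_iff)
qed

lemma step_bounded_exists:
  assumes "a \<in> space M"
  shows "\<exists>N. step_bounded N n a"
proof -
  let ?S = "(\<lambda>(u, w). to_nat_on (carrier G) (inv u \<otimes> w)) ` (\<Psi> n a \<times> \<Psi> (Suc n) a)"
  have "finite ?S"
    using markers_finite[OF assms] by simp
  then have "step_bounded (Max ?S) n a"
    unfolding step_bounded_def by (auto intro!: Max_ge)
  then show ?thesis ..
qed

text \<open>Going down from level \<open>m\<close> to level 0 each set of markers is determined by the next one up to
  finitely many choices, and the markers at level 0 determine the group element.\<close>

lemma finite_agree_step_bounded:
  assumes a: "a \<in> space M"
  shows "finite {b \<in> space M. agree_from m a b \<and> (\<forall>i<m. step_bounded N i b)}"
proof -
  define K where "K = {k \<in> carrier G. to_nat_on (carrier G) k \<le> N}"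
  have "inj_on (to_nat_on (carrier G)) K"
    by (rule inj_on_subset[OF inj_on_to_nat_on[OF countable_group]]) (auto simp: K_def)
  moreover have "finite (to_nat_on (carrier G) ` K)"
    by (rule finite_subset[of _ "{..N}"]) (auto simp: K_def)
  ultimately have finK: "finite K"
    by (rule finite_imageD[rotated])
  define S where "S = rec_nat (\<Psi> m a) (\<lambda>_ A. (\<lambda>(w, k). w \<otimes> inv k) ` (A \<times> K))"
  have S0: "S 0 = \<Psi> m a" and SS: "S (Suc j) = (\<lambda>(w, k). w \<otimes> inv k) ` (S j \<times> K)" for j
    by (auto simp: S_def)
  have finS: "finite (S j)" for j
    by (induction j) (auto simp: S0 SS finK markers_finite[OF a])
  have "{b \<in> space M. agree_from m a b \<and> (\<forall>i<m. step_bounded N i b)} \<subseteq> (\<lambda>h. \<psi> (inv h) a) ` S m"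
  proof
    fix b assume "b \<in> {b \<in> space M. agree_from m a b \<and> (\<forall>i<m. step_bounded N i b)}"
    then have b: "b \<in> space M" "agree_from m a b" "\<And>i. i < m \<Longrightarrow> step_bounded N i b" by auto
    obtain h where h: "h \<in> carrier G" "\<psi> h a = b" "\<Psi> m b = (\<lambda>u. h \<otimes> u) ` \<Psi> m a"
      using b(2) unfolding agree_from_def by blast
    have "(\<lambda>u. inv h \<otimes> u) ` \<Psi> (m - j) b \<subseteq> S j" if "j \<le> m" for j
      using that
    proof (induction j)
      case 0
      then show ?case
        using translate_inv[OF h(1) markers_in[OF a] h(3)] by (simp add: S0)
    next
      case (Suc j)
      let ?i = "m - Suc j"
      have i: "?i < m" "Suc ?i = m - j" using Suc.prems by auto
      show ?case
      proof
        fix x assume "x \<in> (\<lambda>u. inv h \<otimes> u) ` \<Psi> ?i b"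
        then obtain u where u: "u \<in> \<Psi> ?i b" "x = inv h \<otimes> u" by blast
        obtain w where w: "w \<in> \<Psi> (Suc ?i) b"
          using markers_nonempty[OF b(1)] by blast
        have uw: "u \<in> carrier G" "w \<in> carrier G"
          using markers_in[OF b(1)] u w by blast+
        have "inv u \<otimes> w \<in> K"
        proof -
          have "inv u \<otimes> w \<in> carrier G" using uw by simp
          then show ?thesis
            using b(3)[OF i(1)] u(1) w unfolding step_bounded_def K_def by blast
        qed
        moreover have "inv h \<otimes> w \<in> S j"
          using Suc.IH[OF Suc_leD[OF Suc.prems]] w unfolding i(2) by blast
        moreover have "x = (inv h \<otimes> w) \<otimes> inv (inv u \<otimes> w)"
        proof -
          have "inv (inv u \<otimes> w) = inv w \<otimes> u" using uw by (simp add: inv_mult_group)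
          moreover have "w \<otimes> (inv w \<otimes> u) = u" using uw by (simp add: m_assoc[symmetric])
          ultimately show ?thesis using uw h(1) u(2) by (simp add: m_assoc)
        qed
        ultimately show "x \<in> S (Suc j)"
          unfolding SS by (intro image_eqI[of _ _ "(inv h \<otimes> w, inv u \<otimes> w)"]) auto
      qed
    qed
    from this[of m] have "inv h \<in> S m"
      using markers_0[OF b(1)] h(1) by simp
    then show "b \<in> (\<lambda>h. \<psi> (inv h) a) ` S m"
      using h by (intro image_eqI[of _ _ "inv h"]) auto
  qed
  then show ?thesis
    using finS finite_subset by blast
qed

lemma equiv_approx: "equiv (space M) (approx N)"
proof (rule equivI)
  show "approx N \<subseteq> space M \<times> space M"
    by (auto simp: approx_def)
  show "refl_on (space M) (approx N)"
    by (rule refl_onI) (use agree_from_refl in \<open>auto simp: approx_def\<close>)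
  show "sym (approx N)"
    by (rule symI) (auto simp: approx_def dest: agree_from_sym)
  show "trans (approx N)"
  proof (rule transI)
    fix a b c assume ab: "(a, b) \<in> approx N" and bc: "(b, c) \<in> approx N"
    obtain m n where m: "m \<le> N" "agree_from m a b" "\<And>i. i < m \<Longrightarrow> step_bounded N i a \<and> step_bounded N i b"
      and n: "n \<le> N" "agree_from n b c" "\<And>i. i < n \<Longrightarrow> step_bounded N i b \<and> step_bounded N i c"
      and sp: "a \<in> space M" "b \<in> space M" "c \<in> space M"
      using ab bc unfolding approx_def by blast
    define k where "k = max m n"
    have "agree_from k a c"
      using agree_from_trans[OF sp(1) agree_from_mono[OF m(2)] agree_from_mono[OF n(2)]]
      by (simp add: k_def)
    \<comment> \<open>Where one of the bounds is not given, the markers agree with those of \<open>b\<close>.\<close>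
    moreover have "step_bounded N i a \<and> step_bounded N i c" if "i < k" for i
    proof -
      have cb: "step_bounded N i b"
        using that m(3)[of i] n(3)[of i] unfolding k_def by linarith
      have "step_bounded N i a"
        using m(3)[of i] step_bounded_agree[OF sp(2) agree_from_sym[OF sp(1) m(2)] _ cb] by (cases "i < m") auto
      moreover have "step_bounded N i c"
        using n(3)[of i] step_bounded_agree[OF sp(2) n(2) _ cb] by (cases "i < n") auto
      ultimately show ?thesis ..
    qed
    moreover have "k \<le> N"
      using m n by (simp add: k_def)
    ultimately show "(a, c) \<in> approx N"
      using sp by (auto simp: approx_def)
  qed
qed

lemma pred_agree_from: "Measurable.pred (M \<Otimes>\<^sub>M M) (\<lambda>x. agree_from n (fst x) (snd x))"
proof -
  \<comment> \<open>Only membership of single elements in the markers is known to be measurable.\<close>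
  have eq: "agree_from n a b \<longleftrightarrow> (\<exists>h\<in>carrier G. \<psi> h a = b \<and>
      (\<forall>m\<in>{n..}. \<forall>u\<in>carrier G. h \<otimes> u \<in> \<Psi> m b \<longleftrightarrow> u \<in> \<Psi> m a))"
    if ab: "a \<in> space M" "b \<in> space M" for a b
  proof -
    have "\<Psi> m b = (\<lambda>u. h \<otimes> u) ` \<Psi> m a \<longleftrightarrow> (\<forall>u\<in>carrier G. h \<otimes> u \<in> \<Psi> m b \<longleftrightarrow> u \<in> \<Psi> m a)"
      if h: "h \<in> carrier G" for h m
    proof
      assume "\<Psi> m b = (\<lambda>u. h \<otimes> u) ` \<Psi> m a"
      then show "\<forall>u\<in>carrier G. h \<otimes> u \<in> \<Psi> m b \<longleftrightarrow> u \<in> \<Psi> m a"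
        using markers_in[OF ab(1), of m] h by (auto simp: subset_iff)
    next
      assume *: "\<forall>u\<in>carrier G. h \<otimes> u \<in> \<Psi> m b \<longleftrightarrow> u \<in> \<Psi> m a"
      show "\<Psi> m b = (\<lambda>u. h \<otimes> u) ` \<Psi> m a"
      proof
        show "(\<lambda>u. h \<otimes> u) ` \<Psi> m a \<subseteq> \<Psi> m b"
          using * markers_in[OF ab(1), of m] by blast
        show "\<Psi> m b \<subseteq> (\<lambda>u. h \<otimes> u) ` \<Psi> m a"
        proof
          fix w assume w: "w \<in> \<Psi> m b"
          then have wG: "w \<in> carrier G" using markers_in[OF ab(2)] by blast
          then have "h \<otimes> (inv h \<otimes> w) = w"
            using h by (simp add: m_assoc[symmetric])
          then show "w \<in> (\<lambda>u. h \<otimes> u) ` \<Psi> m a"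
            using * w wG h by (intro image_eqI[of _ _ "inv h \<otimes> w"]) auto
        qed
      qed
    qed
    then show ?thesis by (auto simp: agree_from_def)
  qed
  have fst: "Measurable.pred (M \<Otimes>\<^sub>M M) (\<lambda>x. u \<in> \<Psi> m (fst x))" if "u \<in> carrier G" for u m
    using measurable_compose[OF measurable_fst pred_markers[OF that]] .
  have snd: "Measurable.pred (M \<Otimes>\<^sub>M M) (\<lambda>x. u \<in> \<Psi> m (snd x))" if "u \<in> carrier G" for u m
    using measurable_compose[OF measurable_snd pred_markers[OF that]] .
  have "Measurable.pred (M \<Otimes>\<^sub>M M) (\<lambda>x. \<exists>h\<in>carrier G. \<psi> h (fst x) = snd x \<and>
      (\<forall>m\<in>{n..}. \<forall>u\<in>carrier G. h \<otimes> u \<in> \<Psi> m (snd x) \<longleftrightarrow> u \<in> \<Psi> m (fst x)))"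
    by (intro pred_Bex_countable pred_Ball_countable pred_intros_logic countable_group pred_graph fst snd)
      auto
  also have "?this \<longleftrightarrow> ?thesis"
    by (intro measurable_cong) (auto simp: eq space_pair_measure)
  finally show ?thesis .
qed

lemma pred_step_bounded: "Measurable.pred M (step_bounded N n)"
proof -
  have "Measurable.pred M (\<lambda>a. \<forall>u\<in>carrier G. \<forall>w\<in>carrier G. u \<in> \<Psi> n a \<longrightarrow> w \<in> \<Psi> (Suc n) a \<longrightarrow>
      to_nat_on (carrier G) (inv u \<otimes> w) \<le> N)"
    by (intro pred_Ball_countable pred_intros_logic countable_group pred_markers) auto
  also have "?this \<longleftrightarrow> ?thesis"
  proof (rule measurable_cong)
    fix a assume "a \<in> space M"
    then have "\<Psi> n a \<subseteq> carrier G" "\<Psi> (Suc n) a \<subseteq> carrier G"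
      using markers_in by blast+
    then show "(\<forall>u\<in>carrier G. \<forall>w\<in>carrier G. u \<in> \<Psi> n a \<longrightarrow> w \<in> \<Psi> (Suc n) a \<longrightarrow>
        to_nat_on (carrier G) (inv u \<otimes> w) \<le> N) \<longleftrightarrow> step_bounded N n a"
      unfolding step_bounded_def by blast
  qed
  finally show ?thesis .
qed

lemma sets_of_pred:
  assumes "Measurable.pred (M \<Otimes>\<^sub>M M) (\<lambda>x. Q (fst x) (snd x))"
  shows "{(a, b). a \<in> space M \<and> b \<in> space M \<and> Q a b} \<in> sets (M \<Otimes>\<^sub>M M)"
proof -
  have "{(a, b). a \<in> space M \<and> b \<in> space M \<and> Q a b} = {x \<in> space (M \<Otimes>\<^sub>M M). Q (fst x) (snd x)}"
    by (auto simp: space_pair_measure)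
  then show ?thesis using assms by (simp add: pred_def)
qed

lemma borel_equiv_approx: "borel_equiv M (approx N)"
proof -
  have "Measurable.pred (M \<Otimes>\<^sub>M M) (\<lambda>x.
      \<exists>m\<in>{..N}. agree_from m (fst x) (snd x) \<and> (\<forall>i\<in>{..<m}. step_bounded N i (fst x) \<and> step_bounded N i (snd x)))"
    by (intro pred_intros_logic pred_Bex_countable pred_Ball_countable pred_agree_from
        measurable_compose[OF measurable_fst pred_step_bounded] measurable_compose[OF measurable_snd pred_step_bounded]) auto
  from sets_of_pred[OF this] show ?thesis
    unfolding borel_equiv_def using equiv_approx by (simp add: approx_def Ball_def Bex_def)
qed

proposition hyperfinite_orbit_relation: "hyperfinite M (orbit_relation G (space M) \<psi>)"
proof -
  let ?R = "orbit_relation G (space M) \<psi>"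
  have R: "?R = {(a, b). a \<in> space M \<and> b \<in> space M \<and> (\<exists>g\<in>carrier G. \<psi> g a = b)}"
    by (auto simp: orbit_relation_def)
  have "borel_equiv M ?R"
    unfolding borel_equiv_def
  proof
    show "equiv (space M) ?R"
    proof (rule equivI)
      show "?R \<subseteq> space M \<times> space M" by (auto simp: R)
      show "refl_on (space M) ?R"
        by (rule refl_onI) (use act_one in \<open>auto simp: R\<close>)
      show "sym ?R"
      proof (rule symI)
        fix a b assume "(a, b) \<in> ?R"
        then obtain g where g: "a \<in> space M" "b \<in> space M" "g \<in> carrier G" "\<psi> g a = b"
          by (auto simp: R)
        then have "\<psi> (inv g) b = a"
          using act_mult[of "inv g" g a] act_one by simp
        then show "(b, a) \<in> ?R"
          using g by (auto simp: R)
      qed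
      show "trans ?R"
      proof (rule transI)
        fix a b c assume "(a, b) \<in> ?R" "(b, c) \<in> ?R"
        then obtain g h where g: "a \<in> space M" "b \<in> space M" "c \<in> space M"
          "g \<in> carrier G" "\<psi> g a = b" "h \<in> carrier G" "\<psi> h b = c"
          by (auto simp: R)
        then have "\<psi> (h \<otimes> g) a = c"
          using act_mult by simp
        then show "(a, c) \<in> ?R"
          using g by (auto simp: R)
      qed
    qed
    show "?R \<in> sets (M \<Otimes>\<^sub>M M)"
      unfolding R by (intro sets_of_pred pred_Bex_countable countable_group pred_graph)
  qed
  moreover have "finite_borel_equiv M (approx N)" for N
    unfolding finite_borel_equiv_def
  proof (intro conjI borel_equiv_approx ballI)
    fix a assume a: "a \<in> space M"
    have "approx N `` {a} \<subseteq> (\<Union>m\<in>{..N}. {b \<in> space M. agree_from m a b \<and> (\<forall>i<m. step_bounded N i b)})"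
      by (auto simp: approx_def)
    moreover have "finite (\<Union>m\<in>{..N}. {b \<in> space M. agree_from m a b \<and> (\<forall>i<m. step_bounded N i b)})"
      using finite_agree_step_bounded[OF a] by simp
    ultimately show "finite (approx N `` {a})"
      by (rule finite_subset)
  qed
  moreover have "approx N \<subseteq> approx (Suc N)" for N
    unfolding approx_def using step_bounded_mono[of N _ _ "Suc N"] le_SucI by (auto, blast)
  moreover have "?R = (\<Union>N. approx N)"
  proof
    show "(\<Union>N. approx N) \<subseteq> ?R"
      using act_one by (force simp: approx_def R agree_from_def)
    show "?R \<subseteq> (\<Union>N. approx N)"
    proof clarify
      fix a b assume "(a, b) \<in> ?R"
      then obtain g where ab: "a \<in> space M" "b \<in> space M" "g \<in> carrier G" "\<psi> g a = b"
        by (auto simp: R)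
      then obtain n where n: "agree_from n a b"
        using markers_eventually[OF ab(1,3)] unfolding agree_from_def by blast
      obtain \<nu> \<nu>' where \<nu>: "\<And>i. step_bounded (\<nu> i) i a" "\<And>i. step_bounded (\<nu>' i) i b"
        using step_bounded_exists ab by metis
      define N where "N = n + (\<Sum>i<n. \<nu> i + \<nu>' i)"
      have "step_bounded N i a \<and> step_bounded N i b" if "i < n" for i
      proof -
        have "\<nu> i + \<nu>' i \<le> (\<Sum>i<n. \<nu> i + \<nu>' i)"
          using that by (intro member_le_sum) auto
        then show ?thesis
          using step_bounded_mono[OF \<nu>(1)] step_bounded_mono[OF \<nu>(2)] by (simp add: N_def)
      qed
      then have "(a, b) \<in> approx N"
        using ab n by (auto simp: approx_def N_def intro!: exI[of _ n])
      then show "(a, b) \<in> (\<Union>N. approx N)" by blast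
    qed
  qed
  ultimately show ?thesis
    unfolding hyperfinite_def by blast
qed

end

section \<open>Words occurring infinitely often along intervals\<close>

text \<open>A countable set has only countably many finite subsets, so a property of a finite set that varies
  measurably can be tested by running through its possible values.\<close>

lemma pred_of_finite_set:
  assumes A: "countable A" and sub: "\<And>x. x \<in> space M \<Longrightarrow> S x \<subseteq> A"
    and S: "\<And>a. a \<in> A \<Longrightarrow> Measurable.pred M (\<lambda>x. a \<in> S x)"
  shows "Measurable.pred M (\<lambda>x. finite (S x) \<and> R (S x))"
proof -
  have "Measurable.pred M (\<lambda>x. \<exists>F\<in>{F. finite F \<and> F \<subseteq> A}. R F \<and> (\<forall>a\<in>A. a \<in> S x \<longleftrightarrow> a \<in> F))"
    by (intro pred_Bex_countable pred_Ball_countable pred_intros_logic countable_Collect_finite_subset A S) auto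
  also have "?this \<longleftrightarrow> ?thesis"
  proof (rule measurable_cong)
    fix x assume x: "x \<in> space M"
    have "(\<forall>a\<in>A. a \<in> S x \<longleftrightarrow> a \<in> F) \<longleftrightarrow> S x = F" if "F \<subseteq> A" for F
      using sub[OF x] that by blast
    then show "(\<exists>F\<in>{F. finite F \<and> F \<subseteq> A}. R F \<and> (\<forall>a\<in>A. a \<in> S x \<longleftrightarrow> a \<in> F)) \<longleftrightarrow> finite (S x) \<and> R (S x)"
      using sub[OF x] by blast
  qed
  finally show ?thesis .
qed

locale interval_action = hyperbolic_graph_action G V E \<delta> \<phi>
  for G :: "('g, 'b) monoid_scheme" (structure) and V :: "'v set" and E \<delta> \<phi> +
  fixes p :: 'v
  assumes base: "p \<in> V"
    and cocompact: "\<exists>F. finite F \<and> F \<subseteq> V \<and> (\<forall>v\<in>V. \<exists>g\<in>carrier G. \<exists>d\<in>F. v = \<phi> g d)"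
    and intervals: "\<lbrakk>\<gamma> \<in> \<partial>V; x \<in> V; y \<in> V\<rbrakk>
      \<Longrightarrow> finite (sym_diff (ray_interval V E x \<gamma>) (ray_interval V E y \<gamma>))"
begin

abbreviation iv :: "'v \<Rightarrow> (real \<Rightarrow> 'v \<Rightarrow> real) set \<Rightarrow> 'v set" where "iv \<equiv> ray_interval V E"

lemma countable_carrier: "countable (carrier G)"
proof (rule countable_image_inj_on[OF _ inj_on_act[OF base]])
  show "countable ((\<lambda>g. \<phi> g p) ` carrier G)"
    by (rule countable_subset[OF _ countable_V[OF locally_finite]]) (use base in auto)
qed

lemma intervals_diff:
  assumes "\<gamma> \<in> \<partial>V" "x \<in> V" "y \<in> V"
  shows "finite (iv x \<gamma> - iv y \<gamma>)"
  using intervals[OF assms] by (rule rev_finite_subset) auto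

lemma infinite_interval:
  assumes \<gamma>: "\<gamma> \<in> \<partial>V" and x: "x \<in> V"
  shows "infinite (iv x \<gamma>)"
proof -
  obtain f where f: "f \<in> rays_to \<gamma>"
    using rays_to_nonempty[OF \<gamma>] by blast
  have f0: "f 0 \<in> V" using rays_to_V[OF f] .
  have "inj f"
  proof (rule injI)
    fix i j assume "f i = f j"
    moreover have "D (f 0) (f i) = i" "D (f 0) (f j) = j"
      using rays_to_discrete[OF f] by (auto simp: discrete_ray_def)
    ultimately show "i = j" by metis
  qed
  then have "infinite (range f)"
    by (rule range_inj_infinite)
  moreover have "range f \<subseteq> iv (f 0) \<gamma>"
    using ray_interval_iff[OF \<gamma> f0] f by blast
  ultimately have inf: "infinite (iv (f 0) \<gamma>)"
    using infinite_super by blast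
  show ?thesis
  proof
    assume "finite (iv x \<gamma>)"
    then have "finite ((iv (f 0) \<gamma> - iv x \<gamma>) \<union> iv x \<gamma>)"
      using intervals_diff[OF \<gamma> f0 x] by simp
    then have "finite (iv (f 0) \<gamma>)"
      by (rule rev_finite_subset) blast
    with inf show False ..
  qed
qed

lemma ray_from:
  assumes "\<gamma> \<in> \<partial>V" "v \<in> iv x \<gamma>" "x \<in> V"
  obtains f where "f \<in> rays_to \<gamma>" "f 0 = v"
proof -
  obtain f n where f: "f \<in> rays_to \<gamma>" "v = f n"
    using ray_interval_iff[OF assms(1,3)] assms(2) by blast
  then show ?thesis
    using rays_to_tail[OF assms(1) f(1), of n] that[of "\<lambda>i. f (i + n)"] by simp
qed

text \<open>A ray from \<open>x\<close> through \<open>v\<close> followed by another ray from \<open>v\<close> need not be geodesic, but the other ray stays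
  close to the tail of the first one and so moves away from \<open>x\<close> at almost unit speed.\<close>

lemma interval_of_interval:
  assumes \<gamma>: "\<gamma> \<in> \<partial>V" and x: "x \<in> V" and v: "v \<in> iv x \<gamma>" and w: "w \<in> iv v \<gamma>"
  shows "D x v \<le> D x w + 6 * \<delta>"
proof -
  have vV: "v \<in> V" using ray_interval_V[OF v] .
  obtain f k where f: "f \<in> rays_to \<gamma>" "f 0 = x" "v = f k"
    using ray_interval_iff[OF \<gamma> x] v by blast
  obtain h j where h: "h \<in> rays_to \<gamma>" "h 0 = v" "w = h j"
    using ray_interval_iff[OF \<gamma> vV] w by blast
  have "D (f (j + k)) w \<le> 6 * \<delta>"
    using rays_to_fellow_travel[OF \<gamma> rays_to_tail[OF \<gamma> f(1), of k] h(1), of j] f h by simp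
  moreover have "D x (f k) = k" "D x (f (j + k)) = j + k"
    using rays_to_discrete[OF f(1)] f(2) by (auto simp: discrete_ray_def)
  moreover have "D x (f (j + k)) \<le> D x w + D w (f (j + k))"
    using gdist_triangle x rays_to_V[OF f(1)] rays_to_V[OF h(1)] h(3) by simp
  ultimately show ?thesis
    unfolding f(3) using gdist_sym[of E w "f (j + k)"] by linarith
qed

definition occ :: "(real \<Rightarrow> 'v \<Rightarrow> real) set \<Rightarrow> 'v list \<Rightarrow> 'g set" where
  "occ \<gamma> w = {g \<in> carrier G. starts \<gamma> (map (\<phi> g) w)}"

text \<open>The empty word has no first letter; every group element counts as an occurrence of it, which lets the
  choice of the first letter be an instance of the choice of the next one.\<close>

definition occ_in :: "'v \<Rightarrow> (real \<Rightarrow> 'v \<Rightarrow> real) set \<Rightarrow> 'v list \<Rightarrow> 'g set" where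
  "occ_in y \<gamma> w = {g \<in> occ \<gamma> w. w \<noteq> [] \<longrightarrow> \<phi> g (hd w) \<in> iv y \<gamma>}"

lemma occ_in_carrier: "occ_in y \<gamma> w \<subseteq> carrier G"
  by (auto simp: occ_in_def occ_def)

lemma occ_act:
  assumes "g \<in> carrier G" "h \<in> carrier G" "\<gamma> \<in> \<partial>V" "w \<in> lists V"
  shows "g \<otimes> h \<in> occ (bact g \<gamma>) w \<longleftrightarrow> h \<in> occ \<gamma> w"
proof -
  have "map (\<phi> (g \<otimes> h)) w = map (\<phi> g) (map (\<phi> h) w)"
    using assms by (auto simp: act_mult)
  moreover have "map (\<phi> h) w \<in> lists V"
    using assms by auto
  ultimately show ?thesis
    using assms starts_act[OF assms(1,3), of "map (\<phi> h) w"] by (simp add: occ_def del: map_map)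
qed

lemma occ_in_act:
  assumes "g \<in> carrier G" "\<gamma> \<in> \<partial>V" "w \<in> lists V" "y \<in> V"
  shows "occ_in (\<phi> g y) (bact g \<gamma>) w = (\<lambda>h. g \<otimes> h) ` occ_in y \<gamma> w"
proof -
  have *: "g \<otimes> h \<in> occ_in (\<phi> g y) (bact g \<gamma>) w \<longleftrightarrow> h \<in> occ_in y \<gamma> w" if h: "h \<in> carrier G" for h
  proof -
    have "\<phi> (g \<otimes> h) (hd w) \<in> iv (\<phi> g y) (bact g \<gamma>) \<longleftrightarrow> \<phi> h (hd w) \<in> iv y \<gamma>" if "w \<noteq> []"
    proof -
      have "hd w \<in> V" using that assms(3) by (cases w) auto
      then show ?thesis using assms h by (simp add: act_mult)
    qed
    then show ?thesis
      using occ_act[OF assms(1) h assms(2,3)] by (auto simp: occ_in_def)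
  qed
  show ?thesis
  proof
    show "(\<lambda>h. g \<otimes> h) ` occ_in y \<gamma> w \<subseteq> occ_in (\<phi> g y) (bact g \<gamma>) w"
      using * occ_in_carrier by blast
    show "occ_in (\<phi> g y) (bact g \<gamma>) w \<subseteq> (\<lambda>h. g \<otimes> h) ` occ_in y \<gamma> w"
    proof
      fix k assume k: "k \<in> occ_in (\<phi> g y) (bact g \<gamma>) w"
      then have kG: "k \<in> carrier G" using occ_in_carrier by blast
      have "g \<otimes> (inv g \<otimes> k) = k"
        using kG assms(1) by (simp add: grp.m_assoc[symmetric])
      then show "k \<in> (\<lambda>h. g \<otimes> h) ` occ_in y \<gamma> w"
        using *[of "inv g \<otimes> k"] k kG assms(1) by (intro image_eqI[of _ _ "inv g \<otimes> k"]) auto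
    qed
  qed
qed

text \<open>An occurrence is determined by the first vertex of the translated word, since the action is free.\<close>

lemma occ_in_diff:
  assumes "\<gamma> \<in> \<partial>V" "w \<in> lists V" "w \<noteq> []" "x \<in> V" "y \<in> V"
  shows "finite (occ_in x \<gamma> w - occ_in y \<gamma> w)"
proof (rule finite_subset)
  show "occ_in x \<gamma> w - occ_in y \<gamma> w \<subseteq> {g \<in> carrier G. \<phi> g (hd w) \<in> iv x \<gamma> - iv y \<gamma>}"
    using assms(3) by (auto simp: occ_in_def occ_def)
  have "hd w \<in> V" using assms by (cases w) auto
  then show "finite {g \<in> carrier G. \<phi> g (hd w) \<in> iv x \<gamma> - iv y \<gamma>}"
    by (intro finite_act_in intervals_diff assms)
qed

lemma infinite_occ_in_base:
  assumes "\<gamma> \<in> \<partial>V" "w \<in> lists V" "w \<noteq> []" "x \<in> V" "y \<in> V" "infinite (occ_in x \<gamma> w)"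
  shows "infinite (occ_in y \<gamma> w)"
proof
  assume "finite (occ_in y \<gamma> w)"
  then have "finite ((occ_in x \<gamma> w - occ_in y \<gamma> w) \<union> occ_in y \<gamma> w)"
    using occ_in_diff[OF assms(1-5)] by simp
  then have "finite (occ_in x \<gamma> w)"
    by (rule rev_finite_subset) blast
  with assms(6) show False by simp
qed

lemma infinite_occ_in_act:
  assumes g: "g \<in> carrier G" and \<gamma>: "\<gamma> \<in> \<partial>V" and w: "w \<in> lists V" "w \<noteq> []"
  shows "infinite (occ_in p (bact g \<gamma>) w) \<longleftrightarrow> infinite (occ_in p \<gamma> w)"
proof -
  have "inj_on (\<lambda>h. g \<otimes> h) (occ_in p \<gamma> w)"
    using occ_in_carrier g by (intro inj_onI) (metis grp.Units_eq grp.Units_l_cancel subsetD)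
  then have "infinite (occ_in (\<phi> g p) (bact g \<gamma>) w) \<longleftrightarrow> infinite (occ_in p \<gamma> w)"
    unfolding occ_in_act[OF g \<gamma> w(1) base] by (simp add: finite_image_iff)
  moreover have "bact g \<gamma> \<in> \<partial>V" "\<phi> g p \<in> V"
    using g \<gamma> base by auto
  ultimately show ?thesis
    using infinite_occ_in_base[OF _ w] base by blast
qed

text \<open>Letters are vertices and not orbits of vertices, so a word and a group element together name a path.  Taking the
  first letter that works in a fixed enumeration of \<open>V\<close>, together with the independence of the base
  point, gives all points of an orbit the same words.\<close>

definition next_letter :: "(real \<Rightarrow> 'v \<Rightarrow> real) set \<Rightarrow> 'v list \<Rightarrow> 'v" where
  "next_letter \<gamma> w = from_nat_into V (LEAST k. infinite (occ_in p \<gamma> (w @ [from_nat_into V k])))"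

primrec word :: "(real \<Rightarrow> 'v \<Rightarrow> real) set \<Rightarrow> nat \<Rightarrow> 'v list" where
  "word \<gamma> 0 = []"
| "word \<gamma> (Suc n) = word \<gamma> n @ [next_letter \<gamma> (word \<gamma> n)]"

lemma vertex_enum: "from_nat_into V k \<in> V"
  using base from_nat_into[of V k] by auto

lemma word_lists [simp]: "word \<gamma> n \<in> lists V"
  by (induction n) (auto simp: next_letter_def vertex_enum)

lemma length_word [simp]: "length (word \<gamma> n) = n"
  by (induction n) auto

lemma word_act [simp]:
  assumes "g \<in> carrier G" "\<gamma> \<in> \<partial>V"
  shows "word (bact g \<gamma>) n = word \<gamma> n"
proof (induction n)
  case (Suc n)
  have "infinite (occ_in p (bact g \<gamma>) (word \<gamma> n @ [from_nat_into V k]))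
      \<longleftrightarrow> infinite (occ_in p \<gamma> (word \<gamma> n @ [from_nat_into V k]))" for k
    using vertex_enum word_lists by (intro infinite_occ_in_act assms) auto
  then have "next_letter (bact g \<gamma>) (word \<gamma> n) = next_letter \<gamma> (word \<gamma> n)"
    by (simp add: next_letter_def)
  with Suc show ?case by simp
qed simp

lemma infinite_union_member:
  assumes "infinite S" "S \<subseteq> (\<Union>u\<in>I. T u)" "finite I"
  shows "\<exists>u\<in>I. infinite (T u)"
  using assms by (meson finite_UN_I finite_subset)

text \<open>The infinitely many vertices of the interval fall into finitely many orbits.\<close>

lemma word_start:
  assumes \<gamma>: "\<gamma> \<in> \<partial>V"
  shows "\<exists>u\<in>V. infinite (occ_in p \<gamma> [u])"
proof -
  obtain F where F: "finite F" "F \<subseteq> V" "\<And>v. v \<in> V \<Longrightarrow> \<exists>g\<in>carrier G. \<exists>d\<in>F. v = \<phi> g d"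
    using cocompact by blast
  have "iv p \<gamma> \<subseteq> (\<Union>d\<in>F. (\<lambda>g. \<phi> g d) ` occ_in p \<gamma> [d])"
  proof
    fix v assume v: "v \<in> iv p \<gamma>"
    obtain g d where g: "g \<in> carrier G" "d \<in> F" "v = \<phi> g d"
      using F(3)[OF ray_interval_V[OF v]] by blast
    obtain f where "f \<in> rays_to \<gamma>" "f 0 = v"
      using ray_from[OF \<gamma> v base] by blast
    then have "starts \<gamma> [\<phi> g d]"
      using g by (auto simp: starts_def)
    then have "g \<in> occ_in p \<gamma> [d]"
      using g v by (simp add: occ_in_def occ_def)
    then show "v \<in> (\<Union>d\<in>F. (\<lambda>g. \<phi> g d) ` occ_in p \<gamma> [d])"
      using g by blast
  qed
  then obtain d where "d \<in> F" "infinite ((\<lambda>g. \<phi> g d) ` occ_in p \<gamma> [d])"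
    using infinite_union_member[OF infinite_interval[OF \<gamma> base]] F(1) by blast
  then show ?thesis
    using F(2) by blast
qed

text \<open>Each occurrence of \<open>w\<close> is continued by some neighbour of its last vertex, that is, by the translate of a
  neighbour of the last letter, and there are finitely many of those.\<close>

lemma word_extend:
  assumes \<gamma>: "\<gamma> \<in> \<partial>V" and w: "w \<in> lists V" "w \<noteq> []" and inf: "infinite (occ_in p \<gamma> w)"
  shows "\<exists>u\<in>V. infinite (occ_in p \<gamma> (w @ [u]))"
proof -
  have lastV: "last w \<in> V"
    using w last_in_set by blast
  have "occ_in p \<gamma> w \<subseteq> (\<Union>u\<in>{u. {last w, u} \<in> E}. occ_in p \<gamma> (w @ [u]))"
  proof
    fix g assume g: "g \<in> occ_in p \<gamma> w"
    then have gG: "g \<in> carrier G" using occ_in_carrier by blast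
    obtain f where f: "f \<in> rays_to \<gamma>" "\<And>i. i < length w \<Longrightarrow> f i = \<phi> g (w ! i)"
      using g by (auto simp: occ_in_def occ_def starts_def)
    define u where "u = \<phi> (inv g) (f (length w))"
    have fu: "f (length w) = \<phi> g u" and uV: "u \<in> V"
      using gG rays_to_V[OF f(1)] by (auto simp: u_def)
    have "f (length w - 1) = \<phi> g (last w)"
      using f(2)[of "length w - 1"] w by (simp add: last_conv_nth)
    moreover have "{f (length w - 1), f (length w)} \<in> E"
      using discrete_ray_edge[OF rays_to_discrete[OF f(1)], of "length w - 1"] w by simp
    ultimately have "{last w, u} \<in> E"
      using fu edges[OF gG lastV uV] by simp
    moreover have "starts \<gamma> (map (\<phi> g) (w @ [u]))"
      unfolding starts_def
    proof (rule bexI[OF _ f(1)], intro allI impI)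
      fix i assume "i < length (map (\<phi> g) (w @ [u]))"
      then show "f i = map (\<phi> g) (w @ [u]) ! i"
        using f(2)[of i] fu by (cases "i = length w") (auto simp: nth_append)
    qed
    then have "g \<in> occ_in p \<gamma> (w @ [u])"
      using g gG w by (auto simp: occ_in_def occ_def)
    ultimately show "g \<in> (\<Union>u\<in>{u. {last w, u} \<in> E}. occ_in p \<gamma> (w @ [u]))" by blast
  qed
  then obtain u where "{last w, u} \<in> E" "infinite (occ_in p \<gamma> (w @ [u]))"
    using infinite_union_member[OF inf _ neighbours_finite[OF locally_finite lastV]] by blast
  then show ?thesis
    using edge_V by blast
qed

lemma infinite_occ_next_letter:
  assumes "\<exists>u\<in>V. infinite (occ_in p \<gamma> (w @ [u]))"
  shows "infinite (occ_in p \<gamma> (w @ [next_letter \<gamma> w]))"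
proof -
  obtain u where u: "u \<in> V" "infinite (occ_in p \<gamma> (w @ [u]))"
    using assms by blast
  then have "infinite (occ_in p \<gamma> (w @ [from_nat_into V (to_nat_on V u)]))"
    using countable_V[OF locally_finite] by simp
  then show ?thesis
    unfolding next_letter_def by (rule LeastI)
qed

lemma word_infinite:
  assumes \<gamma>: "\<gamma> \<in> \<partial>V"
  shows "infinite (occ_in p \<gamma> (word \<gamma> (Suc n)))"
proof (induction n)
  case 0
  show ?case
    using infinite_occ_next_letter[of \<gamma> "[]"] word_start[OF \<gamma>] by simp
next
  case (Suc n)
  show ?case
    using infinite_occ_next_letter[OF word_extend[OF \<gamma> word_lists _ Suc.IH]] by simp
qed

lemma word_nth: "i < n \<Longrightarrow> word \<gamma> n ! i = word \<gamma> (Suc i) ! i"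
proof (induction n)
  case (Suc n)
  then show ?case
    by (cases "i = n") (auto simp: nth_append)
qed simp

lemma hd_word: "hd (word \<gamma> (Suc n)) = word \<gamma> 1 ! 0"
proof -
  have "word \<gamma> (Suc n) \<noteq> []" by simp
  then have "hd (word \<gamma> (Suc n)) = word \<gamma> (Suc n) ! 0"
    by (rule hd_conv_nth)
  then show ?thesis
    using word_nth[of 0 "Suc n" \<gamma>] by (simp only: One_nat_def zero_less_Suc)
qed

lemma starts_butlast: "starts \<gamma> (w @ [u]) \<Longrightarrow> starts \<gamma> w"
  by (auto simp: starts_def nth_append split: if_splits) (metis less_SucI)

lemma occ_word_antimono:
  assumes "n \<le> m"
  shows "occ \<gamma> (word \<gamma> m) \<subseteq> occ \<gamma> (word \<gamma> n)"
  using assms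
proof (induction m rule: dec_induct)
  case (step m)
  have "occ \<gamma> (word \<gamma> (Suc m)) \<subseteq> occ \<gamma> (word \<gamma> m)"
    using starts_butlast by (auto simp: occ_def)
  with step show ?case by blast
qed simp

lemma ray_of_word:
  assumes "\<gamma> \<in> \<partial>V" "\<And>n. g \<in> occ \<gamma> (word \<gamma> n)"
  shows "\<phi> g \<circ> (\<lambda>i. word \<gamma> (Suc i) ! i) \<in> rays_to \<gamma>"
proof (rule rays_to_limit[OF assms(1)])
  fix n
  obtain f where f: "f \<in> rays_to \<gamma>" "\<And>i. i < Suc n \<Longrightarrow> f i = \<phi> g (word \<gamma> (Suc n) ! i)"
    using assms(2)[of "Suc n"] by (auto simp: occ_def starts_def simp del: word.simps)
  then show "\<exists>f\<in>rays_to \<gamma>. \<forall>i\<le>n. f i = (\<phi> g \<circ> (\<lambda>i. word \<gamma> (Suc i) ! i)) i"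
    using word_nth[of _ "Suc n" \<gamma>] by (intro bexI[OF _ f(1)]) (simp del: word.simps)
qed

end

section \<open>Markers\<close>

context interval_action
begin

text \<open>Occurrences of the greedy words of \<open>\<gamma>\<close>: the towers decrease as the level grows from 1 on.\<close>

definition tower :: "'v \<Rightarrow> (real \<Rightarrow> 'v \<Rightarrow> real) set \<Rightarrow> nat \<Rightarrow> 'g set" where
  "tower y \<gamma> n = occ_in y \<gamma> (word \<gamma> n)"

text \<open>The first vertex of the translated word.  All words of positive length have the same first letter.\<close>

definition foot :: "(real \<Rightarrow> 'v \<Rightarrow> real) set \<Rightarrow> 'g \<Rightarrow> 'v" where
  "foot \<gamma> g = \<phi> g (word \<gamma> 1 ! 0)"

text \<open>The elements of \<open>S\<close> that come first on the way to \<open>\<gamma>\<close>, measured by how much of \<open>S\<close> is not visible from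
  their foot.  No base point is involved, so this choice commutes with the action and is the same
  for two base points whose towers coincide.\<close>

definition leading :: "'g set \<Rightarrow> (real \<Rightarrow> 'v \<Rightarrow> real) set \<Rightarrow> nat \<Rightarrow> 'g set" where
  "leading S \<gamma> n = {g \<in> S. \<forall>h\<in>S. card (S - tower (foot \<gamma> g) \<gamma> n) \<le> card (S - tower (foot \<gamma> h) \<gamma> n)}"

definition recurrent :: "(real \<Rightarrow> 'v \<Rightarrow> real) set \<Rightarrow> bool" where
  "recurrent \<gamma> \<longleftrightarrow> (\<exists>g\<in>carrier G. \<forall>n. g \<in> occ \<gamma> (word \<gamma> n))"

text \<open>Any choice would do, as different choices are compensated by the group element \<open>h\<close> in
  \<open>markers_recurrent_act\<close>; the first one in an enumeration is measurable.\<close>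

definition first_occ :: "(real \<Rightarrow> 'v \<Rightarrow> real) set \<Rightarrow> 'g" where
  "first_occ \<gamma> = from_nat_into (carrier G) (LEAST k. \<forall>n. from_nat_into (carrier G) k \<in> occ \<gamma> (word \<gamma> n))"

definition markers :: "nat \<Rightarrow> (real \<Rightarrow> 'v \<Rightarrow> real) set \<Rightarrow> 'g set" where
  "markers n \<gamma> = (if n = 0 then {\<one>} else if recurrent \<gamma> then {first_occ \<gamma>} else leading (tower p \<gamma> n) \<gamma> n)"

lemma tower_carrier: "tower y \<gamma> n \<subseteq> carrier G"
  by (simp add: tower_def occ_in_carrier)

lemma leading_carrier: "leading (tower y \<gamma> n) \<gamma> m \<subseteq> carrier G"
  using tower_carrier by (auto simp: leading_def)

lemma letter_V: "word \<gamma> 1 ! 0 \<in> V"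
proof -
  have "set (word \<gamma> 1) \<subseteq> V" using word_lists[of \<gamma> 1] by auto
  moreover have "word \<gamma> 1 ! 0 \<in> set (word \<gamma> 1)" by (rule nth_mem) simp
  ultimately show ?thesis by blast
qed

lemma foot_V [simp]: "g \<in> carrier G \<Longrightarrow> foot \<gamma> g \<in> V"
  unfolding foot_def by (rule act_V[OF _ letter_V])

lemma foot_act:
  assumes "g \<in> carrier G" "h \<in> carrier G" "\<gamma> \<in> \<partial>V"
  shows "foot (bact g \<gamma>) (g \<otimes> h) = \<phi> g (foot \<gamma> h)"
  unfolding foot_def word_act[OF assms(1,3)] by (rule act_mult[OF assms(1,2) letter_V])

lemma tower_act:
  assumes "g \<in> carrier G" "\<gamma> \<in> \<partial>V" "y \<in> V"
  shows "tower (\<phi> g y) (bact g \<gamma>) n = (\<lambda>h. g \<otimes> h) ` tower y \<gamma> n"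
  unfolding tower_def word_act[OF assms(1,2)] by (rule occ_in_act[OF assms(1,2) word_lists assms(3)])

lemma in_tower_iff:
  "g \<in> tower y \<gamma> (Suc n) \<longleftrightarrow> g \<in> occ \<gamma> (word \<gamma> (Suc n)) \<and> foot \<gamma> g \<in> iv y \<gamma>"
proof -
  have "word \<gamma> (Suc n) \<noteq> []" by simp
  then show ?thesis
    unfolding tower_def occ_in_def foot_def hd_word[symmetric, of _ n] by blast
qed

lemma tower_infinite: "\<gamma> \<in> \<partial>V \<Longrightarrow> infinite (tower p \<gamma> (Suc n))"
  unfolding tower_def by (rule word_infinite)

lemma tower_diff:
  assumes "\<gamma> \<in> \<partial>V" "x \<in> V" "y \<in> V"
  shows "finite (tower x \<gamma> (Suc n) - tower y \<gamma> (Suc n))"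
  unfolding tower_def by (rule occ_in_diff[OF assms(1) word_lists _ assms(2,3)]) simp

lemma leading_nonempty:
  assumes "\<gamma> \<in> \<partial>V"
  shows "leading (tower p \<gamma> (Suc n)) \<gamma> (Suc n) \<noteq> {}"
proof -
  let ?S = "tower p \<gamma> (Suc n)"
  have "?S \<noteq> {}"
    using tower_infinite[OF assms, of n] by (metis finite.emptyI)
  then obtain x where "x \<in> ?S" by blast
  then obtain g where "g \<in> ?S" "\<And>h. h \<in> ?S \<Longrightarrow>
      card (?S - tower (foot \<gamma> g) \<gamma> (Suc n)) \<le> card (?S - tower (foot \<gamma> h) \<gamma> (Suc n))"
    using ex_has_least_nat[of "\<lambda>g. g \<in> ?S" x "\<lambda>g. card (?S - tower (foot \<gamma> g) \<gamma> (Suc n))"] by blast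
  then show ?thesis
    unfolding leading_def by blast
qed

text \<open>If the foot of \<open>g\<close> is far from \<open>p\<close>, then the tower based at this foot misses any
  prescribed finite part of the tower based at \<open>p\<close>, so the number of missed elements is not
  minimal.\<close>

lemma leading_finite:
  assumes \<gamma>: "\<gamma> \<in> \<partial>V"
  shows "finite (leading (tower p \<gamma> (Suc n)) \<gamma> (Suc n))"
proof -
  let ?S = "tower p \<gamma> (Suc n)" and ?T = "\<lambda>g. tower (foot \<gamma> g) \<gamma> (Suc n)"
  obtain g0 where g0: "g0 \<in> leading ?S \<gamma> (Suc n)"
    using leading_nonempty[OF \<gamma>, of n] by blast
  define m where "m = card (?S - ?T g0)"
  obtain Q where Q: "finite Q" "card Q = Suc m" "Q \<subseteq> ?S"
    using infinite_arbitrarily_large[OF tower_infinite[OF \<gamma>, of n], of "Suc m"] by blast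
  define r where "r = Max ((\<lambda>h. D p (foot \<gamma> h)) ` Q)"
  have "leading ?S \<gamma> (Suc n) \<subseteq> {g \<in> carrier G. \<phi> g (word \<gamma> 1 ! 0) \<in> {v \<in> V. D p v \<le> r + 6 * \<delta>}}"
  proof
    fix g assume g: "g \<in> leading ?S \<gamma> (Suc n)"
    then have gS: "g \<in> ?S" and le: "card (?S - ?T g) \<le> m"
      using g0 unfolding leading_def m_def by blast+
    have gG: "g \<in> carrier G" using gS tower_carrier by blast
    have "finite (?S - ?T g)"
      by (rule tower_diff[OF \<gamma> base foot_V[OF gG]])
    then have "\<not> Q \<subseteq> ?S - ?T g"
      using card_mono[of "?S - ?T g" Q] Q(2) le by linarith
    then obtain h where h: "h \<in> Q" "h \<in> ?T g"
      using Q(3) by blast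
    have "D p (foot \<gamma> g) \<le> D p (foot \<gamma> h) + 6 * \<delta>"
      using interval_of_interval[OF \<gamma> base] gS h(2) unfolding in_tower_iff by blast
    moreover have "D p (foot \<gamma> h) \<le> r"
      unfolding r_def using h(1) Q(1) by (intro Max_ge) auto
    ultimately have "D p (foot \<gamma> g) \<le> r + 6 * \<delta>" by linarith
    then show "g \<in> {g \<in> carrier G. \<phi> g (word \<gamma> 1 ! 0) \<in> {v \<in> V. D p v \<le> r + 6 * \<delta>}}"
      using gG foot_V[OF gG, of \<gamma>] unfolding foot_def by blast
  qed
  moreover have "finite {g \<in> carrier G. \<phi> g (word \<gamma> 1 ! 0) \<in> {v \<in> V. D p v \<le> r + 6 * \<delta>}}"
    by (rule finite_act_in[OF letter_V ball_finite[OF locally_finite base]])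
  ultimately show ?thesis
    by (rule finite_subset)
qed

lemma inj_on_translate: "g \<in> carrier G \<Longrightarrow> inj_on (\<lambda>h. g \<otimes> h) (carrier G)"
  by (intro inj_onI) (metis grp.Units_eq grp.Units_l_cancel)

lemma leading_act:
  assumes g: "g \<in> carrier G" and \<gamma>: "\<gamma> \<in> \<partial>V" and S: "S \<subseteq> carrier G"
  shows "leading ((\<lambda>h. g \<otimes> h) ` S) (bact g \<gamma>) n = (\<lambda>h. g \<otimes> h) ` leading S \<gamma> n"
proof -
  have *: "card ((\<lambda>h. g \<otimes> h) ` S - tower (foot (bact g \<gamma>) (g \<otimes> h)) (bact g \<gamma>) n)
      = card (S - tower (foot \<gamma> h) \<gamma> n)" if h: "h \<in> S" for h
  proof -
    have hG: "h \<in> carrier G" using h S by blast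
    have "(\<lambda>h. g \<otimes> h) ` S - tower (foot (bact g \<gamma>) (g \<otimes> h)) (bact g \<gamma>) n
        = (\<lambda>h. g \<otimes> h) ` (S - tower (foot \<gamma> h) \<gamma> n)"
      unfolding foot_act[OF g hG \<gamma>] tower_act[OF g \<gamma> foot_V[OF hG]]
      by (rule inj_on_image_set_diff[OF inj_on_translate[OF g], symmetric]) (use S tower_carrier in blast)+
    moreover have "inj_on (\<lambda>h. g \<otimes> h) (S - tower (foot \<gamma> h) \<gamma> n)"
      by (rule inj_on_subset[OF inj_on_translate[OF g]]) (use S in blast)
    ultimately show ?thesis
      by (simp only: card_image)
  qed
  have "g \<otimes> h \<in> leading ((\<lambda>h. g \<otimes> h) ` S) (bact g \<gamma>) n \<longleftrightarrow> h \<in> leading S \<gamma> n" if h: "h \<in> S" for h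
    using h * by (simp add: leading_def)
  then show ?thesis
    unfolding leading_def by blast
qed

lemma recurrent_act_imp:
  assumes g: "g \<in> carrier G" and \<gamma>: "\<gamma> \<in> \<partial>V" and "recurrent \<gamma>"
  shows "recurrent (bact g \<gamma>)"
proof -
  obtain h where h: "h \<in> carrier G" "\<And>n. h \<in> occ \<gamma> (word \<gamma> n)"
    using assms(3) unfolding recurrent_def by blast
  then have "g \<otimes> h \<in> occ (bact g \<gamma>) (word (bact g \<gamma>) n)" for n
    unfolding word_act[OF g \<gamma>] occ_act[OF g h(1) \<gamma> word_lists] by blast
  then show ?thesis
    unfolding recurrent_def using g h(1) by blast
qed

lemma recurrent_act:
  assumes g: "g \<in> carrier G" and \<gamma>: "\<gamma> \<in> \<partial>V"
  shows "recurrent (bact g \<gamma>) \<longleftrightarrow> recurrent \<gamma>"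
  using recurrent_act_imp[OF g \<gamma>] recurrent_act_imp[of "inv g" "bact g \<gamma>"] g \<gamma> by auto

lemma group_enum: "from_nat_into (carrier G) k \<in> carrier G"
  using grp.one_closed by (intro from_nat_into) blast

lemma first_occ_carrier: "first_occ \<gamma> \<in> carrier G"
  by (simp add: first_occ_def group_enum)

lemma first_occ_occ:
  assumes "recurrent \<gamma>"
  shows "first_occ \<gamma> \<in> occ \<gamma> (word \<gamma> n)"
proof -
  obtain g where g: "g \<in> carrier G" "\<forall>n. g \<in> occ \<gamma> (word \<gamma> n)"
    using assms unfolding recurrent_def by blast
  then have "\<forall>n. from_nat_into (carrier G) (to_nat_on (carrier G) g) \<in> occ \<gamma> (word \<gamma> n)"
    using countable_carrier by simp
  then have "\<forall>n. first_occ \<gamma> \<in> occ \<gamma> (word \<gamma> n)"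
    unfolding first_occ_def by (rule LeastI)
  then show ?thesis ..
qed

text \<open>Two towers of height 1 over the same boundary point differ by finitely many group
  elements, each of which drops out of all sufficiently high towers.\<close>

lemma towers_eventually_equal:
  assumes \<gamma>: "\<gamma> \<in> \<partial>V" and x: "x \<in> V" and y: "y \<in> V" and nr: "\<not> recurrent \<gamma>"
  shows "\<exists>n. \<forall>m\<ge>n. tower x \<gamma> (Suc m) = tower y \<gamma> (Suc m)"
proof -
  define W where "W = (tower x \<gamma> (Suc 0) - tower y \<gamma> (Suc 0)) \<union> (tower y \<gamma> (Suc 0) - tower x \<gamma> (Suc 0))"
  have W: "finite W" "W \<subseteq> carrier G"
    unfolding W_def using tower_diff[OF \<gamma> x y, of 0] tower_diff[OF \<gamma> y x, of 0] tower_carrier by blast+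
  have "\<exists>n. h \<notin> occ \<gamma> (word \<gamma> n)" if "h \<in> W" for h
    using that W(2) nr unfolding recurrent_def by blast
  then obtain \<nu> where \<nu>: "\<And>h. h \<in> W \<Longrightarrow> h \<notin> occ \<gamma> (word \<gamma> (\<nu> h))"
    by metis
  define n where "n = (\<Sum>h\<in>W. \<nu> h)"
  have out: "h \<notin> occ \<gamma> (word \<gamma> (Suc m))" if "h \<in> W" "n \<le> m" for h m
  proof -
    have "\<nu> h \<le> n"
      unfolding n_def using W(1) that(1) by (intro member_le_sum) auto
    then show ?thesis
      using \<nu>[OF that(1)] occ_word_antimono[of "\<nu> h" "Suc m" \<gamma>] that(2) by fastforce
  qed
  have "tower x \<gamma> (Suc m) = tower y \<gamma> (Suc m)" if "n \<le> m" for m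
  proof (rule Set.set_eqI)
    fix h
    show "h \<in> tower x \<gamma> (Suc m) \<longleftrightarrow> h \<in> tower y \<gamma> (Suc m)"
    proof (cases "h \<in> occ \<gamma> (word \<gamma> (Suc m))")
      case True
      then have "h \<notin> W" using out that by blast
      moreover have "h \<in> occ \<gamma> (word \<gamma> (Suc 0))"
        using True occ_word_antimono[of "Suc 0" "Suc m" \<gamma>] by blast
      ultimately have "foot \<gamma> h \<in> iv x \<gamma> \<longleftrightarrow> foot \<gamma> h \<in> iv y \<gamma>"
        unfolding W_def Un_iff Diff_iff in_tower_iff by blast
      then show ?thesis
        unfolding in_tower_iff by blast
    qed (simp add: in_tower_iff)
  qed
  then show ?thesis by blast
qed

text \<open>Both markers translate the same infinite word to a ray, so their quotient carries a ray to \<open>\<gamma>\<close> to a ray to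
  \<open>g \<gamma>\<close>.\<close>

lemma markers_recurrent_act:
  assumes g: "g \<in> carrier G" and \<gamma>: "\<gamma> \<in> \<partial>V" and rec: "recurrent \<gamma>"
  shows "\<exists>h\<in>carrier G. bact h \<gamma> = bact g \<gamma> \<and> (\<forall>m\<ge>1. markers m (bact g \<gamma>) = (\<lambda>u. h \<otimes> u) ` markers m \<gamma>)"
proof -
  have rec': "recurrent (bact g \<gamma>)"
    using recurrent_act[OF g \<gamma>] rec by simp
  have g\<gamma>: "bact g \<gamma> \<in> \<partial>V" using g \<gamma> by simp
  let ?a = "first_occ \<gamma>" and ?b = "first_occ (bact g \<gamma>)"
  let ?s = "\<lambda>i. word \<gamma> (Suc i) ! i"
  define h where "h = ?b \<otimes> inv ?a"
  have h: "h \<in> carrier G" "h \<otimes> ?a = ?b"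
    unfolding h_def by (auto simp: first_occ_carrier grp.m_assoc)
  have a: "\<phi> ?a \<circ> ?s \<in> rays_to \<gamma>"
    by (rule ray_of_word[OF \<gamma> first_occ_occ[OF rec]])
  have b: "\<phi> ?b \<circ> ?s \<in> rays_to (bact g \<gamma>)"
    using ray_of_word[OF g\<gamma> first_occ_occ[OF rec']] unfolding word_act[OF g \<gamma>] .
  have "?s i \<in> V" for i
  proof -
    have "?s i \<in> set (word \<gamma> (Suc i))" by (rule nth_mem) simp
    then show ?thesis using word_lists[of \<gamma> "Suc i"] by blast
  qed
  then have "\<phi> h \<circ> (\<phi> ?a \<circ> ?s) = \<phi> ?b \<circ> ?s"
    using act_mult[OF h(1) first_occ_carrier, of _ \<gamma>] h(2) by (simp add: fun_eq_iff del: word.simps)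
  then have "bact h \<gamma> = bact g \<gamma>"
    using bact_unique[OF \<gamma> g\<gamma> h(1) a] b by simp
  moreover have "markers m (bact g \<gamma>) = (\<lambda>u. h \<otimes> u) ` markers m \<gamma>" if "1 \<le> m" for m
    using that rec rec' h(2) by (simp add: markers_def)
  ultimately show ?thesis
    using h(1) by blast
qed

lemma markers_act:
  assumes g: "g \<in> carrier G" and \<gamma>: "\<gamma> \<in> \<partial>V"
  shows "\<exists>h\<in>carrier G. bact h \<gamma> = bact g \<gamma> \<and>
    (\<exists>n. \<forall>m\<ge>n. markers m (bact g \<gamma>) = (\<lambda>u. h \<otimes> u) ` markers m \<gamma>)"
proof (cases "recurrent \<gamma>")
  case True
  then show ?thesis
    using markers_recurrent_act[OF g \<gamma>] by blast
next
  case False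
  then have nr: "\<not> recurrent (bact g \<gamma>)"
    using recurrent_act[OF g \<gamma>] by simp
  define y where "y = \<phi> (inv g) p"
  have y: "y \<in> V" "\<phi> g y = p"
    using g base by (auto simp: y_def)
  obtain n where n: "\<And>m. n \<le> m \<Longrightarrow> tower p \<gamma> (Suc m) = tower y \<gamma> (Suc m)"
    using towers_eventually_equal[OF \<gamma> base y(1) False] by blast
  have "markers m (bact g \<gamma>) = (\<lambda>u. g \<otimes> u) ` markers m \<gamma>" if m: "Suc n \<le> m" for m
  proof -
    obtain k where k: "m = Suc k" "n \<le> k" using m by (cases m) auto
    have "tower p (bact g \<gamma>) m = (\<lambda>u. g \<otimes> u) ` tower p \<gamma> m"
      using tower_act[OF g \<gamma> y(1), of m] n[OF k(2)] unfolding y(2) k(1) by simp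
    then show ?thesis
      using leading_act[OF g \<gamma> tower_carrier, of p \<gamma> m m] nr False k(1) by (simp add: markers_def)
  qed
  then show ?thesis
    using g by blast
qed

section \<open>Measurability of the markers\<close>

abbreviation bb :: "(real \<Rightarrow> 'v \<Rightarrow> real) set measure" where "bb \<equiv> boundary_borel p"

lemma countable_words: "countable (lists V)"
  using countable_V[OF locally_finite] by (rule countable_lists)

lemma pred_starts_base: "Measurable.pred bb (\<lambda>\<gamma>. starts \<gamma> w)"
  by (rule pred_starts[OF base])

lemma interval_iff_starts:
  assumes "\<gamma> \<in> \<partial>V" "x \<in> V"
  shows "v \<in> iv x \<gamma> \<longleftrightarrow> (\<exists>w\<in>{w \<in> lists V. w \<noteq> [] \<and> hd w = x \<and> last w = v}. starts \<gamma> w)"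
proof
  assume "v \<in> iv x \<gamma>"
  then obtain f n where f: "f \<in> rays_to \<gamma>" "f 0 = x" "v = f n"
    using ray_interval_iff[OF assms] by blast
  have "map f [0..<Suc n] \<in> lists V" "hd (map f [0..<Suc n]) = x" "last (map f [0..<Suc n]) = v"
    "map f [0..<Suc n] \<noteq> []"
    using rays_to_V[OF f(1)] f by (auto simp: hd_map simp del: upt_Suc) (simp add: last_map)
  moreover have "starts \<gamma> (map f [0..<Suc n])"
    unfolding starts_def using f(1) by (intro bexI[of _ f]) (auto simp del: upt_Suc)
  ultimately show "\<exists>w\<in>{w \<in> lists V. w \<noteq> [] \<and> hd w = x \<and> last w = v}. starts \<gamma> w"
    by blast
next
  assume "\<exists>w\<in>{w \<in> lists V. w \<noteq> [] \<and> hd w = x \<and> last w = v}. starts \<gamma> w"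
  then obtain w f where w: "w \<noteq> []" "hd w = x" "last w = v" and f: "f \<in> rays_to \<gamma>" "\<And>i. i < length w \<Longrightarrow> f i = w ! i"
    unfolding starts_def by blast
  have "f 0 = x" "f (length w - 1) = v"
    using w f(2)[of 0] f(2)[of "length w - 1"] by (auto simp: hd_conv_nth last_conv_nth)
  then show "v \<in> iv x \<gamma>"
    using ray_interval_iff[OF assms] f(1) by blast
qed

lemma pred_interval:
  assumes "x \<in> V"
  shows "Measurable.pred bb (\<lambda>\<gamma>. v \<in> iv x \<gamma>)"
proof -
  have "countable {w \<in> lists V. w \<noteq> [] \<and> hd w = x \<and> last w = v}"
    by (rule countable_subset[OF _ countable_words]) blast
  then have "Measurable.pred bb (\<lambda>\<gamma>. \<exists>w\<in>{w \<in> lists V. w \<noteq> [] \<and> hd w = x \<and> last w = v}. starts \<gamma> w)"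
    by (intro pred_Bex_countable pred_starts_base)
  also have "?this \<longleftrightarrow> ?thesis"
    by (rule measurable_cong) (simp only: interval_iff_starts[OF _ assms] space_boundary_borel)
  finally show ?thesis .
qed

lemma pred_occ: "Measurable.pred bb (\<lambda>\<gamma>. g \<in> occ \<gamma> w)"
  unfolding occ_def mem_Collect_eq by (intro pred_intros_logic pred_starts_base) simp

lemma pred_occ_in: "y \<in> V \<Longrightarrow> Measurable.pred bb (\<lambda>\<gamma>. g \<in> occ_in y \<gamma> w)"
  unfolding occ_in_def mem_Collect_eq by (intro pred_intros_logic pred_occ pred_interval) simp_all

lemma pred_infinite_occ_in:
  assumes "y \<in> V"
  shows "Measurable.pred bb (\<lambda>\<gamma>. infinite (occ_in y \<gamma> w))"
proof -
  have "Measurable.pred bb (\<lambda>\<gamma>. finite (occ_in y \<gamma> w) \<and> True)"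
    by (rule pred_of_finite_set[OF countable_carrier occ_in_carrier pred_occ_in[OF assms]])
  then show ?thesis
    by (intro pred_intros_logic) simp
qed

lemma pred_next_letter: "Measurable.pred bb (\<lambda>\<gamma>. next_letter \<gamma> w = u)"
proof -
  have "(\<lambda>\<gamma>. LEAST k. infinite (occ_in p \<gamma> (w @ [from_nat_into V k]))) \<in> measurable bb (count_space UNIV)"
    by (intro measurable_Least pred_infinite_occ_in base)
  then show ?thesis
    unfolding next_letter_def
    by (rule measurable_compose[where g = "\<lambda>k. from_nat_into V k = u"]) simp
qed

lemma pred_word: "Measurable.pred bb (\<lambda>\<gamma>. word \<gamma> n = w)"
proof (induction n arbitrary: w)
  case (Suc n)
  have "word \<gamma> (Suc n) = w \<longleftrightarrow> w \<noteq> [] \<and> word \<gamma> n = butlast w \<and> next_letter \<gamma> (butlast w) = last w" for \<gamma>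
    by (cases w rule: rev_cases) auto
  moreover have "Measurable.pred bb (\<lambda>\<gamma>. w \<noteq> [] \<and> word \<gamma> n = butlast w \<and> next_letter \<gamma> (butlast w) = last w)"
    by (intro pred_intros_logic Suc pred_next_letter) simp
  ultimately show ?case by (simp only:)
qed simp

text \<open>The word of length \<open>n\<close> takes countably many values.\<close>

lemma pred_at_word:
  assumes "\<And>w. w \<in> lists V \<Longrightarrow> Measurable.pred bb (\<lambda>\<gamma>. Q \<gamma> w)"
  shows "Measurable.pred bb (\<lambda>\<gamma>. Q \<gamma> (word \<gamma> n))"
proof -
  have "Measurable.pred bb (\<lambda>\<gamma>. \<exists>w\<in>lists V. word \<gamma> n = w \<and> Q \<gamma> w)"
    by (intro pred_Bex_countable countable_words pred_intros_logic pred_word assms)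
  moreover have "(\<exists>w\<in>lists V. word \<gamma> n = w \<and> Q \<gamma> w) \<longleftrightarrow> Q \<gamma> (word \<gamma> n)" for \<gamma>
    using word_lists by blast
  ultimately show ?thesis by (simp only:)
qed

lemma pred_tower: "y \<in> V \<Longrightarrow> Measurable.pred bb (\<lambda>\<gamma>. g \<in> tower y \<gamma> n)"
  unfolding tower_def
  by (rule pred_at_word[where Q = "\<lambda>\<gamma> w. g \<in> occ_in y \<gamma> w"]) (rule pred_occ_in)

lemma pred_tower_foot:
  assumes "g \<in> carrier G"
  shows "Measurable.pred bb (\<lambda>\<gamma>. h \<in> tower (foot \<gamma> g) \<gamma> n)"
proof -
  have "Measurable.pred bb (\<lambda>\<gamma>. \<exists>w\<in>{w \<in> lists V. w \<noteq> []}. word \<gamma> 1 = w \<and> h \<in> tower (\<phi> g (w ! 0)) \<gamma> n)"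
  proof (intro pred_Bex_countable pred_intros_logic pred_word pred_tower)
    show "countable {w \<in> lists V. w \<noteq> []}"
      by (rule countable_subset[OF _ countable_words]) blast
    fix w assume "w \<in> {w \<in> lists V. w \<noteq> []}"
    then have "w ! 0 \<in> V" by (cases w) auto
    then show "\<phi> g (w ! 0) \<in> V" using assms by simp
  qed
  moreover have "(\<exists>w\<in>{w \<in> lists V. w \<noteq> []}. word \<gamma> 1 = w \<and> h \<in> tower (\<phi> g (w ! 0)) \<gamma> n)
      \<longleftrightarrow> h \<in> tower (foot \<gamma> g) \<gamma> n" for \<gamma>
  proof -
    have "word \<gamma> 1 \<noteq> []" by simp
    then show ?thesis
      unfolding foot_def using word_lists by blast
  qed
  ultimately show ?thesis by (simp only:)
qed

lemma pred_defect:
  assumes g: "g \<in> carrier G"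
  shows "Measurable.pred bb (\<lambda>\<gamma>. card (tower p \<gamma> (Suc n) - tower (foot \<gamma> g) \<gamma> (Suc n)) = k)"
proof -
  have "Measurable.pred bb (\<lambda>\<gamma>. finite (tower p \<gamma> (Suc n) - tower (foot \<gamma> g) \<gamma> (Suc n)) \<and>
      card (tower p \<gamma> (Suc n) - tower (foot \<gamma> g) \<gamma> (Suc n)) = k)"
  proof (rule pred_of_finite_set[OF countable_carrier])
    show "tower p \<gamma> (Suc n) - tower (foot \<gamma> g) \<gamma> (Suc n) \<subseteq> carrier G" for \<gamma>
      using tower_carrier by blast
    show "Measurable.pred bb (\<lambda>\<gamma>. h \<in> tower p \<gamma> (Suc n) - tower (foot \<gamma> g) \<gamma> (Suc n))" for h
      unfolding Diff_iff by (intro pred_intros_logic pred_tower pred_tower_foot base g)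
  qed
  also have "?this \<longleftrightarrow> ?thesis"
    by (rule measurable_cong) (use tower_diff[OF _ base foot_V[OF g]] in \<open>auto simp del: word.simps\<close>)
  finally show ?thesis .
qed

lemma pred_defect_le:
  assumes "g \<in> carrier G" "h \<in> carrier G"
  shows "Measurable.pred bb (\<lambda>\<gamma>. card (tower p \<gamma> (Suc n) - tower (foot \<gamma> g) \<gamma> (Suc n))
      \<le> card (tower p \<gamma> (Suc n) - tower (foot \<gamma> h) \<gamma> (Suc n)))"
    (is "Measurable.pred bb (\<lambda>\<gamma>. ?c \<gamma> \<le> ?d \<gamma>)")
proof -
  have "Measurable.pred bb (\<lambda>\<gamma>. \<exists>j. \<exists>k\<in>{j..}. ?c \<gamma> = j \<and> ?d \<gamma> = k)"
    by (intro pred_intros_countable pred_Bex_countable pred_intros_logic pred_defect assms) simp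
  moreover have "(\<exists>j. \<exists>k\<in>{j..}. ?c \<gamma> = j \<and> ?d \<gamma> = k) \<longleftrightarrow> ?c \<gamma> \<le> ?d \<gamma>" for \<gamma>
    by auto
  ultimately show ?thesis by simp
qed

lemma pred_leading:
  assumes "g \<in> carrier G"
  shows "Measurable.pred bb (\<lambda>\<gamma>. g \<in> leading (tower p \<gamma> (Suc n)) \<gamma> (Suc n))"
proof -
  let ?c = "\<lambda>\<gamma> g. card (tower p \<gamma> (Suc n) - tower (foot \<gamma> g) \<gamma> (Suc n))"
  have "Measurable.pred bb (\<lambda>\<gamma>. g \<in> tower p \<gamma> (Suc n) \<and>
      (\<forall>h\<in>carrier G. h \<in> tower p \<gamma> (Suc n) \<longrightarrow> ?c \<gamma> g \<le> ?c \<gamma> h))"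
    by (intro pred_intros_logic pred_Ball_countable countable_carrier pred_tower base pred_defect_le assms)
  moreover have "(g \<in> tower p \<gamma> (Suc n) \<and> (\<forall>h\<in>carrier G. h \<in> tower p \<gamma> (Suc n) \<longrightarrow> ?c \<gamma> g \<le> ?c \<gamma> h))
      \<longleftrightarrow> g \<in> leading (tower p \<gamma> (Suc n)) \<gamma> (Suc n)" for \<gamma>
    unfolding leading_def using tower_carrier by blast
  ultimately show ?thesis by (simp only:)
qed

lemma pred_occ_word: "Measurable.pred bb (\<lambda>\<gamma>. \<forall>n. g \<in> occ \<gamma> (word \<gamma> n))"
  by (intro pred_intros_countable, rule pred_at_word[where Q = "\<lambda>\<gamma> w. g \<in> occ \<gamma> w"], rule pred_occ)

lemma pred_recurrent: "Measurable.pred bb recurrent"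
  unfolding recurrent_def by (intro pred_Bex_countable countable_carrier pred_occ_word)

lemma pred_first_occ: "Measurable.pred bb (\<lambda>\<gamma>. first_occ \<gamma> = g)"
proof -
  have "(\<lambda>\<gamma>. LEAST k. \<forall>n. from_nat_into (carrier G) k \<in> occ \<gamma> (word \<gamma> n)) \<in> measurable bb (count_space UNIV)"
    by (intro measurable_Least pred_occ_word)
  then show ?thesis
    unfolding first_occ_def
    by (rule measurable_compose[where g = "\<lambda>k. from_nat_into (carrier G) k = g"]) simp
qed

lemma pred_markers:
  assumes "g \<in> carrier G"
  shows "Measurable.pred bb (\<lambda>\<gamma>. g \<in> markers n \<gamma>)"
proof (cases n)
  case 0
  then show ?thesis by (simp add: markers_def)
next
  case (Suc m)
  have "Measurable.pred bb (\<lambda>\<gamma>. (recurrent \<gamma> \<longrightarrow> first_occ \<gamma> = g) \<and>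
      (\<not> recurrent \<gamma> \<longrightarrow> g \<in> leading (tower p \<gamma> (Suc m)) \<gamma> (Suc m)))"
    by (intro pred_intros_logic pred_recurrent pred_first_occ pred_leading assms)
  moreover have "((recurrent \<gamma> \<longrightarrow> first_occ \<gamma> = g) \<and>
      (\<not> recurrent \<gamma> \<longrightarrow> g \<in> leading (tower p \<gamma> (Suc m)) \<gamma> (Suc m))) \<longleftrightarrow> g \<in> markers n \<gamma>" for \<gamma>
    unfolding markers_def Suc by auto
  ultimately show ?thesis by (simp only:)
qed

text \<open>The graph of a group element is cut out by countably many conditions because the sets of boundary points
  with given initial segment separate points.\<close>

lemma bact_eq_iff_starts:
  assumes g: "g \<in> carrier G" and a: "a \<in> \<partial>V" and b: "b \<in> \<partial>V"
  shows "bact g a = b \<longleftrightarrow> (\<forall>w\<in>lists V. starts a w \<longleftrightarrow> starts b (map (\<phi> g) w))"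
proof
  assume "bact g a = b"
  then show "\<forall>w\<in>lists V. starts a w \<longleftrightarrow> starts b (map (\<phi> g) w)"
    using starts_act[OF g a] by blast
next
  assume *: "\<forall>w\<in>lists V. starts a w \<longleftrightarrow> starts b (map (\<phi> g) w)"
  show "bact g a = b"
  proof (rule starts_separate[OF bact_in[OF g a] b])
    fix w assume w: "w \<in> lists V"
    have w': "map (\<phi> (inv g)) w \<in> lists V" "map (\<phi> g) (map (\<phi> (inv g)) w) = w"
      using w g by (auto intro!: map_idI)
    show "starts (bact g a) w \<longleftrightarrow> starts b w"
      using *[rule_format, OF w'(1)] starts_act[OF g a w'(1)] unfolding w'(2) by blast
  qed
qed

lemma pred_graph_bact:
  assumes g: "g \<in> carrier G"
  shows "Measurable.pred (bb \<Otimes>\<^sub>M bb) (\<lambda>x. bact g (fst x) = snd x)"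
proof -
  have "Measurable.pred (bb \<Otimes>\<^sub>M bb) (\<lambda>x. \<forall>w\<in>lists V. starts (fst x) w \<longleftrightarrow> starts (snd x) (map (\<phi> g) w))"
    by (intro pred_Ball_countable countable_words pred_intros_logic
        measurable_compose[OF measurable_fst pred_starts_base] measurable_compose[OF measurable_snd pred_starts_base])
  also have "?this \<longleftrightarrow> ?thesis"
  proof (rule measurable_cong)
    fix x assume "x \<in> space (bb \<Otimes>\<^sub>M bb)"
    then have "fst x \<in> \<partial>V" "snd x \<in> \<partial>V"
      by (auto simp: space_pair_measure)
    then show "(\<forall>w\<in>lists V. starts (fst x) w \<longleftrightarrow> starts (snd x) (map (\<phi> g) w)) \<longleftrightarrow> bact g (fst x) = snd x"
      using bact_eq_iff_starts[OF g] by blast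
  qed
  finally show ?thesis .
qed

proposition hyperfinite_boundary_action: "hyperfinite bb (orbit_relation G (\<partial>V) bact)"
proof -
  interpret marked_action G bb bact markers
  proof (unfold_locales, simp_all only: space_boundary_borel)
    fix a assume a: "a \<in> \<partial>V"
    fix n
    show "finite (markers n a)"
      using leading_finite[OF a] by (cases n) (auto simp: markers_def)
    show "markers n a \<subseteq> carrier G"
      using leading_carrier first_occ_carrier by (auto simp: markers_def)
    show "markers n a \<noteq> {}"
      using leading_nonempty[OF a] by (cases n) (auto simp: markers_def)
  qed (use countable_carrier bact_in bact_one bact_mult pred_graph_bact pred_markers markers_act in \<open>auto simp: markers_def\<close>)
  show ?thesis
    using hyperfinite_orbit_relation by simp
qed

end

section \<open>Transferring hyperbolicity from the group to the graph\<close>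

lemma cayley_edges_adjacency:
  "(x, y) \<in> adjacency (cayley_edges G S) \<longleftrightarrow>
     (\<exists>g s. g \<in> carrier G \<and> s \<in> S \<and> s \<noteq> \<one>\<^bsub>G\<^esub> \<and> (x = g \<and> y = g \<otimes>\<^bsub>G\<^esub> s \<or> y = g \<and> x = g \<otimes>\<^bsub>G\<^esub> s))"
  unfolding adjacency_def cayley_edges_def by (auto simp: doubleton_eq_iff)

context group
begin

lemma cayley_connected_simple_graph:
  assumes S: "S \<subseteq> carrier G" and gen: "generate G S = carrier G"
  shows "connected_simple_graph (carrier G) (cayley_edges G S)"
proof
  let ?A = "adjacency (cayley_edges G S)"
  show "simple_graph (carrier G) (cayley_edges G S)"
    unfolding simple_graph_def
  proof
    fix e assume "e \<in> cayley_edges G S"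
    then obtain g s where e: "e = {g, g \<otimes> s}" "g \<in> carrier G" "s \<in> S" "s \<noteq> \<one>"
      by (auto simp: cayley_edges_def)
    then have "s \<in> carrier G" using S by blast
    then have "g \<noteq> g \<otimes> s"
      using e l_cancel_one'[of g s] by simp
    with e \<open>s \<in> carrier G\<close> show "e \<subseteq> carrier G \<and> card e = 2" by simp
  qed
  have step: "(g, g \<otimes> s) \<in> ?A\<^sup>*" if "g \<in> carrier G" "s \<in> S" for g s
  proof (cases "s = \<one>")
    case False
    then have "(g, g \<otimes> s) \<in> ?A"
      unfolding cayley_edges_adjacency using that by blast
    then show ?thesis ..
  qed (use that in simp)
  have walk: "(g, g \<otimes> h) \<in> ?A\<^sup>*" if "h \<in> generate G S" "g \<in> carrier G" for g h
    using that
  proof (induction h arbitrary: g)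
    case one
    then show ?case by simp
  next
    case (incl h)
    then show ?case using step by blast
  next
    case (inv h)
    then have hG: "h \<in> carrier G" using S by blast
    have "(g \<otimes> inv h, (g \<otimes> inv h) \<otimes> h) \<in> ?A\<^sup>*"
      using inv hG by (intro step) auto
    then have "(g \<otimes> inv h, g) \<in> ?A\<^sup>*"
      using inv hG by (simp add: m_assoc)
    moreover have "sym (?A\<^sup>*)"
      using adjacency_sym by (intro sym_rtrancl) (auto intro!: symI)
    ultimately show ?case by (meson symD)
  next
    case (eng h1 h2)
    then have h: "h1 \<in> carrier G" "h2 \<in> carrier G" using gen by auto
    have "(g, g \<otimes> h1) \<in> ?A\<^sup>*" "(g \<otimes> h1, (g \<otimes> h1) \<otimes> h2) \<in> ?A\<^sup>*"
      using eng h by auto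
    then show ?case
      using h eng.prems by (simp add: m_assoc)
  qed
  show "connected_graph (carrier G) (cayley_edges G S)"
    unfolding connected_graph_def
  proof (intro conjI ballI)
    show "carrier G \<noteq> {}" using one_closed by blast
    fix u v assume uv: "u \<in> carrier G" "v \<in> carrier G"
    then have "(u, u \<otimes> (inv u \<otimes> v)) \<in> ?A\<^sup>*"
      using gen by (intro walk) auto
    then show "(u, v) \<in> {(x, y). {x, y} \<in> cayley_edges G S}\<^sup>*"
      using uv by (simp add: m_assoc[symmetric] adjacency_def)
  qed
qed

lemma cayley_translate_le:
  assumes g: "g \<in> carrier G" and S: "S \<subseteq> carrier G" and xy: "(x, y) \<in> adjacency (cayley_edges G S) ^^ n"
  shows "(g \<otimes> x, g \<otimes> y) \<in> adjacency (cayley_edges G S) ^^ n"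
  using xy
proof (induction n arbitrary: y)
  case (Suc n)
  then obtain z where z: "(x, z) \<in> adjacency (cayley_edges G S) ^^ n" "(z, y) \<in> adjacency (cayley_edges G S)"
    by auto
  from z(2) obtain h s where h: "h \<in> carrier G" "s \<in> S" "s \<noteq> \<one>" "z = h \<and> y = h \<otimes> s \<or> y = h \<and> z = h \<otimes> s"
    unfolding cayley_edges_adjacency by blast
  have "s \<in> carrier G" using h S by blast
  then have "(g \<otimes> z, g \<otimes> y) \<in> adjacency (cayley_edges G S)"
    unfolding cayley_edges_adjacency using h g
    by (intro exI[of _ "g \<otimes> h"] exI[of _ s]) (auto simp: m_assoc)
  then show ?case
    using Suc.IH[OF z(1)] by auto
qed simp

end

lemma bounded_on_finite:
  fixes f :: "'a \<Rightarrow> nat"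
  assumes "finite A"
  obtains B where "\<And>a. a \<in> A \<Longrightarrow> f a \<le> B"
  using assms by (metis finite_nat_set_iff_bounded_le finite_imageI imageI)

context graph_action
begin

text \<open>The Svarc-Milnor argument.  The orbit map of \<open>p\<close> is Lipschitz as there are finitely many generators.
  Conversely each vertex is within \<open>R\<close> of the orbit, and adjacent vertices are near orbit points of
  elements that differ by one of the finitely many \<open>k\<close> moving \<open>p\<close> by at most \<open>2R + 1\<close>.\<close>

lemma thin_of_hyperbolic_group:
  assumes hyp: "hyperbolic_group G" and lf: "locally_finite_graph V E"
    and F: "finite F" "F \<subseteq> V" "\<And>v. v \<in> V \<Longrightarrow> \<exists>g\<in>carrier G. \<exists>d\<in>F. v = \<phi> g d"
  shows "\<exists>\<delta>. thin \<delta>"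
proof -
  obtain p where p: "p \<in> V"
    using connected by (auto simp: connected_graph_def)
  obtain S where S: "finite S" "S \<subseteq> carrier G" "generate G S = carrier G"
    and hypS: "hyperbolic_space (graph_points (carrier G) (cayley_edges G S))
      (graph_dist (carrier G) (cayley_edges G S))"
    using hyp unfolding hyperbolic_group_def by blast
  let ?A = "cayley_edges G S"
  interpret A: connected_simple_graph "carrier G" ?A
    by (rule grp.cayley_connected_simple_graph[OF S(2,3)])
  obtain \<delta> where \<delta>: "A.thin \<delta>"
    using A.hyperbolic_imp_thin[OF hypS] by blast
  obtain \<mu> where \<mu>: "\<And>s. s \<in> S \<Longrightarrow> D p (\<phi> s p) \<le> \<mu>"
    using bounded_on_finite[OF S(1), of "\<lambda>s. D p (\<phi> s p)"] by blast
  have step: "D (\<phi> a p) (\<phi> b p) \<le> \<mu>" if ab: "(a, b) \<in> adjacency ?A" for a b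
  proof -
    obtain g s where g: "g \<in> carrier G" "s \<in> S" "a = g \<and> b = g \<otimes> s \<or> b = g \<and> a = g \<otimes> s"
      using ab unfolding cayley_edges_adjacency by blast
    have sG: "s \<in> carrier G" using g S by blast
    have "D (\<phi> g p) (\<phi> (g \<otimes> s) p) = D p (\<phi> s p)"
      using g sG p by (simp add: act_mult)
    then have "D (\<phi> g p) (\<phi> (g \<otimes> s) p) \<le> \<mu>" "D (\<phi> (g \<otimes> s) p) (\<phi> g p) \<le> \<mu>"
      using \<mu>[OF g(2)] by (simp_all only: gdist_sym[of E "\<phi> (g \<otimes> s) p" "\<phi> g p"])
    then show ?thesis
      using g(3) by blast
  qed
  have walk: "D (\<phi> a p) (\<phi> b p) \<le> \<mu> * n" if "(a, b) \<in> adjacency ?A ^^ n" "a \<in> carrier G" for a b n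
    using that
  proof (induction n arbitrary: b)
    case (Suc n)
    then obtain z where z: "(a, z) \<in> adjacency ?A ^^ n" "(z, b) \<in> adjacency ?A" by auto
    then have "z \<in> carrier G" "b \<in> carrier G" using A.adjacency_V by blast+
    then have "D (\<phi> a p) (\<phi> b p) \<le> D (\<phi> a p) (\<phi> z p) + D (\<phi> z p) (\<phi> b p)"
      using Suc.prems p by (intro gdist_triangle) auto
    also have "\<dots> \<le> \<mu> * n + \<mu>"
      by (intro add_mono Suc.IH z Suc.prems step)
    finally show ?case by simp
  qed simp
  have lip: "D (\<phi> a p) (\<phi> b p) \<le> \<mu> * A.D a b" if "a \<in> carrier G" "b \<in> carrier G" for a b
    using walk[OF A.gdist_relpow[OF that] that(1)] .
  obtain R where R: "\<And>d. d \<in> F \<Longrightarrow> D d p \<le> R"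
    using bounded_on_finite[OF F(1), of "\<lambda>d. D d p"] by blast
  have "\<exists>a\<in>carrier G. D v (\<phi> a p) \<le> R" if v: "v \<in> V" for v
  proof -
    obtain a d where a: "a \<in> carrier G" "d \<in> F" "v = \<phi> a d"
      using F(3)[OF v] by blast
    then have "d \<in> V" using F(2) by blast
    then have "D v (\<phi> a p) = D d p"
      using a p by simp
    then show ?thesis
      using a(1) R[OF a(2)] by (intro bexI[of _ a]) simp_all
  qed
  then obtain \<sigma> where \<sigma>: "\<And>v. v \<in> V \<Longrightarrow> \<sigma> v \<in> carrier G \<and> D v (\<phi> (\<sigma> v) p) \<le> R"
    by metis
  have "finite {k \<in> carrier G. \<phi> k p \<in> {v \<in> V. D p v \<le> 2 * R + 1}}"
    by (rule finite_act_in[OF p ball_finite[OF lf p]])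
  then obtain M where M: "\<And>k. k \<in> {k \<in> carrier G. \<phi> k p \<in> {v \<in> V. D p v \<le> 2 * R + 1}} \<Longrightarrow> A.D \<one> k \<le> M"
    using bounded_on_finite[of _ "\<lambda>k. A.D \<one> k"] by blast
  have jump: "A.D (\<sigma> u) (\<sigma> v) \<le> M" if uv: "{u, v} \<in> E" for u v
  proof -
    have V: "u \<in> V" "v \<in> V" using edge_V[OF uv] by auto
    let ?a = "\<sigma> u" and ?b = "\<sigma> v"
    have ab: "?a \<in> carrier G" "?b \<in> carrier G" using \<sigma> V by auto
    define k where "k = inv ?a \<otimes> ?b"
    have k: "k \<in> carrier G" "?a \<otimes> k = ?b"
      using ab by (auto simp: k_def grp.m_assoc[symmetric])
    have tri: "D (\<phi> ?a p) (\<phi> ?b p) \<le> D (\<phi> ?a p) u + D u (\<phi> ?b p)" "D u (\<phi> ?b p) \<le> D u v + D v (\<phi> ?b p)"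
      using V ab p by (auto intro!: gdist_triangle)
    have "D p (\<phi> k p) = D (\<phi> ?a p) (\<phi> ?b p)"
      using act_mult[OF ab(1) k(1) p] gdist_act[OF ab(1) p, of "\<phi> k p"] k p by simp
    also have "\<dots> \<le> 2 * R + 1"
      using tri \<sigma>[OF V(1)] \<sigma>[OF V(2)] gdist_edge[OF uv] gdist_sym[of E "\<phi> ?a p" u] by linarith
    finally have "A.D \<one> k \<le> M"
      using M k p by simp
    moreover have "(?a \<otimes> \<one>, ?a \<otimes> k) \<in> adjacency ?A ^^ A.D \<one> k"
      by (rule grp.cayley_translate_le[OF ab(1) S(2) A.gdist_relpow]) (use k in auto)
    then have "A.D ?a ?b \<le> A.D \<one> k"
      using k ab gdist_le by fastforce
    ultimately show ?thesis by linarith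
  qed
  show ?thesis
    by (rule thin_quasi_isometry[OF A.connected_simple_graph_axioms connected_simple_graph_axioms \<delta>,
          where \<pi> = "\<lambda>a. \<phi> a p" and \<sigma> = \<sigma> and \<mu> = \<mu> and R = R and M = M])
      (use p lip \<sigma> jump in auto)
qed

end

section \<open>Hyperfiniteness of the boundary action\<close>

theorem theorem1p4:
  fixes G :: "('g, 'b) monoid_scheme"
    and V :: "'v set" and E :: "'v set set"
    and \<phi> :: "'g \<Rightarrow> 'v \<Rightarrow> 'v" and p :: 'v
  assumes "hyperbolic_group G"
    and "simple_graph V E" and "connected_graph V E" and "locally_finite_graph V E"
    and "acts_by_automorphisms G V E \<phi>"
    and "acts_freely G V \<phi>" and "acts_cocompactly G V \<phi>"
    and "\<And>\<gamma> x y. \<lbrakk>\<gamma> \<in> graph_boundary V E; x \<in> V; y \<in> V\<rbrakk>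
           \<Longrightarrow> finite (sym_diff (ray_interval V E x \<gamma>) (ray_interval V E y \<gamma>))"
    and "p \<in> V"
  shows "hyperfinite
           (borel_space_of
             (boundary_topology (graph_points V E) (graph_dist V E) (vertex_point p)))
           (orbit_relation G (graph_boundary V E) (boundary_action G V \<phi>))"
proof -
  have graph: "connected_simple_graph V E"
    using assms by (intro connected_simple_graph.intro)
  have act: "group_action G V \<phi>"
    and edges: "\<And>g u v. \<lbrakk>g \<in> carrier G; u \<in> V; v \<in> V\<rbrakk> \<Longrightarrow> {\<phi> g u, \<phi> g v} \<in> E \<longleftrightarrow> {u, v} \<in> E"
    using assms(5) by (auto simp: acts_by_automorphisms_def)
  have free: "\<And>g v. \<lbrakk>g \<in> carrier G; v \<in> V; \<phi> g v = v\<rbrakk> \<Longrightarrow> g = \<one>\<^bsub>G\<^esub>"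
    using assms(6) by (auto simp: acts_freely_def stabilizer_def)
  have "\<forall>Q\<in>orbits G V \<phi>. \<exists>d\<in>V. Q = orbit G \<phi> d"
    by (auto simp: orbits_def)
  then obtain rep where rep: "\<And>Q. Q \<in> orbits G V \<phi> \<Longrightarrow> rep Q \<in> V \<and> Q = orbit G \<phi> (rep Q)"
    by metis
  define F where "F = rep ` orbits G V \<phi>"
  have F: "finite F" "F \<subseteq> V"
    using assms(7) rep by (auto simp: F_def acts_cocompactly_def)
  have cover: "\<exists>g\<in>carrier G. \<exists>d\<in>F. v = \<phi> g d" if v: "v \<in> V" for v
  proof -
    let ?O = "orbit G \<phi> v"
    have O: "?O \<in> orbits G V \<phi>"
      using v by (auto simp: orbits_def)
    have "v \<in> ?O"
      using group_action.orbit_refl[OF act v] .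
    then have "v \<in> orbit G \<phi> (rep ?O)"
      using rep[OF O] by simp
    then show ?thesis
      using O by (auto simp: orbit_def F_def)
  qed
  interpret graph_action G V E \<phi>
    by (intro graph_action.intro graph graph_action_axioms.intro act edges free)
  obtain \<delta> where \<delta>: "thin \<delta>"
    using thin_of_hyperbolic_group[OF assms(1,4) F cover] by blast
  interpret interval_action G V E \<delta> \<phi> p
  proof unfold_locales
    show "\<exists>F. finite F \<and> F \<subseteq> V \<and> (\<forall>v\<in>V. \<exists>g\<in>carrier G. \<exists>d\<in>F. v = \<phi> g d)"
      using F cover by blast
  qed (use assms(4,9) \<delta> edges free assms(8) in auto)
  show ?thesis
    using hyperfinite_boundary_action unfolding boundary_borel_def .
qed

end
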